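(* Let $n\ge1$. For Hilbert spaces $\mathcal E_1$ and $\mathcal E_2$, let $\mathcal Q_i$ be a co-invariant subspace of the Drury-Arveson space $H^2_n(\mathcal E_i)$ for $i=1,2$. Suppose that $X\in\mathcal B(\mathcal Q_1,\mathcal Q_2)$ is a contraction such that $$X(P_{\mathcal Q_1}M_{z_i}|_{\mathcal Q_1})=(P_{\mathcal Q_2}M_{z_i}|_{\mathcal Q_2})X\qquad(i=1,\dots,n).$$ Then there exists a multiplier $\Phi\in\mathcal M_1(H^2_n(\mathcal E_1),H^2_n(\mathcal E_2))$ such that $$X^*=M_\Phi^*|_{\mathcal Q_2}.$$ Moreover, the multiplier $\Phi$ can be taken to be the transfer function of the unitary $U^*$, where $U$ is the unitary described in the context corresponding to $T=(P_{\mathcal Q_1}M_{z_1}|_{\mathcal Q_1},\dots,P_{\mathcal Q_1}M_{z_n}|_{\mathcal Q_1})$ and $S=(P_{\mathcal Q_2}M_{z_1}|_{\mathcal Q_2},\dots,P_{\mathcal Q_2}M_{z_n}|_{\mathcal Q_2})$.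
   Context: All Hilbert spaces are complex; $\mathbb B^n$ is the open unit ball of $\mathbb C^n$. $H^2_n(\mathcal E)$, the $\mathcal E$-valued Drury-Arveson space, is the reproducing kernel Hilbert space of $\mathcal E$-valued holomorphic functions on $\mathbb B^n$ with kernel $(1-\langle\boldsymbol z,\boldsymbol w\rangle)^{-1}I_{\mathcal E}$. $M_{z_i}$ is multiplication by the coordinate $z_i$. A closed subspace $\mathcal Q$ is co-invariant if $M_{z_i}^*\mathcal Q\subseteq\mathcal Q$ for all $i$; $P_{\mathcal Q}$ is the orthogonal projection onto $\mathcal Q$. $\mathcal M_1(H^2_n(\mathcal E_1),H^2_n(\mathcal E_2))$ is the set of contractive multipliers, i.e. holomorphic $\Phi:\mathbb B^n\to\mathcal B(\mathcal E_1,\mathcal E_2)$ such that $M_\Phi:f\mapsto\Phi f$ is a contraction from $H^2_n(\mathcal E_1)$ to $H^2_n(\mathcal E_2)$. For an $n$-tuple $T$ of operators with $\sum_iT_iT_i^*\le I$ (a row contraction), $D_{1,T^*}=(I-\sum_{i=1}^nT_iT_i^* )^{1/2}$ and $\mathcal D_{1,T^*}=\overline{\mathrm{ran}}\,D_{1,T^*}$; the compressions $T$ and $S$ in the statement are commuting row contractions. The unitary $U$: adding an infinite dimensional Hilbert space $\mathcal L$ if necessary and setting $\mathcal R=\overline{\mathrm{ran}}(I-XX^* )\oplus\mathcal L$, one constructs a unitary $U=\begin{bmatrix}A&B\\C&D\end{bmatrix}:\mathcal D_{1,S^*}\oplus\mathcal R^n\to\mathcal D_{1,T^*}\oplus\mathcal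 R$ such that for all $k\in\mathcal Q_2$ $$U\big(D_{1,S^*}k,((I-XX^* )^{1/2}S_1^*k,0_{\mathcal L}),\dots,((I-XX^* )^{1/2}S_n^*k,0_{\mathcal L})\big)=\big(D_{1,T^*}X^*k,((I-XX^* )^{1/2}k,0_{\mathcal L})\big).$$ The transfer function of $U^*$ is $\boldsymbol z\mapsto A^*+C^*(I-ZD^* )^{-1}ZB^*$ $(\boldsymbol z\in\mathbb B^n)$, where $Z=(z_1I_{\mathcal R},\dots,z_nI_{\mathcal R}):\mathcal R^n\to\mathcal R$ is the row operator $Z(h_1,\dots,h_n)=\sum_iz_ih_i$. *)

theory Defs
  imports "HOL-Analysis.Analysis"
begin

section \<open>Complex Hilbert spaces\<close>

class complex_normed_vector = real_normed_vector +
  fixes scaleC :: "complex \<Rightarrow> 'a \<Rightarrow> 'a" (infixr "*\<^sub>C" 75)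
  assumes scaleC_add_right: "a *\<^sub>C (x + y) = a *\<^sub>C x + a *\<^sub>C y"
    and scaleC_add_left: "(a + b) *\<^sub>C x = a *\<^sub>C x + b *\<^sub>C x"
    and scaleC_scaleC: "a *\<^sub>C b *\<^sub>C x = (a * b) *\<^sub>C x"
    and scaleC_of_real: "complex_of_real r *\<^sub>C x = r *\<^sub>R x"
    and norm_scaleC: "norm (a *\<^sub>C x) = cmod a * norm x"

text \<open>The inner product is linear in the first argument. Positivity, definiteness and
  the norm formula come from \<^class>\<open>real_inner\<close> through \<open>Re_cinner\<close>.\<close>

class complex_inner = complex_normed_vector + real_inner +
  fixes cinner :: "'a \<Rightarrow> 'a \<Rightarrow> complex"
  assumes cinner_commute: "cinner x y = cnj (cinner y x)"
    and cinner_add_left: "cinner (x + y) z = cinner x z + cinner y z"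
    and cinner_scaleC_left: "cinner (a *\<^sub>C x) y = a * cinner x y"
    and Re_cinner: "Re (cinner x y) = inner x y"

class chilbert_space = complex_inner + complete_space

global_interpretation complex_vector: vector_space "scaleC :: complex \<Rightarrow> 'a \<Rightarrow> 'a::complex_normed_vector"
  defines csubspace = complex_vector.subspace
    and cspan = complex_vector.span
proof
  show "1 *\<^sub>C x = x" for x :: 'a
    using scaleC_of_real[of 1 x] by simp
qed (simp_all add: scaleC_add_right scaleC_add_left scaleC_scaleC)

subsection \<open>Instances\<close>

instantiation complex :: chilbert_space
begin

definition scaleC_complex :: "complex \<Rightarrow> complex \<Rightarrow> complex"
  where "scaleC_complex a x = a * x"

definition cinner_complex :: "complex \<Rightarrow> complex \<Rightarrow> complex"
  where "cinner_complex x y = x * cnj y"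

instance
  by standard (auto simp: scaleC_complex_def cinner_complex_def algebra_simps norm_mult
      scaleR_conv_of_real inner_complex_def)

end

instantiation prod :: (complex_normed_vector, complex_normed_vector) complex_normed_vector
begin

definition scaleC_prod :: "complex \<Rightarrow> 'a \<times> 'b \<Rightarrow> 'a \<times> 'b"
  where "scaleC_prod a x = (a *\<^sub>C fst x, a *\<^sub>C snd x)"

instance
proof
  fix a :: complex and x :: "'a \<times> 'b"
  have "norm (a *\<^sub>C x) = sqrt ((cmod a)\<^sup>2 * ((norm (fst x))\<^sup>2 + (norm (snd x))\<^sup>2))"
    by (simp add: scaleC_prod_def norm_prod_def norm_scaleC power_mult_distrib distrib_left)
  then show "norm (a *\<^sub>C x) = cmod a * norm x"
    by (simp add: real_sqrt_mult norm_prod_def)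
qed (auto simp: scaleC_prod_def scaleC_add_right scaleC_add_left scaleC_scaleC scaleC_of_real
       scaleR_prod_def)

end

instantiation prod :: (complex_inner, complex_inner) complex_inner
begin

definition cinner_prod :: "'a \<times> 'b \<Rightarrow> 'a \<times> 'b \<Rightarrow> complex"
  where "cinner_prod x y = cinner (fst x) (fst y) + cinner (snd x) (snd y)"

instance
proof
  fix x y :: "'a \<times> 'b"
  show "cinner x y = cnj (cinner y x)"
    unfolding cinner_prod_def complex_cnj_add
    by (intro arg_cong2[where f="(+)"] cinner_commute)
qed (auto simp: cinner_prod_def scaleC_prod_def cinner_add_left cinner_scaleC_left Re_cinner
       inner_prod_def distrib_left)

end

instance prod :: (chilbert_space, chilbert_space) chilbert_space ..

instantiation vec :: (complex_normed_vector, finite) complex_normed_vector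
begin

definition scaleC_vec :: "complex \<Rightarrow> 'a ^ 'b \<Rightarrow> 'a ^ 'b"
  where "scaleC_vec a x = (\<chi> i. a *\<^sub>C (x $ i))"

instance
  by standard (auto simp: scaleC_vec_def vec_eq_iff scaleC_add_right scaleC_add_left scaleC_scaleC
      scaleC_of_real norm_vec_def norm_scaleC L2_set_right_distrib)

end

instantiation vec :: (complex_inner, finite) complex_inner
begin

definition cinner_vec :: "'a ^ 'b \<Rightarrow> 'a ^ 'b \<Rightarrow> complex"
  where "cinner_vec x y = (\<Sum>i\<in>UNIV. cinner (x $ i) (y $ i))"

instance
proof
  fix x y :: "'a ^ 'b"
  show "cinner x y = cnj (cinner y x)"
    unfolding cinner_vec_def cnj_sum by (intro sum.cong refl cinner_commute)
qed (auto simp: cinner_vec_def scaleC_vec_def cinner_add_left cinner_scaleC_left Re_cinner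
       inner_vec_def sum.distrib sum_distrib_left)

end

instance vec :: (chilbert_space, finite) chilbert_space ..

text \<open>\<^typ>\<open>'a \<Rightarrow>\<^sub>L 'b\<close> consists of the real-linear bounded maps; it is a complex normed space under
  multiplication of the values, and the complex-linear maps form a closed complex subspace with the
  operator norm.\<close>

instantiation blinfun :: (real_normed_vector, complex_normed_vector) complex_normed_vector
begin

lift_definition scaleC_blinfun :: "complex \<Rightarrow> 'a \<Rightarrow>\<^sub>L 'b \<Rightarrow> 'a \<Rightarrow>\<^sub>L 'b"
  is "\<lambda>a f x. a *\<^sub>C f x"
proof -
  fix a :: complex and f :: "'a \<Rightarrow> 'b"
  assume f: "bounded_linear f"
  have "bounded_linear (\<lambda>y::'b. a *\<^sub>C y)"
  proof (rule bounded_linear_intro[where K="cmod a"])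
    show "a *\<^sub>C r *\<^sub>R y = r *\<^sub>R a *\<^sub>C y" for r and y :: 'b
      by (simp add: scaleC_of_real[symmetric] scaleC_scaleC mult.commute)
  qed (simp_all add: scaleC_add_right norm_scaleC mult.commute)
  from bounded_linear_compose[OF this f] show "bounded_linear (\<lambda>x. a *\<^sub>C f x)" .
qed

instance
proof
  fix a :: complex and f :: "'a \<Rightarrow>\<^sub>L 'b"
  have le: "norm (b *\<^sub>C g) \<le> cmod b * norm g" for b and g :: "'a \<Rightarrow>\<^sub>L 'b"
    by (rule norm_blinfun_bound)
      (auto simp: scaleC_blinfun.rep_eq norm_scaleC mult.assoc intro!: mult_left_mono norm_blinfun)
  show "norm (a *\<^sub>C f) = cmod a * norm f"
  proof (cases "a = 0")
    case True
    then show ?thesis using le[of a f] by simp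
  next
    case False
    have "f = inverse a *\<^sub>C a *\<^sub>C f"
      using False by transfer (simp add: scaleC_scaleC)
    then have "norm f \<le> cmod (inverse a) * norm (a *\<^sub>C f)"
      using le[of "inverse a" "a *\<^sub>C f"] by simp
    then have "cmod a * norm f \<le> norm (a *\<^sub>C f)"
      using False by (simp add: norm_inverse norm_divide divide_simps mult.commute)
    then show ?thesis using le[of a f] by simp
  qed
qed (transfer; simp add: scaleC_add_right scaleC_add_left scaleC_scaleC scaleC_of_real)+

end

section \<open>Operators between subspaces\<close>

text \<open>The closed subspaces in play (\<open>\<Q>\<^sub>i\<close>, defect spaces, \<open>\<R>\<close>) are sets inside a type of class
  \<^class>\<open>chilbert_space\<close>; an operator on such a subspace is a function of which only the values
  on the subspace matter.\<close>

definition closed_csubspace :: "'a::chilbert_space set \<Rightarrow> bool"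
  where "closed_csubspace V \<longleftrightarrow> csubspace V \<and> closed V"

definition clinear_on :: "'a::complex_normed_vector set \<Rightarrow> ('a \<Rightarrow> 'b::complex_normed_vector) \<Rightarrow> bool"
  where "clinear_on V F \<longleftrightarrow>
    (\<forall>x\<in>V. \<forall>y\<in>V. F (x + y) = F x + F y) \<and> (\<forall>c. \<forall>x\<in>V. F (c *\<^sub>C x) = c *\<^sub>C F x)"

definition bounded_op :: "'a::chilbert_space set \<Rightarrow> 'b::chilbert_space set \<Rightarrow> ('a \<Rightarrow> 'b) \<Rightarrow> bool"
  where "bounded_op V W F \<longleftrightarrow>
    F \<in> V \<rightarrow> W \<and> clinear_on V F \<and> (\<exists>K. \<forall>x\<in>V. norm (F x) \<le> K * norm x)"

definition contraction_op :: "'a::chilbert_space set \<Rightarrow> 'b::chilbert_space set \<Rightarrow> ('a \<Rightarrow> 'b) \<Rightarrow> bool"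
  where "contraction_op V W F \<longleftrightarrow> bounded_op V W F \<and> (\<forall>x\<in>V. norm (F x) \<le> norm x)"

definition unitary_op :: "'a::chilbert_space set \<Rightarrow> 'b::chilbert_space set \<Rightarrow> ('a \<Rightarrow> 'b) \<Rightarrow> bool"
  where "unitary_op V W F \<longleftrightarrow>
    bij_betw F V W \<and> clinear_on V F \<and> (\<forall>x\<in>V. \<forall>y\<in>V. cinner (F x) (F y) = cinner x y)"

text \<open>\<open>adj V F\<close> is the adjoint of the operator \<open>F\<close> with domain \<open>V\<close>.\<close>

definition adj :: "'a::chilbert_space set \<Rightarrow> ('a \<Rightarrow> 'b::chilbert_space) \<Rightarrow> 'b \<Rightarrow> 'a"
  where "adj V F y = (THE x. x \<in> V \<and> (\<forall>v\<in>V. cinner (F v) y = cinner v x))"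

definition proj :: "'a::chilbert_space set \<Rightarrow> 'a \<Rightarrow> 'a"
  where "proj V x = (THE p. p \<in> V \<and> (\<forall>v\<in>V. cinner (x - p) v = 0))"

text \<open>The positive square root of a positive operator on \<open>V\<close>, set to \<open>0\<close> off \<open>V\<close> so as to be a
  unique function.\<close>

definition sqrt_op :: "'a::chilbert_space set \<Rightarrow> ('a \<Rightarrow> 'a) \<Rightarrow> 'a \<Rightarrow> 'a"
  where "sqrt_op V P = (THE R. bounded_op V V R \<and> (\<forall>x\<in>V. cinner (R x) x \<in> \<real>\<^sub>\<ge>\<^sub>0) \<and>
    (\<forall>x\<in>V. R (R x) = P x) \<and> (\<forall>x. x \<notin> V \<longrightarrow> R x = 0))"

definition defect :: "'a::chilbert_space set \<Rightarrow> ('n::finite \<Rightarrow> 'a \<Rightarrow> 'a) \<Rightarrow> 'a \<Rightarrow> 'a"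
  where "defect V T = sqrt_op V (\<lambda>x. x - (\<Sum>i\<in>UNIV. T i (adj V (T i) x)))"

definition defect_space :: "'a::chilbert_space set \<Rightarrow> ('n::finite \<Rightarrow> 'a \<Rightarrow> 'a) \<Rightarrow> 'a set"
  where "defect_space V T = closure (defect V T ` V)"

section \<open>The Drury-Arveson space\<close>

abbreviation unit_ball :: "(complex ^ 'n) set"
  where "unit_ball \<equiv> ball 0 1"

definition holomorphic_ball :: "(complex ^ 'n \<Rightarrow> 'b::complex_normed_vector) \<Rightarrow> bool"
  where "holomorphic_ball f \<longleftrightarrow> (\<forall>z\<in>unit_ball. \<exists>f'. (f has_derivative f') (at z) \<and>
    (\<forall>c v. f' (c *\<^sub>C v) = c *\<^sub>C f' v))"

text \<open>\<open>drury_arveson ev\<close>: the Hilbert space \<open>'h\<close>, whose elements are regarded as \<open>'e\<close>-valued functions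
  on the ball by means of \<open>ev\<close>, is the reproducing kernel Hilbert space of holomorphic functions
  with kernel \<open>(1 - \<langle>z,w\<rangle>)\<inverse> I\<close>. A space with a given kernel is unique up to a unitary that
  commutes with the evaluations. Values of \<open>ev f\<close> outside the ball are irrelevant.\<close>

definition drury_arveson ::
    "('h::chilbert_space \<Rightarrow> complex ^ 'n::finite \<Rightarrow> 'e::chilbert_space) \<Rightarrow> bool"
  where "drury_arveson ev \<longleftrightarrow>
    (\<forall>z\<in>unit_ball. clinear_on UNIV (\<lambda>f. ev f z)) \<and>
    (\<forall>f g. (\<forall>z\<in>unit_ball. ev f z = ev g z) \<longrightarrow> f = g) \<and>
    (\<forall>f. holomorphic_ball (ev f)) \<and>
    (\<forall>w\<in>unit_ball. \<forall>e. \<exists>k.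
      (\<forall>z\<in>unit_ball. ev k z = inverse (1 - cinner z w) *\<^sub>C e) \<and>
      (\<forall>f. cinner f k = cinner (ev f w) e))"

text \<open>The operator \<open>f \<mapsto> \<Phi> f\<close> of pointwise multiplication, as a map of Hilbert spaces.\<close>

definition mult_op ::
    "('h1 \<Rightarrow> complex ^ 'n::finite \<Rightarrow> 'e1) \<Rightarrow> ('h2 \<Rightarrow> complex ^ 'n \<Rightarrow> 'e2) \<Rightarrow>
     (complex ^ 'n \<Rightarrow> 'e1 \<Rightarrow> 'e2) \<Rightarrow> 'h1 \<Rightarrow> 'h2"
  where "mult_op ev1 ev2 \<Phi> f = (THE g. \<forall>z\<in>unit_ball. ev2 g z = \<Phi> z (ev1 f z))"

definition coord_mult ::
    "('h \<Rightarrow> complex ^ 'n::finite \<Rightarrow> 'e::chilbert_space) \<Rightarrow> 'n \<Rightarrow> 'h \<Rightarrow> 'h"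
  where "coord_mult ev i = mult_op ev ev (\<lambda>z e. (z $ i) *\<^sub>C e)"

definition coinvariant ::
    "('h::chilbert_space \<Rightarrow> complex ^ 'n::finite \<Rightarrow> 'e::chilbert_space) \<Rightarrow> 'h set \<Rightarrow> bool"
  where "coinvariant ev Q \<longleftrightarrow>
    closed_csubspace Q \<and> (\<forall>i. \<forall>f\<in>Q. adj UNIV (coord_mult ev i) f \<in> Q)"

definition compression ::
    "('h::chilbert_space \<Rightarrow> complex ^ 'n::finite \<Rightarrow> 'e::chilbert_space) \<Rightarrow> 'h set \<Rightarrow> 'n \<Rightarrow> 'h \<Rightarrow> 'h"
  where "compression ev Q i f = proj Q (coord_mult ev i f)"

definition contractive_multiplier ::
    "('h1::chilbert_space \<Rightarrow> complex ^ 'n::finite \<Rightarrow> 'e1::chilbert_space) \<Rightarrow>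
     ('h2::chilbert_space \<Rightarrow> complex ^ 'n \<Rightarrow> 'e2::chilbert_space) \<Rightarrow>
     (complex ^ 'n \<Rightarrow> 'e1 \<Rightarrow>\<^sub>L 'e2) \<Rightarrow> bool"
  where "contractive_multiplier ev1 ev2 \<Phi> \<longleftrightarrow>
    (\<forall>z\<in>unit_ball. clinear_on UNIV (blinfun_apply (\<Phi> z))) \<and>
    holomorphic_ball \<Phi> \<and>
    (\<forall>f. \<exists>g. (\<forall>z\<in>unit_ball. ev2 g z = \<Phi> z (ev1 f z)) \<and> norm g \<le> norm f)"

section \<open>The unitary colligation and its transfer function\<close>

text \<open>Here \<open>T\<close>, \<open>S\<close> act on \<open>Q1\<close>, \<open>Q2\<close> and \<open>X\<close> maps \<open>Q1\<close> to \<open>Q2\<close>. The auxiliary space \<open>\<L>\<close> is a closed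
  subspace \<open>L\<close> of an arbitrary Hilbert space type, and direct sums are subsets of product types.\<close>

definition star_defect ::
    "'h1::chilbert_space set \<Rightarrow> 'h2::chilbert_space set \<Rightarrow> ('h1 \<Rightarrow> 'h2) \<Rightarrow> 'h2 \<Rightarrow> 'h2"
  where "star_defect Q1 Q2 X = sqrt_op Q2 (\<lambda>k. k - X (adj Q1 X k))"

definition state_space ::
    "'h1::chilbert_space set \<Rightarrow> 'h2::chilbert_space set \<Rightarrow> ('h1 \<Rightarrow> 'h2) \<Rightarrow>
     'l::chilbert_space set \<Rightarrow> ('h2 \<times> 'l) set"
  where "state_space Q1 Q2 X L = closure ((\<lambda>k. k - X (adj Q1 X k)) ` Q2) \<times> L"

definition power_space :: "'r set \<Rightarrow> ('r ^ 'n) set"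
  where "power_space R = {v. \<forall>i. v $ i \<in> R}"

definition lifting_unitary ::
    "'h1::chilbert_space set \<Rightarrow> 'h2::chilbert_space set \<Rightarrow> ('h1 \<Rightarrow> 'h2) \<Rightarrow>
     ('n::finite \<Rightarrow> 'h1 \<Rightarrow> 'h1) \<Rightarrow> ('n \<Rightarrow> 'h2 \<Rightarrow> 'h2) \<Rightarrow> 'l::chilbert_space set \<Rightarrow>
     ('h2 \<times> (('h2 \<times> 'l) ^ 'n) \<Rightarrow> 'h1 \<times> ('h2 \<times> 'l)) \<Rightarrow> bool"
  where "lifting_unitary Q1 Q2 X T S L U \<longleftrightarrow>
    unitary_op (defect_space Q2 S \<times> power_space (state_space Q1 Q2 X L))
      (defect_space Q1 T \<times> state_space Q1 Q2 X L) U \<and>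
    (\<forall>k\<in>Q2. U (defect Q2 S k, \<chi> i. (star_defect Q1 Q2 X (adj Q2 (S i) k), 0)) =
      (defect Q1 T (adj Q1 X k), (star_defect Q1 Q2 X k, 0)))"

text \<open>For \<open>U = [A B; C D] : DS \<oplus> R\<^sup>n \<rightarrow> DT \<oplus> R\<close>, the transfer function of \<open>U\<^sup>*\<close> at \<open>z\<close>, that is
  \<open>A\<^sup>* + C\<^sup>* (I - Z D\<^sup>*)\<inverse> Z B\<^sup>* : DT \<rightarrow> DS\<close>.\<close>

definition transfer_adj ::
    "'s::chilbert_space set \<Rightarrow> 'r::chilbert_space set \<Rightarrow> ('s \<times> ('r ^ 'n::finite) \<Rightarrow> 't::chilbert_space \<times> 'r) \<Rightarrow>
     complex ^ 'n \<Rightarrow> 't \<Rightarrow> 's"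
  where "transfer_adj DS R U z y =
    (let A = (\<lambda>x. fst (U (x, 0)));
         B = (\<lambda>v. fst (U (0, v)));
         C = (\<lambda>x. snd (U (x, 0)));
         D = (\<lambda>v. snd (U (0, v)));
         Z = (\<lambda>v. \<Sum>i\<in>UNIV. (z $ i) *\<^sub>C (v $ i))
     in adj DS A y + adj DS C
          (inv_into R (\<lambda>r. r - Z (adj (power_space R) D r)) (Z (adj (power_space R) B y))))"

text \<open>For \<open>T\<close> the compression of the coordinate multipliers to a co-invariant \<open>Q\<close> one has
  \<open>\<parallel>D f\<parallel> = \<parallel>f 0\<parallel>\<close> for \<open>f \<in> Q\<close>, with \<open>D\<close> the defect operator, so \<open>D f \<mapsto> f 0\<close> extends to a unique
  linear isometry of the defect space into the coefficient space. It is this isometry that identifies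
  the defect space with a subspace of the coefficient space.\<close>

definition defect_embedding ::
    "('h::chilbert_space \<Rightarrow> complex ^ 'n::finite \<Rightarrow> 'e::chilbert_space) \<Rightarrow> 'h set \<Rightarrow> ('h \<Rightarrow> 'e) \<Rightarrow> bool"
  where "defect_embedding ev Q V \<longleftrightarrow>
    clinear_on (defect_space Q (compression ev Q)) V \<and>
    (\<forall>x\<in>defect_space Q (compression ev Q). norm (V x) = norm x) \<and>
    (\<forall>f\<in>Q. V (defect Q (compression ev Q) f) = ev f 0)"

text \<open>\<open>\<Phi>\<close> is the transfer function of \<open>U\<^sup>*\<close>, read as a function into operators between the
  coefficient spaces through the embeddings above (and \<open>0\<close> on the orthogonal complement of the
  embedded defect space).\<close>

definition is_transfer_multiplier ::
    "('h1::chilbert_space \<Rightarrow> complex ^ 'n::finite \<Rightarrow> 'e1::chilbert_space) \<Rightarrow>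
     ('h2::chilbert_space \<Rightarrow> complex ^ 'n \<Rightarrow> 'e2::chilbert_space) \<Rightarrow>
     'h1 set \<Rightarrow> 'h2 set \<Rightarrow> ('h1 \<Rightarrow> 'h2) \<Rightarrow> 'l::chilbert_space set \<Rightarrow>
     ('h2 \<times> (('h2 \<times> 'l) ^ 'n) \<Rightarrow> 'h1 \<times> ('h2 \<times> 'l)) \<Rightarrow>
     (complex ^ 'n \<Rightarrow> 'e1 \<Rightarrow>\<^sub>L 'e2) \<Rightarrow> bool"
  where "is_transfer_multiplier ev1 ev2 Q1 Q2 X L U \<Phi> \<longleftrightarrow>
    (\<exists>V1 V2. defect_embedding ev1 Q1 V1 \<and> defect_embedding ev2 Q2 V2 \<and>
      (\<forall>z\<in>unit_ball. \<forall>e. \<Phi> z e =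
        V2 (transfer_adj (defect_space Q2 (compression ev2 Q2)) (state_space Q1 Q2 X L) U z
          (adj (defect_space Q1 (compression ev1 Q1)) V1 e))))"

end

theory Submission
  imports Defs
begin

text \<open>Writing \<open>K(z,w) = (1 - \<langle>z,w\<rangle>)\<inverse>\<close>, the unitarity of \<open>U\<close> says that the transfer function \<open>\<Phi>\<close> of \<open>U\<^sup>*\<close>
  satisfies \<open>K(z,w) (I - \<Phi>(z) \<Phi>(w)\<^sup>*) = r(z)\<^sup>* r(w)\<close> for the resolvent-type function
  \<open>r(w) = (I - D W\<^sup>*)\<inverse> C\<close>. So \<open>K(\<cdot>,w) e \<mapsto> (K(\<cdot>,w) \<Phi>(w)\<^sup>* e, r(w) e)\<close> extends to an isometry \<open>(G, \<Gamma>)\<close> (up to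
  the part of the coefficient space that is orthogonal to the defect space), and \<open>G = M\<^sub>\<Phi>\<^sup>*\<close>.
  Checking on kernels gives \<open>U (k(0), (\<Gamma> M\<^sub>i\<^sup>* k)\<^sub>i) = ((G k)(0), \<Gamma> k)\<close>. On \<open>\<Q>\<^sub>2\<close> this is the relation that
  defines \<open>U\<close>, with \<open>G\<close> and \<open>\<Gamma>\<close> in place of \<open>X\<^sup>*\<close> and \<open>(I - X X\<^sup>*)\<^bsup>1/2\<^esup>\<close>. The difference \<open>F\<close> of the two pairs
  satisfies \<open>\<parallel>F k\<parallel>\<^sup>2 = \<Sum>\<^sub>i \<parallel>F M\<^sub>i\<^sup>* k\<parallel>\<^sup>2\<close>, and it vanishes because the tuple \<open>(M\<^sub>i\<^sup>*)\<close> is pure.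

  Such a \<open>U\<close> exists with \<open>\<L> = \<H>\<^sub>1 \<oplus> \<H>\<^sub>2\<close>, the sum of the two Drury-Arveson spaces: the orthogonal
  complements of the domain and of the range of the isometry to be extended embed isometrically into
  each other.\<close>

section \<open>Complex Hilbert spaces\<close>

text \<open>The unitary \<open>U\<close> may be any one that obeys the prescribed relation, and off
  the subspace of that relation nothing is known about it. The model (G, \<Gamma>) is therefore
  built from \<open>U\<close> alone, on the whole second Drury-Arveson space, and compared with
  \<open>X\<close> afterwards, by feeding both pairs to the same \<open>U\<close>.

  The norm identity for F has two sources. Subtracting the two relations, with \<open>U\<close>
  preserving norms, gives |\<Delta> k|^2 + |(H k)(0)|^2 = \<Sum> |\<Delta> M_i^* k|^2 for the state
  error \<Delta> and the function error H. The identity |h|^2 = |h(0)|^2 + \<Sum> |M_i^* h|^2 for h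
  = H k, together with M_i^* H k = H M_i^* k, turns the value at 0 into norms of H.

  The auxiliary space has to absorb finite powers of itself, as the complements to be matched lie in
  finite sums of copies of the spaces at hand. A Drury-Arveson space with nonzero coefficients is
  infinite dimensional, so the sum of the two spaces is either zero or infinite dimensional, and in
  both cases its finite powers embed in it.\<close>

lemma cinner_add_right: "cinner x (y + z) = cinner x y + cinner x z"
  by (metis cinner_add_left cinner_commute complex_cnj_add)

lemma cinner_scaleC_right: "cinner x (a *\<^sub>C y) = cnj a * cinner x y"
  by (metis cinner_scaleC_left cinner_commute complex_cnj_mult)

lemma Im_cinner: "Im (cinner x y) = inner x (\<i> *\<^sub>C y)"
  by (simp add: Re_cinner[symmetric] cinner_scaleC_right)

lemma bounded_bilinear_cinner: "bounded_bilinear (cinner :: 'a::complex_inner \<Rightarrow> 'a \<Rightarrow> complex)"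
proof
  fix x x' y y' :: 'a and r :: real
  show "cinner (x + x') y = cinner x y + cinner x' y" by (rule cinner_add_left)
  show "cinner x (y + y') = cinner x y + cinner x y'" by (rule cinner_add_right)
  show "cinner (r *\<^sub>R x) y = r *\<^sub>R cinner x y"
    using cinner_scaleC_left[of "of_real r" x y] by (simp add: scaleC_of_real scaleR_conv_of_real)
  show "cinner x (r *\<^sub>R y) = r *\<^sub>R cinner x y"
    using cinner_scaleC_right[of x "of_real r" y] by (simp add: scaleC_of_real scaleR_conv_of_real)
  \<comment> \<open>Real and imaginary parts are bounded separately by the real Cauchy-Schwarz
    inequality, hence the factor 2. The bound serves continuity, so it need not be sharp.\<close>
  have "norm (cinner x y) \<le> norm x * norm y * 2" for x y :: 'a
  proof -
    have "norm (cinner x y) \<le> \<bar>inner x y\<bar> + \<bar>inner x (\<i> *\<^sub>C y)\<bar>"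
      using cmod_le[of "cinner x y"] by (simp add: Re_cinner Im_cinner)
    also have "\<dots> \<le> norm x * norm y + norm x * norm (\<i> *\<^sub>C y)"
      by (intro add_mono Cauchy_Schwarz_ineq2)
    finally show ?thesis by (simp add: norm_scaleC)
  qed
  then show "\<exists>K. \<forall>x y :: 'a. norm (cinner x y) \<le> norm x * norm y * K" by blast
qed

interpretation cinner: bounded_bilinear cinner
  by (rule bounded_bilinear_cinner)

lemma bounded_bilinear_scaleC: "bounded_bilinear (scaleC :: complex \<Rightarrow> 'a::complex_normed_vector \<Rightarrow> 'a)"
proof
  fix a b :: complex and x y :: 'a and r :: real
  show "(r *\<^sub>R a) *\<^sub>C x = r *\<^sub>R a *\<^sub>C x"
    by (metis scaleC_of_real scaleC_scaleC scaleR_conv_of_real)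
  show "a *\<^sub>C r *\<^sub>R x = r *\<^sub>R a *\<^sub>C x"
    by (metis scaleC_of_real scaleC_scaleC mult.commute)
  show "\<exists>K. \<forall>a x. norm (a *\<^sub>C x :: 'a) \<le> norm a * norm x * K"
    by (intro exI[of _ 1]) (simp add: norm_scaleC)
qed (simp_all add: scaleC_add_left scaleC_add_right)

interpretation scaleC: bounded_bilinear scaleC
  by (rule bounded_bilinear_scaleC)

lemma cinner_self: "cinner x x = complex_of_real ((norm x)\<^sup>2)"
proof -
  have "Im (cinner x x) = 0"
    using cinner_commute[of x x] by (metis cnj.simps(2) neg_equal_zero)
  then show ?thesis
    by (simp add: complex_eq_iff Re_cinner power2_norm_eq_inner)
qed

lemma norm_eq_if_cinner_eq: "cinner x x = cinner y y \<Longrightarrow> norm x = norm y"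
  by (metis cinner_self norm_ge_zero of_real_eq_iff power2_eq_iff_nonneg)

lemma cinner_zero_commute: "cinner x y = 0 \<longleftrightarrow> cinner y x = 0"
  by (metis cinner_commute complex_cnj_zero)

section \<open>Closed complex subspaces and linear maps defined on them\<close>

lemma csubspace_closed_ops:
  assumes "csubspace V"
  shows "0 \<in> V" "x \<in> V \<Longrightarrow> y \<in> V \<Longrightarrow> x + y \<in> V" "x \<in> V \<Longrightarrow> y \<in> V \<Longrightarrow> x - y \<in> V"
    "x \<in> V \<Longrightarrow> a *\<^sub>C x \<in> V" "x \<in> V \<Longrightarrow> r *\<^sub>R x \<in> V" "x \<in> V \<Longrightarrow> - x \<in> V"
  using assms
  by (auto simp: complex_vector.subspace_0 complex_vector.subspace_add complex_vector.subspace_diff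
      complex_vector.subspace_scale scaleC_of_real[symmetric] complex_vector.subspace_neg)

lemma csubspaceI:
  assumes "0 \<in> V" "\<And>x y. x \<in> V \<Longrightarrow> y \<in> V \<Longrightarrow> x + y \<in> V" "\<And>a x. x \<in> V \<Longrightarrow> a *\<^sub>C x \<in> V"
  shows "csubspace V"
  using assms by (auto simp: complex_vector.subspace_def)

lemma closed_csubspaceD:
  assumes "closed_csubspace V"
  shows "csubspace V" "closed V"
  using assms by (auto simp: closed_csubspace_def)

lemma closed_csubspace_UNIV: "closed_csubspace UNIV"
  by (simp add: closed_csubspace_def)

lemma clinear_on_ops:
  assumes "clinear_on V F" "csubspace V"
  shows "F 0 = 0" "x \<in> V \<Longrightarrow> y \<in> V \<Longrightarrow> F (x + y) = F x + F y"
    "x \<in> V \<Longrightarrow> y \<in> V \<Longrightarrow> F (x - y) = F x - F y"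
    "x \<in> V \<Longrightarrow> F (a *\<^sub>C x) = a *\<^sub>C F x" "x \<in> V \<Longrightarrow> F (r *\<^sub>R x) = r *\<^sub>R F x"
proof -
  note V = csubspace_closed_ops[OF assms(2)]
  have add: "x \<in> V \<Longrightarrow> y \<in> V \<Longrightarrow> F (x + y) = F x + F y" for x y
    using assms(1) by (simp add: clinear_on_def)
  have scale: "x \<in> V \<Longrightarrow> F (a *\<^sub>C x) = a *\<^sub>C F x" for x a
    using assms(1) by (simp add: clinear_on_def)
  show "F 0 = 0" using scale[of 0 0] V(1) by simp
  show "x \<in> V \<Longrightarrow> y \<in> V \<Longrightarrow> F (x + y) = F x + F y" by (rule add)
  show "x \<in> V \<Longrightarrow> y \<in> V \<Longrightarrow> F (x - y) = F x - F y"
    using add[of "x - y" y] V(3)[of x y] by (simp add: algebra_simps)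
  show "x \<in> V \<Longrightarrow> F (a *\<^sub>C x) = a *\<^sub>C F x" by (rule scale)
  show "x \<in> V \<Longrightarrow> F (r *\<^sub>R x) = r *\<^sub>R F x" using scale[of x "of_real r"] by (simp add: scaleC_of_real)
qed

lemma clinear_onI:
  assumes "\<And>x y. x \<in> V \<Longrightarrow> y \<in> V \<Longrightarrow> F (x + y) = F x + F y"
    and "\<And>c x. x \<in> V \<Longrightarrow> F (c *\<^sub>C x) = c *\<^sub>C F x"
  shows "clinear_on V F"
  using assms by (simp add: clinear_on_def)

lemma csubspace_vimage_clinear:
  assumes "csubspace W" "clinear_on UNIV F"
  shows "csubspace {x. F x \<in> W}"
  using assms by (intro csubspaceI) (auto simp: clinear_on_ops csubspace_closed_ops)

lemma clinear_on_image_csubspace: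
  assumes "csubspace V" "clinear_on V F"
  shows "csubspace (F ` V)"
proof (rule csubspaceI)
  note V = csubspace_closed_ops[OF assms(1)] and F = clinear_on_ops[OF assms(2,1)]
  show "0 \<in> F ` V" using V(1) F(1) by (metis image_eqI)
  show "x + y \<in> F ` V" if "x \<in> F ` V" "y \<in> F ` V" for x y
    using that V(2) F(2) by (auto simp: image_iff) metis
  show "a *\<^sub>C x \<in> F ` V" if "x \<in> F ` V" for a x
    using that V(4) F(4) by (auto simp: image_iff) metis
qed

lemma closed_csubspace_closure:
  assumes "csubspace V"
  shows "closed_csubspace (closure V)"
  unfolding closed_csubspace_def
proof (intro conjI csubspaceI closed_closure)
  note V = csubspace_closed_ops[OF assms]
  show "0 \<in> closure V" using V(1) closure_subset by blast
  show "x + y \<in> closure V" if xy: "x \<in> closure V" "y \<in> closure V" for x y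
  proof -
    obtain f g where "\<forall>n. f n \<in> V" "f \<longlonglongrightarrow> x" "\<forall>n. g n \<in> V" "g \<longlonglongrightarrow> y"
      using xy by (auto simp: closure_sequential)
    then have "(\<lambda>n. f n + g n) \<longlonglongrightarrow> x + y" "\<forall>n. f n + g n \<in> V"
      using V(2) by (auto intro: tendsto_add)
    then show ?thesis by (auto simp: closure_sequential)
  qed
  show "a *\<^sub>C x \<in> closure V" if x: "x \<in> closure V" for a x
  proof -
    obtain f where "\<forall>n. f n \<in> V" "f \<longlonglongrightarrow> x"
      using x by (auto simp: closure_sequential)
    then have "(\<lambda>n. a *\<^sub>C f n) \<longlonglongrightarrow> a *\<^sub>C x" "\<forall>n. a *\<^sub>C f n \<in> V"
      using V(4) by (auto intro: scaleC.tendsto tendsto_const)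
    then show ?thesis by (auto simp: closure_sequential)
  qed
qed

lemma closed_csubspace_closure_cspan: "closed_csubspace (closure (cspan G))"
  by (intro closed_csubspace_closure complex_vector.subspace_span)

lemma closure_cspan_superset: "G \<subseteq> closure (cspan G)"
  using closure_subset complex_vector.span_superset by blast

lemma closure_cspan_minimal:
  assumes "G \<subseteq> V" "closed_csubspace V"
  shows "closure (cspan G) \<subseteq> V"
  using assms by (intro closure_minimal complex_vector.span_minimal) (auto dest: closed_csubspaceD)

lemma closed_csubspace_orthogonal:
  shows "closed_csubspace {x. cinner x y = 0}"
  unfolding closed_csubspace_def
  by (intro conjI csubspaceI closed_Collect_eq continuous_intros cinner.continuous_on)
    (auto simp: cinner_add_left cinner_scaleC_left cinner.zero_left)

lemma closed_csubspace_Int: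
  "closed_csubspace V \<Longrightarrow> closed_csubspace W \<Longrightarrow> closed_csubspace (V \<inter> W)"
  by (auto simp: closed_csubspace_def complex_vector.subspace_inter)

lemma closed_csubspace_orthocomplement:
  "closed_csubspace {x. \<forall>y\<in>S. cinner x y = 0}"
proof -
  have "{x. \<forall>y\<in>S. cinner x y = 0} = (\<Inter>y\<in>S. {x. cinner x y = 0})" by auto
  then show ?thesis
    using closed_csubspace_orthogonal unfolding closed_csubspace_def
    by (auto intro!: complex_vector.subspace_Inter)
qed

lemma orthogonal_closure_cspan:
  fixes x y :: "'a::chilbert_space"
  assumes "\<And>x. x \<in> G \<Longrightarrow> cinner x y = 0" "x \<in> closure (cspan G)"
  shows "cinner x y = 0"
  using closure_cspan_minimal[OF _ closed_csubspace_orthogonal, of G y] assms by auto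

text \<open>An operator here is a total function that is linear only on \<open>V\<close>, so the
  continuity rules of \<open>bounded_linear\<close> do not apply. The bound is used on the
  differences \<open>s n - l\<close>, which lie in \<open>V\<close>.\<close>

lemma clinear_on_tendsto:
  assumes V: "csubspace V" and F: "clinear_on V F"
    and bd: "\<And>x. x \<in> V \<Longrightarrow> norm (F x) \<le> K * norm x"
    and s: "\<And>n. s n \<in> V" "l \<in> V" "s \<longlonglongrightarrow> l"
  shows "(\<lambda>n. F (s n)) \<longlonglongrightarrow> F l"
proof -
  have "(\<lambda>n. F (s n) - F l) \<longlonglongrightarrow> 0"
  proof (rule Lim_null_comparison)
    show "\<forall>\<^sub>F n in sequentially. norm (F (s n) - F l) \<le> K * norm (s n - l)"
    proof (intro always_eventually allI)
      show "norm (F (s n) - F l) \<le> K * norm (s n - l)" for n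
        using bd[OF csubspace_closed_ops(3)[OF V s(1) s(2)]]
        by (simp add: clinear_on_ops(3)[OF F V s(1) s(2)])
    qed
    have "(\<lambda>n. K * norm (s n - l)) \<longlonglongrightarrow> K * norm (l - l)"
      by (intro tendsto_intros s(3))
    then show "(\<lambda>n. K * norm (s n - l)) \<longlonglongrightarrow> 0" by simp
  qed
  then show ?thesis using LIM_zero_iff by blast
qed

lemma Cauchy_dominated:
  assumes "Cauchy s" "\<And>m n. m \<le> n \<Longrightarrow> dist (t n) (t m) \<le> c * dist (s n) (s m)"
  shows "Cauchy t"
  unfolding Cauchy_altdef2
proof (intro allI impI)
  fix e :: real assume "e > 0"
  \<comment> \<open>Dividing by \<open>\<bar>c\<bar> + 1\<close> avoids a case split on the sign of
    \<open>c\<close>.\<close>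
  then have "e / (\<bar>c\<bar> + 1) > 0" by simp
  then obtain N where N: "\<forall>n\<ge>N. dist (s n) (s N) < e / (\<bar>c\<bar> + 1)"
    using assms(1) unfolding Cauchy_altdef2 by blast
  have "dist (t n) (t N) < e" if "n \<ge> N" for n
  proof -
    have "dist (t n) (t N) \<le> (\<bar>c\<bar> + 1) * dist (s n) (s N)"
      by (rule order_trans[OF assms(2)[OF that] mult_right_mono]) simp_all
    also have "\<dots> < e" using N that by (simp add: pos_less_divide_eq mult.commute)
    finally show ?thesis .
  qed
  then show "\<exists>N. \<forall>n\<ge>N. dist (t n) (t N) < e" by blast
qed

text \<open>A map that is bounded below lifts a convergent sequence of values to a Cauchy sequence
  of arguments; its limit lies in \<open>V\<close>, and \<open>upper\<close> identifies the image of
  that limit.\<close>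

lemma closed_csubspace_image:
  assumes V: "closed_csubspace V" and F: "clinear_on V F"
    and lower: "\<And>x. x \<in> V \<Longrightarrow> norm x \<le> c * norm (F x)"
    and upper: "\<And>x. x \<in> V \<Longrightarrow> norm (F x) \<le> K * norm x"
  shows "closed_csubspace (F ` V)"
  unfolding closed_csubspace_def
proof
  note V' = csubspace_closed_ops[OF closed_csubspaceD(1)[OF V]]
  note F' = clinear_on_ops[OF F closed_csubspaceD(1)[OF V]]
  show "csubspace (F ` V)"
    using V F by (intro clinear_on_image_csubspace) (auto dest: closed_csubspaceD)
  show "closed (F ` V)"
    unfolding closed_sequential_limits
  proof (intro allI impI, elim conjE)
    fix s l assume s: "\<forall>n. s n \<in> F ` V" and l: "s \<longlonglongrightarrow> l"
    from s have "\<forall>n. \<exists>y. y \<in> V \<and> s n = F y" by auto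
    then obtain t where "\<forall>n. t n \<in> V \<and> s n = F (t n)"
      by (rule choice[THEN exE])
    then have t: "\<And>n. t n \<in> V" "\<And>n. s n = F (t n)" by auto
    have st: "norm (t m - t n) \<le> c * norm (s m - s n)" for m n
      using lower[of "t m - t n"] V'(3)[OF t(1) t(1), of m n] F'(3)[OF t(1) t(1), of m n]
      by (simp add: t(2))
    have "Cauchy t"
      by (rule Cauchy_dominated[OF LIMSEQ_imp_Cauchy[OF l], of t c]) (simp add: st dist_norm)
    then obtain x where x: "t \<longlonglongrightarrow> x" by (auto simp: Cauchy_convergent_iff convergent_def)
    have xV: "x \<in> V"
      using closed_csubspaceD(2)[OF V] t(1) x closed_sequentially by blast
    have "(\<lambda>n. F (t n)) \<longlonglongrightarrow> F x"
      by (rule clinear_on_tendsto[OF closed_csubspaceD(1)[OF V] F upper t(1) xV x])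
    moreover have "s = (\<lambda>n. F (t n))" using t(2) by (rule ext)
    ultimately have "s \<longlonglongrightarrow> F x" by simp
    then have "l = F x" using l LIMSEQ_unique by blast
    then show "l \<in> F ` V" using xV by blast
  qed
qed

section \<open>Riesz representation, adjoints and projections\<close>

lemma quadratic_nonneg_imp_zero:
  fixes a b :: real
  assumes "\<And>t. 0 \<le> 2 * t * a + t\<^sup>2 * b"
  shows "a = 0"
proof (rule ccontr)
  assume a: "a \<noteq> 0"
  \<comment> \<open>The minimiser \<open>- a / b\<close> presupposes \<open>b > 0\<close>. With a
    positive \<open>c > b\<close> in place of \<open>b\<close> the value at \<open>- a / c\<close>
    is still negative.\<close>
  define c where "c = \<bar>b\<bar> + 1"
  have c: "c > 0" "b < c" by (auto simp: c_def)
  have "0 \<le> 2 * (- a / c) * a + (- a / c)\<^sup>2 * b" by (rule assms)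
  also have "\<dots> = (a\<^sup>2 / c) * (b / c - 2)"
    using c by (simp add: field_simps power2_eq_square)
  also have "\<dots> < 0"
    using a c by (intro mult_pos_neg) (auto simp: field_simps)
  finally show False by simp
qed

text \<open>The representing vector is the minimiser over \<open>V\<close> of |v|^2 - 2 Re (\<phi>
  v), which is |v - x|^2 up to a constant if \<open>x\<close> represents \<phi>. Minimising
  sequences are Cauchy by the parallelogram law, and stationarity at the minimum is the
  representation property. This needs no projection theorem; \<open>proj\<close> is obtained from it
  later.\<close>

lemma riesz_closed_csubspace:
  fixes V :: "'a::chilbert_space set" and \<phi> :: "'a \<Rightarrow> complex"
  assumes V: "closed_csubspace V" and lin: "clinear_on V \<phi>"
    and bd: "\<And>v. v \<in> V \<Longrightarrow> norm (\<phi> v) \<le> K * norm v"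
  shows "\<exists>x\<in>V. \<forall>v\<in>V. \<phi> v = cinner v x"
proof -
  note V' = csubspace_closed_ops[OF closed_csubspaceD(1)[OF V]]
  note L = clinear_on_ops[OF lin closed_csubspaceD(1)[OF V]]
  define J where "J = (\<lambda>v. (norm v)\<^sup>2 - 2 * Re (\<phi> v))"
  define m where "m = Inf (J ` V)"
  have lb: "- K\<^sup>2 \<le> J v" if "v \<in> V" for v
  proof -
    have "Re (\<phi> v) \<le> K * norm v"
      using bd[OF that] complex_Re_le_cmod[of "\<phi> v"] by linarith
    moreover have "0 \<le> (norm v - K)\<^sup>2" by simp
    ultimately show ?thesis by (simp add: J_def power2_diff algebra_simps)
  qed
  then have bdd: "bdd_below (J ` V)" unfolding bdd_below_def by blast
  have mJ: "m \<le> J v" if "v \<in> V" for v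
    unfolding m_def by (intro cInf_lower bdd) (use that in auto)
  have "\<exists>v\<in>V. J v < m + 1 / real (Suc n)" for n
    using cInf_lessD[of "J ` V" "m + 1 / real (Suc n)"] V'(1) unfolding m_def by auto
  then have "\<forall>n. \<exists>v. v \<in> V \<and> J v < m + 1 / real (Suc n)" by blast
  then obtain s where "\<forall>n. s n \<in> V \<and> J (s n) < m + 1 / real (Suc n)"
    by (rule choice[THEN exE])
  then have sV: "\<And>n. s n \<in> V" and s: "\<And>n. J (s n) < m + 1 / real (Suc n)" by auto
  \<comment> \<open>The linear part of \<open>J\<close> cancels, so \<open>J\<close> obeys the
    parallelogram law with the coefficients of the squared norm.\<close>
  have par: "(norm (x - y))\<^sup>2 = 2 * J x + 2 * J y - 4 * J ((1/2) *\<^sub>R (x + y))"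
    if "x \<in> V" "y \<in> V" for x y
    using that V' L by (simp add: J_def power2_norm_eq_inner inner_add_left inner_add_right
        inner_diff_left inner_diff_right inner_commute algebra_simps)
  have diff: "(norm (s i - s j))\<^sup>2 \<le> 2 / real (Suc i) + 2 / real (Suc j)" for i j
  proof -
    have "m \<le> J ((1/2) *\<^sub>R (s i + s j))" using sV V' by (intro mJ) auto
    then show ?thesis using par[OF sV[of i] sV[of j]] s[of i] s[of j]
      by simp
  qed
  have "Cauchy s"
    unfolding Cauchy_altdef2
  proof (intro allI impI)
    fix e :: real assume e: "e > 0"
    obtain N where N: "4 / e\<^sup>2 < real N" using reals_Archimedean2 by blast
    have "4 < e\<^sup>2 * real N" using N e by (simp add: field_simps)
    also have "\<dots> \<le> e\<^sup>2 * real (Suc N)" by (intro mult_left_mono) auto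
    finally have N': "4 / real (Suc N) < e\<^sup>2" by (simp add: field_simps)
    have "dist (s n) (s N) < e" if "n \<ge> N" for n
    proof -
      have "2 / real (Suc n) \<le> 2 / real (Suc N)" using that by (simp add: field_simps)
      then have "(norm (s n - s N))\<^sup>2 < e\<^sup>2" using diff[of n N] N' by simp
      then show ?thesis using e power_less_imp_less_base by (fastforce simp: dist_norm)
    qed
    then show "\<exists>N. \<forall>n\<ge>N. dist (s n) (s N) < e" by blast
  qed
  then obtain x where x: "s \<longlonglongrightarrow> x" by (auto simp: Cauchy_convergent_iff convergent_def)
  have xV: "x \<in> V"
    using closed_csubspaceD(2)[OF V] sV x closed_sequentially by blast
  have "(\<lambda>n. \<phi> (s n)) \<longlonglongrightarrow> \<phi> x"
    by (rule clinear_on_tendsto[OF closed_csubspaceD(1)[OF V] lin bd sV xV x])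
  then have Jx: "(\<lambda>n. J (s n)) \<longlonglongrightarrow> J x"
    unfolding J_def by (intro tendsto_intros x)
  have "(\<lambda>n. m + 1 / real (Suc n)) \<longlonglongrightarrow> m + 0"
    by (intro tendsto_intros) (use LIMSEQ_inverse_real_of_nat in \<open>simp add: inverse_eq_divide\<close>)
  then have "J x \<le> m"
    using LIMSEQ_le[OF Jx, of _ m] s by (auto simp: less_imp_le)
  then have min: "J x \<le> J v" if "v \<in> V" for v using mJ[OF that] by simp
  \<comment> \<open>First variation of \<open>J\<close> at its minimiser along real multiples of
    \<open>v\<close>.\<close>
  have Re: "Re (\<phi> v) = inner v x" if v: "v \<in> V" for v
  proof -
    have "0 \<le> 2 * t * (inner v x - Re (\<phi> v)) + t\<^sup>2 * (norm v)\<^sup>2" for t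
      using min[of "x + t *\<^sub>R v"] v xV V' L unfolding J_def power2_norm_eq_inner
      by (simp add: inner_add_left inner_add_right inner_commute algebra_simps power2_eq_square)
    then show ?thesis using quadratic_nonneg_imp_zero by fastforce
  qed
  have "\<phi> v = cinner v x" if v: "v \<in> V" for v
  proof (rule complex_eqI)
    show "Re (\<phi> v) = Re (cinner v x)" by (simp add: Re v Re_cinner)
    \<comment> \<open>Multiplication by \<open>- \<i>\<close> turns the imaginary part into a real
      part, so the identity for real parts covers it.\<close>
    have "Im (\<phi> v) = Re (\<phi> ((- \<i>) *\<^sub>C v))" by (simp only: L(4)[OF v] scaleC_complex_def) simp
    also have "\<dots> = Re (cinner ((- \<i>) *\<^sub>C v) x)" by (simp only: Re[OF V'(4)[OF v]] Re_cinner)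
    also have "\<dots> = Im (cinner v x)" by (simp only: cinner_scaleC_left) simp
    finally show "Im (\<phi> v) = Im (cinner v x)" .
  qed
  then show ?thesis using xV by blast
qed

lemma cinner_ext_on:
  assumes "csubspace V" "x \<in> V" "y \<in> V" "\<And>v. v \<in> V \<Longrightarrow> cinner v x = cinner v y"
  shows "x = y"
proof -
  have "x - y \<in> V" using csubspace_closed_ops(3)[OF assms(1)] assms by blast
  then have "cinner (x - y) (x - y) = 0"
    using assms(4)[of "x - y"] by (simp add: cinner.diff_right)
  then show ?thesis by (simp add: cinner_self)
qed

lemma cinner_ext: "(\<And>v. cinner v x = cinner v y) \<Longrightarrow> x = y"
  by (rule cinner_ext_on[of UNIV]) auto

lemma adj_eqI:
  assumes "csubspace V" "x \<in> V" "\<And>v. v \<in> V \<Longrightarrow> cinner (F v) y = cinner v x"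
  shows "adj V F y = x"
  unfolding adj_def
proof (rule the_equality)
  show "x' = x" if "x' \<in> V \<and> (\<forall>v\<in>V. cinner (F v) y = cinner v x')" for x'
    using that assms by (intro cinner_ext_on[OF assms(1)]) auto
qed (use assms in auto)

context
  fixes V :: "'a::chilbert_space set" and F :: "'a \<Rightarrow> 'b::chilbert_space" and K :: real
  assumes V: "closed_csubspace V" and F: "clinear_on V F"
    and bd: "\<And>v. v \<in> V \<Longrightarrow> norm (F v) \<le> K * norm v"
begin

lemma adj_props: "adj V F y \<in> V \<and> (\<forall>v\<in>V. cinner (F v) y = cinner v (adj V F y))"
proof -
  note V' = closed_csubspaceD[OF V]
  obtain B where B: "B > 0" "\<And>x y :: 'b. norm (cinner x y) \<le> norm x * norm y * B"
    using cinner.pos_bounded by blast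
  have "clinear_on V (\<lambda>v. cinner (F v) y)"
    using clinear_on_ops[OF F V'(1)]
    by (intro clinear_onI) (auto simp: cinner_add_left cinner_scaleC_left scaleC_complex_def)
  moreover have "norm (cinner (F v) y) \<le> K * norm y * B * norm v" if "v \<in> V" for v
  proof -
    have "norm (F v) * (norm y * B) \<le> K * norm v * (norm y * B)"
      using B(1) bd[OF that] by (intro mult_right_mono) auto
    then show ?thesis using B(2)[of "F v" y] by (simp add: mult_ac)
  qed
  ultimately obtain x where "x \<in> V" "\<forall>v\<in>V. cinner (F v) y = cinner v x"
    using riesz_closed_csubspace[OF V] by blast
  then show ?thesis using adj_eqI[OF V'(1), of x F y] by auto
qed

lemma adj_in: "adj V F y \<in> V"
  and cinner_adj: "v \<in> V \<Longrightarrow> cinner v (adj V F y) = cinner (F v) y"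
  using adj_props by auto

lemma cinner_adj_left: "v \<in> V \<Longrightarrow> cinner (adj V F y) v = cinner y (F v)"
  by (metis cinner_adj cinner_commute)

lemma clinear_adj: "clinear_on W (adj V F)"
proof (rule clinear_onI)
  note V' = csubspace_closed_ops[OF closed_csubspaceD(1)[OF V]]
  show "adj V F (x + y) = adj V F x + adj V F y" for x y
    using V' adj_in closed_csubspaceD(1)[OF V]
    by (intro adj_eqI) (auto simp: cinner_adj cinner_add_right)
  show "adj V F (c *\<^sub>C x) = c *\<^sub>C adj V F x" for c x
    using V' adj_in closed_csubspaceD(1)[OF V]
    by (intro adj_eqI) (auto simp: cinner_adj cinner_scaleC_right)
qed

text \<open>The estimate is |F^* y|^2 = Re <F F^* y, y> with the bound of \<open>F\<close> applied
  at F^* y. The sign of \<open>K\<close> does not follow from \<open>bd\<close>: on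
  \<open>V = {0}\<close> every \<open>K\<close> is a bound, while the conclusion fails for negative
  \<open>K\<close> and nonzero \<open>y\<close>.\<close>

lemma norm_adj_le:
  assumes "K \<ge> 0"
  shows "norm (adj V F y) \<le> K * norm y"
proof (cases "adj V F y = 0")
  case False
  have "(norm (adj V F y))\<^sup>2 = inner (F (adj V F y)) y"
    using cinner_adj[OF adj_in[of y], of y] by (metis Re_cinner power2_norm_eq_inner)
  also have "\<dots> \<le> norm (F (adj V F y)) * norm y" by (rule norm_cauchy_schwarz)
  also have "\<dots> \<le> K * norm (adj V F y) * norm y"
    using bd[OF adj_in] by (simp add: mult_right_mono)
  finally show ?thesis using False by (simp add: power2_eq_square mult_ac)
qed (use assms in simp)

end

text \<open>The orthogonal projection is the adjoint of the inclusion of \<open>V\<close>, so its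
  existence, linearity and contractivity are instances of facts on adjoints.\<close>

lemma proj_eq_adj: "proj V = adj V (\<lambda>x. x)"
proof -
  have "cinner (x - p) v = 0 \<longleftrightarrow> cinner v x = cinner v p" for x p v :: 'a
    by (subst cinner_zero_commute) (simp add: cinner.diff_right)
  then show ?thesis unfolding proj_def adj_def by presburger
qed

lemma closed_csubspace_proj:
  assumes "closed_csubspace V"
  shows "proj V x \<in> V" "v \<in> V \<Longrightarrow> cinner v (proj V x) = cinner v x"
    "v \<in> V \<Longrightarrow> cinner (proj V x) v = cinner x v"
    "clinear_on W (proj V)" "norm (proj V x) \<le> norm x"
    "v \<in> V \<Longrightarrow> proj V v = v"
proof -
  have id: "clinear_on V (\<lambda>x. x)" by (simp add: clinear_on_def)
  note * = assms id
  show "proj V x \<in> V" unfolding proj_eq_adj by (rule adj_in[OF *, of 1]) auto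
  show "v \<in> V \<Longrightarrow> cinner v (proj V x) = cinner v x"
    unfolding proj_eq_adj by (rule cinner_adj[OF *, of 1]) auto
  show "v \<in> V \<Longrightarrow> cinner (proj V x) v = cinner x v"
    unfolding proj_eq_adj by (rule cinner_adj_left[OF *, of 1]) auto
  show "clinear_on W (proj V)" unfolding proj_eq_adj by (rule clinear_adj[OF *, of 1]) auto
  show "norm (proj V x) \<le> norm x"
    unfolding proj_eq_adj using norm_adj_le[OF *, of 1] by auto
  show "v \<in> V \<Longrightarrow> proj V v = v"
    unfolding proj_eq_adj using closed_csubspaceD[OF assms] by (intro adj_eqI) auto
qed

lemma closed_csubspace_eqI:
  assumes "closed_csubspace N" "csubspace W" "N \<subseteq> W"
    and "\<And>y. y \<in> W \<Longrightarrow> (\<And>x. x \<in> N \<Longrightarrow> cinner x y = 0) \<Longrightarrow> y = 0"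
  shows "N = W"
proof (rule subset_antisym)
  show "W \<subseteq> N"
  proof
    fix y assume y: "y \<in> W"
    have "y - proj N y = 0"
      using assms(3) y closed_csubspace_proj(1,2)[OF assms(1)]
      by (intro assms(4) csubspace_closed_ops[OF assms(2)]) (auto simp: cinner.diff_right)
    then show "y \<in> N" using closed_csubspace_proj(1)[OF assms(1), of y] by simp
  qed
qed fact

text \<open>The device for extending a property from generators: if the vectors that have it form
  such a preimage, it is enough to check a set with dense span. The case \<open>M = {0}\<close>
  extends linear identities.\<close>

lemma closed_csubspace_preimage:
  fixes V :: "'a::chilbert_space set" and F :: "'a \<Rightarrow> 'b::chilbert_space"
  assumes V: "closed_csubspace V" and F: "clinear_on V F"
    and bd: "\<And>x. x \<in> V \<Longrightarrow> norm (F x) \<le> K * norm x" and M: "closed_csubspace M"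
  shows "closed_csubspace {x\<in>V. F x \<in> M}"
  unfolding closed_csubspace_def
proof (intro conjI csubspaceI)
  note V' = csubspace_closed_ops[OF closed_csubspaceD(1)[OF V]]
  note M' = csubspace_closed_ops[OF closed_csubspaceD(1)[OF M]]
  note F' = clinear_on_ops[OF F closed_csubspaceD(1)[OF V]]
  show "0 \<in> {x\<in>V. F x \<in> M}" using V'(1) F'(1) M'(1) by simp
  show "x + y \<in> {x\<in>V. F x \<in> M}" if "x \<in> {x\<in>V. F x \<in> M}" "y \<in> {x\<in>V. F x \<in> M}" for x y
    using that V'(2) F'(2) M'(2) by simp
  show "a *\<^sub>C x \<in> {x\<in>V. F x \<in> M}" if "x \<in> {x\<in>V. F x \<in> M}" for a x
    using that V'(4) F'(4) M'(4) by simp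
  show "closed {x\<in>V. F x \<in> M}"
    unfolding closed_sequential_limits
  proof (intro allI impI, elim conjE)
    fix s l assume s: "\<forall>n. s n \<in> {x\<in>V. F x \<in> M}" and l: "s \<longlonglongrightarrow> l"
    have lV: "l \<in> V"
      by (rule closed_sequentially[OF closed_csubspaceD(2)[OF V] _ l]) (use s in auto)
    have "(\<lambda>n. F (s n)) \<longlonglongrightarrow> F l"
      by (rule clinear_on_tendsto[OF closed_csubspaceD(1)[OF V] F bd _ lV l]) (use s in auto)
    then have "F l \<in> M"
      by (rule closed_sequentially[OF closed_csubspaceD(2)[OF M], rotated]) (use s in auto)
    then show "l \<in> {x\<in>V. F x \<in> M}" using lV by simp
  qed
qed

text \<open>The unitary is read off the closure of the span of all pairs \<open>(h i, g i)\<close>, which is a graph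
  because the two components of each of its elements have the same norm.\<close>

lemma gram_unitary:
  fixes h :: "'i \<Rightarrow> 'a::chilbert_space" and g :: "'i \<Rightarrow> 'b::chilbert_space"
  assumes gram: "\<And>i j. i \<in> I \<Longrightarrow> j \<in> I \<Longrightarrow> cinner (h i) (h j) = cinner (g i) (g j)"
  obtains F where "unitary_op (closure (cspan (h ` I))) (closure (cspan (g ` I))) F"
    and "\<And>i. i \<in> I \<Longrightarrow> F (h i) = g i"
proof -
  define S where "S = (\<lambda>i. (h i, g i)) ` I"
  define G where "G = closure (cspan S)"
  have G: "closed_csubspace G" unfolding G_def by (rule closed_csubspace_closure_cspan)
  note G' = csubspace_closed_ops[OF closed_csubspaceD(1)[OF G]]
  have SG: "S \<subseteq> G" unfolding G_def by (rule closure_cspan_superset)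
  have cl: "closed_csubspace {p. cinner (fst p) (fst q) = cinner (snd p) (snd q)}"
    for q :: "'a \<times> 'b"
    unfolding closed_csubspace_def
    by (intro conjI csubspaceI closed_Collect_eq continuous_intros cinner.continuous_on)
      (auto simp: cinner_add_left cinner_scaleC_left cinner.zero_left scaleC_prod_def)
  \<comment> \<open>The Gram identity is extended one variable at a time: here \<open>q\<close> is
    still a generator, in the next step it is arbitrary.\<close>
  have 1: "cinner (fst p) (fst q) = cinner (snd p) (snd q)" if "p \<in> G" "q \<in> S" for p q
  proof -
    have "S \<subseteq> {p. cinner (fst p) (fst q) = cinner (snd p) (snd q)}"
      using gram that(2) by (auto simp: S_def)
    then show ?thesis
      using closure_cspan_minimal[OF _ cl[of q], of S] that(1) unfolding G_def by blast
  qed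
  have 2: "cinner (fst p) (fst q) = cinner (snd p) (snd q)" if "p \<in> G" "q \<in> G" for p q
  proof -
    have "S \<subseteq> {p'. cinner (fst p') (fst p) = cinner (snd p') (snd p)}"
      using 1[OF that(1)] by (auto) (metis cinner_commute fst_conv snd_conv)
    then show ?thesis
      using closure_cspan_minimal[OF _ cl[of p], of S] that(2) unfolding G_def
      by (metis (mono_tags, lifting) cinner_commute mem_Collect_eq subsetD)
  qed
  have nrm: "norm (fst p) = norm (snd p)" if "p \<in> G" for p
    using 2[OF that that] by (rule norm_eq_if_cinner_eq)
  \<comment> \<open>As the components have equal norm, both coordinate projections are bounded below
    on \<open>G\<close> with constant 2, so their images are closed.\<close>
  have le: "norm p \<le> 2 * norm (fst p)" "norm p \<le> 2 * norm (snd p)" if "p \<in> G" for p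
    using norm_Pair_le[of "fst p" "snd p"] nrm[OF that] by auto
  have cf: "closed_csubspace (fst ` G)"
    using le(1) by (intro closed_csubspace_image[OF G, of fst 2 1])
      (auto simp: clinear_on_def scaleC_prod_def norm_fst_le)
  have cs: "closed_csubspace (snd ` G)"
    using le(2) by (intro closed_csubspace_image[OF G, of snd 2 1])
      (auto simp: clinear_on_def scaleC_prod_def norm_snd_le)
  have "closed_csubspace {p\<in>UNIV. fst p \<in> closure (cspan (h ` I))}"
    by (rule closed_csubspace_preimage[OF closed_csubspace_UNIV _ _ closed_csubspace_closure_cspan, of _ 1])
      (auto simp: clinear_on_def scaleC_prod_def norm_fst_le)
  then have "G \<subseteq> {p\<in>UNIV. fst p \<in> closure (cspan (h ` I))}"
    unfolding G_def using closure_cspan_superset[of "h ` I"]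
    by (intro closure_cspan_minimal) (auto simp: S_def image_subset_iff)
  moreover have "h ` I \<subseteq> fst ` G"
    using SG by (force simp: S_def)
  ultimately have f: "fst ` G = closure (cspan (h ` I))"
    using closure_cspan_minimal[OF _ cf] by blast
  have "closed_csubspace {p\<in>UNIV. snd p \<in> closure (cspan (g ` I))}"
    by (rule closed_csubspace_preimage[OF closed_csubspace_UNIV _ _ closed_csubspace_closure_cspan, of _ 1])
      (auto simp: clinear_on_def scaleC_prod_def norm_snd_le)
  then have "G \<subseteq> {p\<in>UNIV. snd p \<in> closure (cspan (g ` I))}"
    unfolding G_def using closure_cspan_superset[of "g ` I"]
    by (intro closure_cspan_minimal) (auto simp: S_def image_subset_iff)
  moreover have "g ` I \<subseteq> snd ` G"
    using SG by (force simp: S_def)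
  ultimately have s: "snd ` G = closure (cspan (g ` I))"
    using closure_cspan_minimal[OF _ cs] by blast
  define F where "F x = (SOME y. (x, y) \<in> G)" for x
  have FG: "(x, F x) \<in> G" if "x \<in> fst ` G" for x
  proof -
    from that obtain y where "(x, y) \<in> G" by auto
    then show ?thesis unfolding F_def by (rule someI)
  qed
  \<comment> \<open>The difference of two points over \<open>x\<close> is
    \<open>(0, y - y')\<close>, and its components have equal norm.\<close>
  have uniq: "y = y'" if "(x, y) \<in> G" "(x, y') \<in> G" for x y y'
    using nrm[OF G'(3)[OF that]] G'(1) by simp
  have inj: "x = x'" if "(x, y) \<in> G" "(x', y) \<in> G" for x x' y
    using nrm[OF G'(3)[OF that]] G'(1) by simp
  note f' = csubspace_closed_ops[OF closed_csubspaceD(1)[OF cf]]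
  have "unitary_op (fst ` G) (snd ` G) F"
    unfolding unitary_op_def
  proof (intro conjI ballI)
    show "bij_betw F (fst ` G) (snd ` G)"
      unfolding bij_betw_def
    proof
      show "inj_on F (fst ` G)"
        by (rule inj_onI) (metis FG inj)
      show "F ` fst ` G = snd ` G"
      proof (rule subset_antisym; rule subsetI)
        show "y \<in> snd ` G" if "y \<in> F ` fst ` G" for y
          using that FG by (metis imageE image_eqI snd_conv)
        show "y \<in> F ` fst ` G" if "y \<in> snd ` G" for y
        proof -
          from that obtain p where "p \<in> G" "y = snd p" by auto
          then have p: "(fst p, y) \<in> G" "fst p \<in> fst ` G" by auto
          then show ?thesis using uniq[OF FG[OF p(2)] p(1)] by blast
        qed
      qed
    qed
    show "clinear_on (fst ` G) F"
    proof (rule clinear_onI)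
      show "F (x + y) = F x + F y" if "x \<in> fst ` G" "y \<in> fst ` G" for x y
        using uniq[OF FG[OF f'(2)[OF that]]] G'(2)[OF FG[OF that(1)] FG[OF that(2)]] by simp
      show "F (c *\<^sub>C x) = c *\<^sub>C F x" if "x \<in> fst ` G" for x c
        using uniq[OF FG[OF f'(4)[OF that]]] G'(4)[OF FG[OF that], of c]
        by (simp add: scaleC_prod_def)
    qed
    show "cinner (F x) (F y) = cinner x y" if "x \<in> fst ` G" "y \<in> fst ` G" for x y
      using 2[OF FG[OF that(1)] FG[OF that(2)]] by simp
  qed
  moreover have "F (h i) = g i" if "i \<in> I" for i
  proof -
    have *: "(h i, g i) \<in> G" using SG that by (auto simp: S_def)
    then have "h i \<in> fst ` G" by force
    then show ?thesis using uniq[OF FG *] by blast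
  qed
  ultimately show ?thesis using that unfolding f s by blast
qed

section \<open>Positive square roots\<close>

text \<open>The quadratic form is real at \<open>x + y\<close> and at
  \<open>\<i> *\<^sub>C x + y\<close>. The first fact compares the imaginary parts of the
  sesquilinear form, the second its real parts, which is where complex scalars enter.\<close>

lemma symmetric_if_positive:
  fixes V :: "'a::chilbert_space set"
  assumes V: "csubspace V" and R: "clinear_on V R"
    and pos: "\<And>x. x \<in> V \<Longrightarrow> cinner (R x) x \<in> \<real>\<^sub>\<ge>\<^sub>0"
    and x: "x \<in> V" and y: "y \<in> V"
  shows "cinner (R x) y = cinner x (R y)"
proof -
  note V' = csubspace_closed_ops[OF V] and R' = clinear_on_ops[OF R V]
  have Im0: "Im (cinner (R u) u) = 0" if "u \<in> V" for u
    using pos[OF that] by (auto simp: nonneg_Reals_def)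
  have 1: "Im (cinner (R u) v) + Im (cinner (R v) u) = 0" if "u \<in> V" "v \<in> V" for u v
  proof -
    have "cinner (R (u + v)) (u + v) =
        cinner (R u) u + cinner (R v) v + (cinner (R u) v + cinner (R v) u)"
      using that by (simp add: R'(2) cinner_add_left cinner_add_right)
    then show ?thesis
      using Im0[OF that(1)] Im0[OF that(2)] Im0[OF V'(2)[OF that]] by simp
  qed
  have "cinner (R (\<i> *\<^sub>C x)) y = \<i> * cinner (R x) y"
    using x by (simp add: R'(4) cinner_scaleC_left)
  moreover have "cinner (R y) (\<i> *\<^sub>C x) = - \<i> * cinner (R y) x"
    by (simp add: cinner_scaleC_right)
  ultimately have "Re (cinner (R x) y) = Re (cinner (R y) x)"
    using 1[OF V'(4)[OF x, of \<i>] y] by simp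
  then have "cinner (R x) y = cnj (cinner (R y) x)"
    using 1[OF x y] by (simp add: complex_eq_iff)
  then show ?thesis by (metis cinner_commute)
qed

text \<open>Cauchy-Schwarz for a degenerate form: at \<open>y + t *\<^sub>R R y\<close> the form is
  nonnegative for all real \<open>t\<close> and has no constant term, so its linear coefficient, a
  multiple of |R y|^2, is 0.\<close>

lemma positive_zero_form:
  fixes V :: "'a::chilbert_space set"
  assumes V: "csubspace V" and R: "clinear_on V R" and RV: "R \<in> V \<rightarrow> V"
    and pos: "\<And>x. x \<in> V \<Longrightarrow> cinner (R x) x \<in> \<real>\<^sub>\<ge>\<^sub>0"
    and y: "y \<in> V" "inner (R y) y = 0"
  shows "R y = 0"
proof -
  note V' = csubspace_closed_ops[OF V] and R' = clinear_on_ops[OF R V]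
  have sym: "inner (R u) v = inner u (R v)" if "u \<in> V" "v \<in> V" for u v
    using symmetric_if_positive[OF V R pos that] by (metis Re_cinner)
  have nn: "0 \<le> inner (R u) u" if "u \<in> V" for u
    using pos[OF that] by (auto simp: nonneg_Reals_def Re_cinner[symmetric])
  define u where "u = R y"
  have u: "u \<in> V" using RV y by (auto simp: u_def)
  have "inner (R y) u = 0"
  proof (rule quadratic_nonneg_imp_zero)
    fix t
    have "0 \<le> inner (R (y + t *\<^sub>R u)) (y + t *\<^sub>R u)"
      using u y V' by (intro nn) auto
    also have "\<dots> = 2 * t * inner (R y) u + t\<^sup>2 * inner (R u) u"
      using u y V' R' sym[OF u y(1)]
      by (simp add: inner_add_left inner_add_right inner_commute power2_eq_square algebra_simps)
    finally show "0 \<le> 2 * t * inner (R y) u + t\<^sup>2 * inner (R u) u" .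
  qed
  then show ?thesis by (simp add: u_def)
qed

text \<open>The square root of \<open>I - B\<close> is \<open>I - Y\<close>, where \<open>Y = (B + Y\<^sup>2) / 2\<close> is the limit of \<open>sqrt_iter B\<close>. The
  increments of the iterates are dominated in norm by those of the case \<open>B = 1\<close>, which is
  \<open>sqrt_scalar\<close>.\<close>

fun sqrt_scalar :: "nat \<Rightarrow> real" where
  "sqrt_scalar 0 = 0"
| "sqrt_scalar (Suc n) = (1 + (sqrt_scalar n)\<^sup>2) / 2"

lemma sqrt_scalar_bounds: "0 \<le> sqrt_scalar n" "sqrt_scalar n \<le> 1"
proof (induction n)
  case (Suc n)
  case 1 show ?case by simp
  case 2 show ?case using Suc power_le_one[of "sqrt_scalar n" 2] by simp
qed simp_all

lemma sqrt_scalar_mono: "sqrt_scalar n \<le> sqrt_scalar (Suc n)"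
  using zero_le_power2[of "sqrt_scalar n - 1"] by (simp add: power2_diff)

lemma convergent_sqrt_scalar: "convergent sqrt_scalar"
  by (rule Bseq_mono_convergent)
    (auto intro!: BseqI'[of _ 1] lift_Suc_mono_le[of sqrt_scalar] sqrt_scalar_mono
      simp: sqrt_scalar_bounds abs_of_nonneg simp del: sqrt_scalar.simps)

fun sqrt_iter :: "('a::real_vector \<Rightarrow> 'a) \<Rightarrow> nat \<Rightarrow> 'a \<Rightarrow> 'a" where
  "sqrt_iter B 0 x = 0"
| "sqrt_iter B (Suc n) x = (1/2) *\<^sub>R (B x + sqrt_iter B n (sqrt_iter B n x))"

context
  fixes V :: "'a::chilbert_space set" and B :: "'a \<Rightarrow> 'a"
  assumes V: "closed_csubspace V" and B: "clinear_on V B" and BV: "\<And>x. x \<in> V \<Longrightarrow> B x \<in> V"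
    and B1: "\<And>x. x \<in> V \<Longrightarrow> norm (B x) \<le> norm x"
    and Bsym: "\<And>x y. x \<in> V \<Longrightarrow> y \<in> V \<Longrightarrow> cinner (B x) y = cinner x (B y)"
begin

private abbreviation "Y \<equiv> sqrt_iter B"

private lemmas V' = csubspace_closed_ops[OF closed_csubspaceD(1)[OF V]]
private lemmas B' = clinear_on_ops[OF B closed_csubspaceD(1)[OF V]]

lemma sqrt_iter_in: "x \<in> V \<Longrightarrow> Y n x \<in> V"
  by (induction n arbitrary: x) (auto intro!: V' BV)

lemma sqrt_iter_add: "x \<in> V \<Longrightarrow> y \<in> V \<Longrightarrow> Y n (x + y) = Y n x + Y n y"
  by (induction n arbitrary: x y) (auto simp: B' sqrt_iter_in algebra_simps)

lemma sqrt_iter_scaleC: "x \<in> V \<Longrightarrow> Y n (c *\<^sub>C x) = c *\<^sub>C Y n x"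
  by (induction n arbitrary: x)
    (auto simp: B' sqrt_iter_in scaleC_add_right scaleC.scaleR_right)

lemma clinear_on_sqrt_iter: "clinear_on V (Y n)"
  by (intro clinear_onI sqrt_iter_add sqrt_iter_scaleC)

private lemmas Y' = clinear_on_ops[OF clinear_on_sqrt_iter closed_csubspaceD(1)[OF V]]

lemma sqrt_iter_sym: "x \<in> V \<Longrightarrow> y \<in> V \<Longrightarrow> cinner (Y n x) y = cinner x (Y n y)"
  by (induction n arbitrary: x y)
    (auto simp: cinner.zero_left cinner.zero_right cinner.scaleR_left cinner.scaleR_right
      cinner_add_left cinner_add_right Bsym sqrt_iter_in)

text \<open>Each iterate is a polynomial in \<open>B\<close> and commutes with whatever commutes
  with \<open>B\<close>. This serves for the iterates among themselves and, in the limit, for a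
  competing square root.\<close>

lemma sqrt_iter_commute_general:
  assumes S: "clinear_on V S" "\<And>x. x \<in> V \<Longrightarrow> S x \<in> V" "\<And>x. x \<in> V \<Longrightarrow> S (B x) = B (S x)"
  shows "x \<in> V \<Longrightarrow> S (Y n x) = Y n (S x)"
proof (induction n arbitrary: x)
  case 0
  then show ?case using clinear_on_ops(1)[OF S(1) closed_csubspaceD(1)[OF V]] by simp
next
  case (Suc n)
  note S' = clinear_on_ops[OF S(1) closed_csubspaceD(1)[OF V]]
  show ?case
    using Suc by (simp add: S' S sqrt_iter_in BV V')
qed

lemma sqrt_iter_commute: "x \<in> V \<Longrightarrow> Y m (Y n x) = Y n (Y m x)"
  by (rule sqrt_iter_commute_general[OF clinear_on_sqrt_iter sqrt_iter_in])
    (auto intro!: sqrt_iter_commute_general[OF B BV, symmetric])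

lemma norm_sqrt_iter_le: "x \<in> V \<Longrightarrow> norm (Y n x) \<le> sqrt_scalar n * norm x"
proof (induction n arbitrary: x)
  case (Suc n)
  have "norm (Y n (Y n x)) \<le> sqrt_scalar n * (sqrt_scalar n * norm x)"
    using Suc.IH[OF sqrt_iter_in[OF Suc.prems, of n]]
      mult_left_mono[OF Suc.IH[OF Suc.prems] sqrt_scalar_bounds(1)[of n]] by linarith
  then have "norm (B x + Y n (Y n x)) \<le> norm x + (sqrt_scalar n)\<^sup>2 * norm x"
    using norm_triangle_le[of "B x" "Y n (Y n x)"] B1[OF Suc.prems]
    by (simp add: power2_eq_square mult_ac)
  then have "2 * norm (Y (Suc n) x) \<le> norm x + (sqrt_scalar n)\<^sup>2 * norm x" by simp
  also have "\<dots> = 2 * (sqrt_scalar (Suc n) * norm x)" by (simp add: field_simps)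
  finally show ?case by linarith
qed simp

text \<open>By commutativity the difference of the two squares factors as
  \<open>Y (Suc n) - Y n\<close> applied to \<open>Y (Suc n) + Y n\<close>. The scalar recursion has
  the same factorisation, and its factors bound the norms of these.\<close>

lemma norm_sqrt_iter_diff:
  "x \<in> V \<Longrightarrow> norm (Y (Suc n) x - Y n x) \<le> (sqrt_scalar (Suc n) - sqrt_scalar n) * norm x"
proof (induction n arbitrary: x)
  case 0
  then show ?case using B1 by simp
next
  case (Suc n)
  let ?s = "Y (Suc n) x + Y n x"
  have in1: "Y (Suc n) x \<in> V" "Y n x \<in> V" by (rule sqrt_iter_in[OF Suc.prems])+
  have s: "?s \<in> V" by (rule V'(2)[OF in1])
  define p where "p = Y (Suc n) (Y (Suc n) x)"
  define q where "q = Y n (Y n x)"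
  have a: "Y (Suc (Suc n)) x = (1/2) *\<^sub>R (B x + p)" "Y (Suc n) x = (1/2) *\<^sub>R (B x + q)"
    unfolding p_def q_def by (rule sqrt_iter.simps(2))+
  have "Y (Suc n) ?s - Y n ?s = p - q"
    unfolding p_def q_def Y'(2)[OF in1] sqrt_iter_commute[OF Suc.prems, of "Suc n" n]
    by (simp del: sqrt_iter.simps)
  then have eq: "Y (Suc (Suc n)) x - Y (Suc n) x = (1/2) *\<^sub>R (Y (Suc n) ?s - Y n ?s)"
    by (simp only: a scaleR_diff_right[symmetric]) simp
  have ns: "norm ?s \<le> (sqrt_scalar (Suc n) + sqrt_scalar n) * norm x"
    using norm_triangle_ineq[of "Y (Suc n) x" "Y n x"] norm_sqrt_iter_le[OF Suc.prems, of n]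
      norm_sqrt_iter_le[OF Suc.prems, of "Suc n"]
    by (simp del: sqrt_iter.simps sqrt_scalar.simps add: algebra_simps)
  have "norm (Y (Suc n) ?s - Y n ?s) \<le> (sqrt_scalar (Suc n) - sqrt_scalar n) * norm ?s"
    by (rule Suc.IH[OF s])
  also have "\<dots> \<le> (sqrt_scalar (Suc n) - sqrt_scalar n) *
      ((sqrt_scalar (Suc n) + sqrt_scalar n) * norm x)"
    using sqrt_scalar_mono[of n] by (intro mult_left_mono ns) simp
  also have "\<dots> = 2 * ((sqrt_scalar (Suc (Suc n)) - sqrt_scalar (Suc n)) * norm x)"
  proof -
    have "sqrt_scalar (Suc (Suc n)) - sqrt_scalar (Suc n) =
        ((sqrt_scalar (Suc n))\<^sup>2 - (sqrt_scalar n)\<^sup>2) / 2"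
      by (subst sqrt_scalar.simps(2), subst (2) sqrt_scalar.simps(2)) (simp add: field_simps)
    moreover have "(sqrt_scalar (Suc n) - sqrt_scalar n) * ((sqrt_scalar (Suc n) + sqrt_scalar n) * norm x)
        = ((sqrt_scalar (Suc n))\<^sup>2 - (sqrt_scalar n)\<^sup>2) * norm x"
      by (simp add: power2_eq_square algebra_simps del: sqrt_scalar.simps)
    ultimately show ?thesis by (simp del: sqrt_scalar.simps add: mult.commute)
  qed
  finally show ?case unfolding eq by (simp del: sqrt_iter.simps sqrt_scalar.simps)
qed

lemma norm_sqrt_iter_diff_le:
  assumes "x \<in> V" "m \<le> n"
  shows "norm (Y n x - Y m x) \<le> (sqrt_scalar n - sqrt_scalar m) * norm x"
  using assms(2)
proof (induction n rule: dec_induct)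
  case (step n)
  have "norm (Y (Suc n) x - Y m x) \<le> norm (Y (Suc n) x - Y n x) + norm (Y n x - Y m x)"
    using norm_triangle_ineq[of "Y (Suc n) x - Y n x" "Y n x - Y m x"]
    by (simp del: sqrt_iter.simps)
  then show ?case
    using step.IH norm_sqrt_iter_diff[OF assms(1), of n]
    by (simp del: sqrt_iter.simps sqrt_scalar.simps add: algebra_simps)
qed simp

lemma convergent_sqrt_iter:
  assumes x: "x \<in> V"
  shows "convergent (\<lambda>n. Y n x)"
proof -
  have "Cauchy sqrt_scalar"
    using convergent_sqrt_scalar by (simp add: Cauchy_convergent_iff)
  moreover have "dist (Y n x) (Y m x) \<le> norm x * dist (sqrt_scalar n) (sqrt_scalar m)" if "m \<le> n" for m n
    using norm_sqrt_iter_diff_le[OF x that]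
      mult_right_mono[OF abs_ge_self[of "sqrt_scalar n - sqrt_scalar m"] norm_ge_zero[of x]]
    unfolding dist_norm real_norm_def by (simp add: mult.commute)
  ultimately have "Cauchy (\<lambda>n. Y n x)" by (rule Cauchy_dominated)
  then show ?thesis by (simp add: Cauchy_convergent_iff)
qed

definition sqrt_limit :: "'a \<Rightarrow> 'a" where "sqrt_limit x = lim (\<lambda>n. Y n x)"

lemma sqrt_limit: "x \<in> V \<Longrightarrow> (\<lambda>n. Y n x) \<longlonglongrightarrow> sqrt_limit x"
  unfolding sqrt_limit_def using convergent_sqrt_iter convergent_LIMSEQ_iff by blast

lemma sqrt_limit_in: "x \<in> V \<Longrightarrow> sqrt_limit x \<in> V"
  by (rule closed_sequentially[OF closed_csubspaceD(2)[OF V] _ sqrt_limit]) (auto intro: sqrt_iter_in)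

lemma clinear_on_sqrt_limit: "clinear_on V sqrt_limit"
proof (rule clinear_onI)
  show "sqrt_limit (x + y) = sqrt_limit x + sqrt_limit y" if "x \<in> V" "y \<in> V" for x y
  proof (rule LIMSEQ_unique[OF sqrt_limit[OF V'(2)[OF that]]])
    show "(\<lambda>n. Y n (x + y)) \<longlonglongrightarrow> sqrt_limit x + sqrt_limit y"
      unfolding sqrt_iter_add[OF that] by (intro tendsto_add sqrt_limit that)
  qed
  show "sqrt_limit (c *\<^sub>C x) = c *\<^sub>C sqrt_limit x" if "x \<in> V" for c x
  proof (rule LIMSEQ_unique[OF sqrt_limit[OF V'(4)[OF that]]])
    show "(\<lambda>n. Y n (c *\<^sub>C x)) \<longlonglongrightarrow> c *\<^sub>C sqrt_limit x"
      unfolding sqrt_iter_scaleC[OF that] by (intro scaleC.tendsto tendsto_const sqrt_limit that)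
  qed
qed

lemma sqrt_limit_sym:
  assumes "x \<in> V" "y \<in> V"
  shows "cinner (sqrt_limit x) y = cinner x (sqrt_limit y)"
proof (rule LIMSEQ_unique[OF cinner.tendsto[OF sqrt_limit[OF assms(1)] tendsto_const]])
  show "(\<lambda>n. cinner (Y n x) y) \<longlonglongrightarrow> cinner x (sqrt_limit y)"
    unfolding sqrt_iter_sym[OF assms] by (intro cinner.tendsto tendsto_const sqrt_limit assms)
qed

lemma norm_sqrt_iter_le1: "x \<in> V \<Longrightarrow> norm (Y n x) \<le> norm x"
  using norm_sqrt_iter_le[of x n] mult_right_mono[OF sqrt_scalar_bounds(2)[of n], of "norm x"]
  by simp

lemma norm_sqrt_limit: "x \<in> V \<Longrightarrow> norm (sqrt_limit x) \<le> norm x"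
  using norm_sqrt_iter_le1 by (intro Lim_norm_ubound[OF _ sqrt_limit]) auto

text \<open>Pointwise convergence passes to \<open>Y n (Y n x)\<close> because all iterates are
  contractions: the outer \<open>Y n\<close> does not enlarge the inner error
  \<open>Y n x - sqrt_limit x\<close>.\<close>

lemma sqrt_limit_fixpoint:
  assumes x: "x \<in> V"
  shows "sqrt_limit x = (1/2) *\<^sub>R (B x + sqrt_limit (sqrt_limit x))"
proof -
  have L: "sqrt_limit x \<in> V" by (rule sqrt_limit_in[OF x])
  have "(\<lambda>n. Y n (Y n x) - sqrt_limit (sqrt_limit x)) \<longlonglongrightarrow> 0"
  proof (rule Lim_null_comparison)
    show "\<forall>\<^sub>F n in sequentially. norm (Y n (Y n x) - sqrt_limit (sqrt_limit x)) \<le>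
        norm (Y n x - sqrt_limit x) + norm (Y n (sqrt_limit x) - sqrt_limit (sqrt_limit x))"
    proof (intro always_eventually allI)
      fix n
      have "Y n (Y n x) - sqrt_limit (sqrt_limit x) =
          Y n (Y n x - sqrt_limit x) + (Y n (sqrt_limit x) - sqrt_limit (sqrt_limit x))"
        using Y'(3)[OF sqrt_iter_in[OF x] L] by simp
      then have "norm (Y n (Y n x) - sqrt_limit (sqrt_limit x)) =
          norm (Y n (Y n x - sqrt_limit x) + (Y n (sqrt_limit x) - sqrt_limit (sqrt_limit x)))"
        by (rule arg_cong)
      then show "norm (Y n (Y n x) - sqrt_limit (sqrt_limit x)) \<le>
        norm (Y n x - sqrt_limit x) + norm (Y n (sqrt_limit x) - sqrt_limit (sqrt_limit x))"
        using norm_triangle_ineq[of "Y n (Y n x - sqrt_limit x)"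
            "Y n (sqrt_limit x) - sqrt_limit (sqrt_limit x)"]
          norm_sqrt_iter_le1[OF V'(3)[OF sqrt_iter_in[OF x] L], of n n] by linarith
    qed
    have "(\<lambda>n. norm (Y n x - sqrt_limit x) + norm (Y n (sqrt_limit x) - sqrt_limit (sqrt_limit x)))
        \<longlonglongrightarrow> norm (sqrt_limit x - sqrt_limit x) +
          norm (sqrt_limit (sqrt_limit x) - sqrt_limit (sqrt_limit x))"
      by (intro tendsto_intros sqrt_limit x L)
    then show "(\<lambda>n. norm (Y n x - sqrt_limit x) +
        norm (Y n (sqrt_limit x) - sqrt_limit (sqrt_limit x))) \<longlonglongrightarrow> 0" by simp
  qed
  then have "(\<lambda>n. Y n (Y n x)) \<longlonglongrightarrow> sqrt_limit (sqrt_limit x)" using LIM_zero_iff by blast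
  then have "(\<lambda>n. (1/2) *\<^sub>R (B x + Y n (Y n x))) \<longlonglongrightarrow>
      (1/2) *\<^sub>R (B x + sqrt_limit (sqrt_limit x))"
    by (intro tendsto_intros)
  then have "(\<lambda>n. Y (Suc n) x) \<longlonglongrightarrow> (1/2) *\<^sub>R (B x + sqrt_limit (sqrt_limit x))" by simp
  then show ?thesis using LIMSEQ_Suc[OF sqrt_limit[OF x]] LIMSEQ_unique by blast
qed

lemma sqrt_limit_square:
  assumes x: "x \<in> V"
  shows "(x - sqrt_limit x) - sqrt_limit (x - sqrt_limit x) = x - B x"
proof -
  note L' = clinear_on_ops[OF clinear_on_sqrt_limit closed_csubspaceD(1)[OF V]]
  have "2 *\<^sub>R sqrt_limit x = B x + sqrt_limit (sqrt_limit x)"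
    by (subst sqrt_limit_fixpoint[OF x]) simp
  then have "B x = sqrt_limit x + sqrt_limit x - sqrt_limit (sqrt_limit x)"
    by (simp add: scaleR_2)
  then show ?thesis by (simp add: L'(3)[OF x sqrt_limit_in[OF x]])
qed

lemma sqrt_limit_commute:
  assumes S: "bounded_op V V S" "\<And>x. x \<in> V \<Longrightarrow> S (B x) = B (S x)" and x: "x \<in> V"
  shows "S (sqrt_limit x) = sqrt_limit (S x)"
proof -
  have SV: "y \<in> V \<Longrightarrow> S y \<in> V" for y using S(1) by (auto simp: bounded_op_def)
  have lin: "clinear_on V S" using S(1) by (simp add: bounded_op_def)
  note S' = clinear_on_ops[OF lin closed_csubspaceD(1)[OF V]]
  obtain K where K: "\<And>y. y \<in> V \<Longrightarrow> norm (S y) \<le> K * norm y"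
    using S(1) by (auto simp: bounded_op_def)
  have "(\<lambda>n. S (Y n x)) \<longlonglongrightarrow> S (sqrt_limit x)"
    by (rule clinear_on_tendsto[OF closed_csubspaceD(1)[OF V] lin K])
      (simp_all add: sqrt_iter_in sqrt_limit_in sqrt_limit x)
  then have "(\<lambda>n. Y n (S x)) \<longlonglongrightarrow> S (sqrt_limit x)"
    using sqrt_iter_commute_general[OF lin SV S(2) x] by simp
  then show ?thesis using sqrt_limit[OF SV[OF x]] LIMSEQ_unique by blast
qed

lemma sqrt_limit_root:
  defines "R \<equiv> \<lambda>x. if x \<in> V then x - sqrt_limit x else 0"
  shows "x \<in> V \<Longrightarrow> R x \<in> V" "clinear_on V R" "x \<in> V \<Longrightarrow> R (R x) = x - B x"
    "x \<in> V \<Longrightarrow> y \<in> V \<Longrightarrow> cinner (R x) y = cinner x (R y)"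
proof -
  note L' = clinear_on_ops[OF clinear_on_sqrt_limit closed_csubspaceD(1)[OF V]]
  show RV: "x \<in> V \<Longrightarrow> R x \<in> V" for x
    using V' sqrt_limit_in by (auto simp: R_def)
  show "clinear_on V R"
    unfolding R_def by (rule clinear_onI) (auto simp: V' L' scaleC.diff_right algebra_simps)
  show "x \<in> V \<Longrightarrow> y \<in> V \<Longrightarrow> cinner (R x) y = cinner x (R y)"
    by (simp add: R_def cinner.diff_left cinner.diff_right sqrt_limit_sym)
  show "R (R x) = x - B x" if "x \<in> V"
    using sqrt_limit_square[OF that] RV[OF that] that by (simp add: R_def)
qed

text \<open>Uniqueness is the point, as \<open>sqrt_op\<close> is a \<open>THE\<close>. A rival root
  \<open>S\<close> commutes with \<open>S\<^sup>2 = I - B\<close>, hence with \<open>B\<close> and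
  with the limit root \<open>R\<close>. For \<open>y = S x - R x\<close> this gives
  \<open>S y + R y = 0\<close>. Two nonnegative forms with sum 0 vanish at \<open>y\<close>, so
  \<open>S y = R y = 0\<close>, and symmetry makes |y|^2 = <x, S y - R y> equal to 0.\<close>

lemma sqrt_op_eq: "sqrt_op V (\<lambda>x. x - B x) = (\<lambda>x. if x \<in> V then x - sqrt_limit x else 0)"
  (is "_ = ?R")
proof -
  note RV = sqrt_limit_root(1) and Rlin = sqrt_limit_root(2) and Rsq = sqrt_limit_root(3)
  have Rb: "norm (?R x) \<le> 2 * norm x" if "x \<in> V" for x
    using that norm_triangle_ineq4[of x "sqrt_limit x"] norm_sqrt_limit[OF that] by simp
  have Rpos: "cinner (?R x) x \<in> \<real>\<^sub>\<ge>\<^sub>0" if x: "x \<in> V" for x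
  proof -
    have "Im (cinner (sqrt_limit x) x) = 0"
      using sqrt_limit_sym[OF x x] cinner_commute[of x "sqrt_limit x"]
      by (metis cnj.simps(2) neg_equal_zero)
    moreover have "inner (sqrt_limit x) x \<le> norm x * norm x"
      using norm_cauchy_schwarz[of "sqrt_limit x" x] norm_sqrt_limit[OF x]
      by (meson mult_right_mono norm_ge_zero order_trans)
    ultimately show ?thesis
      using x by (simp add: complex_nonneg_Reals_iff cinner.diff_left Re_cinner cinner_self
          inner_diff_left power2_norm_eq_inner[symmetric] power2_eq_square)
  qed
  have Rbd: "bounded_op V V ?R"
    unfolding bounded_op_def using RV Rlin Rb by blast
  show ?thesis
    unfolding sqrt_op_def
  proof (rule the_equality)
    show "bounded_op V V ?R \<and> (\<forall>x\<in>V. cinner (?R x) x \<in> \<real>\<^sub>\<ge>\<^sub>0) \<and>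
      (\<forall>x\<in>V. ?R (?R x) = x - B x) \<and> (\<forall>x. x \<notin> V \<longrightarrow> ?R x = 0)"
      using Rbd Rpos Rsq by auto
  next
    fix S assume S: "bounded_op V V S \<and> (\<forall>x\<in>V. cinner (S x) x \<in> \<real>\<^sub>\<ge>\<^sub>0) \<and>
      (\<forall>x\<in>V. S (S x) = x - B x) \<and> (\<forall>x. x \<notin> V \<longrightarrow> S x = 0)"
    have SV: "y \<in> V \<Longrightarrow> S y \<in> V" for y using S by (auto simp: bounded_op_def)
    have Slin: "clinear_on V S" using S by (simp add: bounded_op_def)
    have Spos: "\<And>x. x \<in> V \<Longrightarrow> cinner (S x) x \<in> \<real>\<^sub>\<ge>\<^sub>0" using S by blast
    have Ssq: "\<And>x. x \<in> V \<Longrightarrow> S (S x) = x - B x" using S by blast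
    note S' = clinear_on_ops[OF Slin closed_csubspaceD(1)[OF V]]
    note R' = clinear_on_ops[OF Rlin closed_csubspaceD(1)[OF V]]
    have SB: "S (B x) = B (S x)" if x: "x \<in> V" for x
    proof -
      have "S (x - B x) = S x - B (S x)"
        using Ssq[OF x] Ssq[OF SV[OF x]] by simp
      then show ?thesis using S'(3)[OF x BV[OF x]] by simp
    qed
    have SR: "S (?R x) = ?R (S x)" if x: "x \<in> V" for x
      using x SV[OF x] sqrt_limit_commute[of S x] SB S S'(3)[OF x sqrt_limit_in[OF x]] by simp
    have SRx: "S x = ?R x" if x: "x \<in> V" for x
    proof -
      define y where "y = S x - ?R x"
      have y: "y \<in> V" unfolding y_def by (rule V'(3)[OF SV[OF x] RV[OF x]])
      have "S y + ?R y = S (S x) - S (?R x) + (?R (S x) - ?R (?R x))"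
        unfolding y_def using S'(3)[OF SV[OF x] RV[OF x]] R'(3)[OF SV[OF x] RV[OF x]] by simp
      also have "\<dots> = 0" using SR[OF x] Rsq[OF x] Ssq[OF x] by simp
      finally have 0: "S y + ?R y = 0" .
      have nn: "0 \<le> inner (S y) y" "0 \<le> inner (?R y) y"
        using Spos[OF y] Rpos[OF y] by (auto simp: complex_nonneg_Reals_iff Re_cinner[symmetric])
      have "inner (S y) y + inner (?R y) y = 0"
        by (subst inner_add_left[symmetric]) (simp only: 0 inner_zero_left)
      then have z: "inner (S y) y = 0" "inner (?R y) y = 0" using nn by linarith+
      have Sy: "S y = 0"
        using SV by (intro positive_zero_form[OF closed_csubspaceD(1)[OF V] Slin _ Spos y z(1)]) auto
      have Ry: "?R y = 0"
        using 0 Sy by simp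
      have "cinner y y = cinner (S x) y - cinner (?R x) y"
        unfolding y_def by (simp only: cinner.diff_left)
      also have "cinner (S x) y = cinner x (S y)"
        by (rule symmetric_if_positive[OF closed_csubspaceD(1)[OF V] Slin Spos x y])
      also have "cinner (?R x) y = cinner x (?R y)"
        by (rule symmetric_if_positive[OF closed_csubspaceD(1)[OF V] Rlin Rpos x y])
      finally have "cinner y y = 0" by (simp only: Sy Ry cinner.zero_right diff_self)
      then show ?thesis by (simp add: cinner_self y_def)
    qed
    show "S = ?R"
    proof
      show "S x = ?R x" for x
        using SRx[of x] S by (cases "x \<in> V") auto
    qed
  qed
qed

lemma sqrt_op_props:
  defines "R \<equiv> sqrt_op V (\<lambda>x. x - B x)"
  shows "x \<in> V \<Longrightarrow> R x \<in> V" "clinear_on V R" "x \<in> V \<Longrightarrow> R (R x) = x - B x"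
    "x \<in> V \<Longrightarrow> y \<in> V \<Longrightarrow> cinner (R x) y = cinner x (R y)"
  unfolding R_def sqrt_op_eq by (fact sqrt_limit_root)+

end

text \<open>The interface to roots of \<open>I - G\<^sup>* G\<close>. The hypothesis on
  \<open>P\<close> is put as a Gram identity, so no formula for the adjoint of \<open>G\<close> is
  called for. It is applied to the column of backward shifts and to the adjoint of
  \<open>X\<close>.\<close>

lemma sqrt_op_gram:
  fixes V :: "'a::chilbert_space set" and G :: "'a \<Rightarrow> 'k::chilbert_space"
  assumes V: "closed_csubspace V" and G: "clinear_on V G"
    and G1: "\<And>x. x \<in> V \<Longrightarrow> norm (G x) \<le> norm x"
    and P: "\<And>x. x \<in> V \<Longrightarrow> P x \<in> V"
    and PG: "\<And>x y. x \<in> V \<Longrightarrow> y \<in> V \<Longrightarrow> cinner (P x) y = cinner x y - cinner (G x) (G y)"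
  shows "x \<in> V \<Longrightarrow> sqrt_op V P x \<in> V" and "clinear_on V (sqrt_op V P)"
    and "x \<in> V \<Longrightarrow> y \<in> V \<Longrightarrow>
      cinner (sqrt_op V P x) (sqrt_op V P y) = cinner x y - cinner (G x) (G y)"
    and "x \<in> V \<Longrightarrow> sqrt_op V P x \<in> closure (P ` V)"
    and "clinear_on V P"
proof -
  define B where "B x = x - P x" for x
  define R where "R = sqrt_op V P"
  have R_eq: "R = sqrt_op V (\<lambda>x. x - B x)" by (simp add: R_def B_def)
  have csV: "csubspace V" by (rule closed_csubspaceD[OF V])
  note V' = csubspace_closed_ops[OF csV] and G' = clinear_on_ops[OF G csV]
  have BV: "x \<in> V \<Longrightarrow> B x \<in> V" for x unfolding B_def using V'(3) P by blast
  have BG: "cinner (B x) y = cinner (G x) (G y)" if "x \<in> V" "y \<in> V" for x y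
    unfolding B_def by (simp add: cinner.diff_left PG that)
  have Bsym: "cinner (B x) y = cinner x (B y)" if "x \<in> V" "y \<in> V" for x y
    using BG[OF that] BG[OF that(2,1)] by (metis cinner_commute)
  have Blin: "clinear_on V B"
  proof (rule clinear_onI)
    show "B (x + y) = B x + B y" if "x \<in> V" "y \<in> V" for x y
      using that BV V' by (intro cinner_ext_on[OF csV]) (auto simp: Bsym[symmetric] cinner_add_right)
    show "B (c *\<^sub>C x) = c *\<^sub>C B x" if "x \<in> V" for x c
      using that BV V' by (intro cinner_ext_on[OF csV]) (auto simp: Bsym[symmetric] cinner_scaleC_right)
  qed
  note B' = clinear_on_ops[OF Blin csV]
  have B1: "norm (B x) \<le> norm x" if x: "x \<in> V" for x
  proof (cases "B x = 0")
    case False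
    have "(norm (B x))\<^sup>2 = inner (G x) (G (B x))"
      using BG[OF x BV[OF x]] by (metis Re_cinner power2_norm_eq_inner)
    also have "\<dots> \<le> norm (G x) * norm (G (B x))" by (rule norm_cauchy_schwarz)
    also have "\<dots> \<le> norm x * norm (B x)" using x BV G1 by (intro mult_mono) auto
    finally show ?thesis using False by (simp add: power2_eq_square)
  qed simp
  have P_eq: "P = (\<lambda>x. x - B x)" by (simp add: B_def fun_eq_iff)
  have R1: "x \<in> V \<Longrightarrow> R x \<in> V" for x
    unfolding R_eq by (rule sqrt_op_props(1)[OF V Blin]) (simp_all add: BV B1 Bsym)
  have R2: "clinear_on V R"
    unfolding R_eq by (rule sqrt_op_props(2)[OF V Blin]) (simp_all add: BV B1 Bsym)
  have R3: "x \<in> V \<Longrightarrow> R (R x) = x - B x" for x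
    unfolding R_eq by (rule sqrt_op_props(3)[OF V Blin]) (simp_all add: BV B1 Bsym)
  have R4: "x \<in> V \<Longrightarrow> y \<in> V \<Longrightarrow> cinner (R x) y = cinner x (R y)" for x y
    unfolding R_eq by (rule sqrt_op_props(4)[OF V Blin]) (simp_all add: BV B1 Bsym)
  note R' = R1 R2 R3 R4
  show "x \<in> V \<Longrightarrow> sqrt_op V P x \<in> V" for x using R'(1) by (simp add: R_def)
  show "clinear_on V (sqrt_op V P)" using R'(2) by (simp add: R_def)
  have RR: "cinner (R x) (R y) = cinner (P x) y" if "x \<in> V" "y \<in> V" for x y
    using R'(4)[OF R'(1)[OF that(1)] that(2)] R'(3)[OF that(1)] by (simp add: B_def)
  then show "x \<in> V \<Longrightarrow> y \<in> V \<Longrightarrow>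
      cinner (sqrt_op V P x) (sqrt_op V P y) = cinner x y - cinner (G x) (G y)" for x y
    by (simp add: R_def PG)
  show Plin: "clinear_on V P"
    unfolding P_eq by (rule clinear_onI) (simp_all add: B' scaleC.diff_right)
  show "sqrt_op V P x \<in> closure (P ` V)" if x: "x \<in> V"
  proof -
    define N where "N = closure (P ` V)"
    have N: "closed_csubspace N"
      unfolding N_def by (intro closed_csubspace_closure clinear_on_image_csubspace csV Plin)
    have NV: "N \<subseteq> V"
      unfolding N_def using P closed_csubspaceD(2)[OF V] by (intro closure_minimal) auto
    have PN: "y \<in> V \<Longrightarrow> P y \<in> N" for y
      unfolding N_def using closure_subset by fastforce
    note pr = closed_csubspace_proj[OF N]
    \<comment> \<open>\<open>u\<close> is the part of \<open>R x\<close> orthogonal to the closure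
      of the range of \<open>P\<close>. As |R u|^2 is the form of \<open>P\<close> at
      \<open>u\<close>, it is 0, and then |u|^2 = <x, R u> = 0.\<close>
    define u where "u = R x - proj N (R x)"
    have u: "u \<in> V" unfolding u_def by (rule V'(3)[OF R'(1)[OF x] subsetD[OF NV pr(1)]])
    have orth: "v \<in> N \<Longrightarrow> cinner v u = 0" for v
      unfolding u_def by (simp add: cinner.diff_right pr(2))
    have "cinner (R u) (R u) = 0" using RR[OF u u] orth[OF PN[OF u]] by simp
    then have Ru: "R u = 0" by (simp add: cinner_self)
    have "cinner u u = cinner (R x) u - cinner (proj N (R x)) u"
      by (subst u_def) (rule cinner.diff_left)
    also have "\<dots> = cinner x (R u)" using orth[OF pr(1)] R'(4)[OF x u] by simp
    finally have "u = 0" by (simp add: Ru cinner.zero_right cinner_self)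
    then show ?thesis using pr(1)[of "R x"] by (simp add: u_def R_def N_def)
  qed
qed

section \<open>Unitaries between closed subspaces\<close>

lemma closed_csubspace_subset_complement:
  assumes "closed_csubspace V"
  shows "closed_csubspace {x\<in>V. \<forall>y\<in>S. cinner x y = 0}"
proof -
  have "{x\<in>V. \<forall>y\<in>S. cinner x y = 0} = V \<inter> {x. \<forall>y\<in>S. cinner x y = 0}" by auto
  then show ?thesis
    using closed_csubspace_Int[OF assms closed_csubspace_orthocomplement] by simp
qed

lemma isometry_unitary_image:
  assumes V: "csubspace V" and F: "clinear_on V F"
    and iso: "\<And>x y. x \<in> V \<Longrightarrow> y \<in> V \<Longrightarrow> cinner (F x) (F y) = cinner x y"
  shows "unitary_op V (F ` V) F"
proof -
  have "inj_on F V"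
  proof (rule inj_onI)
    fix x y assume xy: "x \<in> V" "y \<in> V" "F x = F y"
    note d = csubspace_closed_ops(3)[OF V xy(1,2)]
    have "cinner (x - y) (x - y) = 0"
      using iso[OF d d] clinear_on_ops(3)[OF F V xy(1,2)] xy(3) by (simp add: cinner.zero_left)
    then show "x = y" by (simp add: cinner_self)
  qed
  then show ?thesis using F iso by (simp add: unitary_op_def bij_betw_def)
qed

text \<open>An isometric image of a closed subspace is closed, so surjectivity reduces to a trivial
  orthogonal complement in \<open>W\<close>.\<close>

lemma unitary_opI_closed:
  fixes V :: "'a::chilbert_space set" and W :: "'b::chilbert_space set"
  assumes V: "closed_csubspace V" and W: "csubspace W" and F: "clinear_on V F"
    and FW: "\<And>x. x \<in> V \<Longrightarrow> F x \<in> W"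
    and iso: "\<And>x y. x \<in> V \<Longrightarrow> y \<in> V \<Longrightarrow> cinner (F x) (F y) = cinner x y"
    and dense: "\<And>y. y \<in> W \<Longrightarrow> (\<And>x. x \<in> V \<Longrightarrow> cinner (F x) y = 0) \<Longrightarrow> y = 0"
  shows "unitary_op V W F"
proof -
  have nrm: "norm (F x) = norm x" if "x \<in> V" for x
    using iso[OF that that] by (rule norm_eq_if_cinner_eq)
  have "closed_csubspace (F ` V)"
    by (rule closed_csubspace_image[OF V F, of 1 1]) (simp_all add: nrm)
  then have "F ` V = W"
    using W FW dense by (intro closed_csubspace_eqI) auto
  then show ?thesis using isometry_unitary_image[OF closed_csubspaceD(1)[OF V] F iso] by simp
qed

lemma isometry_image_closed:
  fixes V :: "'a::chilbert_space set" and F :: "'a \<Rightarrow> 'b::chilbert_space"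
  assumes "closed_csubspace V" "clinear_on V F"
    and "\<And>x y. x \<in> V \<Longrightarrow> y \<in> V \<Longrightarrow> cinner (F x) (F y) = cinner x y"
  shows "closed_csubspace (F ` V)"
proof -
  have "norm (F x) = norm x" if "x \<in> V" for x
    using assms(3)[OF that that] by (rule norm_eq_if_cinner_eq)
  then show ?thesis by (intro closed_csubspace_image[OF assms(1,2), of 1 1]) auto
qed

lemma unitary_op_inv:
  assumes U: "unitary_op V W U" and V: "csubspace V" and W: "csubspace W"
  defines "U' \<equiv> inv_into V U"
  shows "unitary_op W V U'" and "y \<in> W \<Longrightarrow> U (U' y) = y" and "x \<in> V \<Longrightarrow> U' (U x) = x"
    and "x \<in> V \<Longrightarrow> y \<in> W \<Longrightarrow> cinner (U x) y = cinner x (U' y)"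
    and "x \<in> V \<Longrightarrow> y \<in> W \<Longrightarrow> cinner (U' y) x = cinner y (U x)"
proof -
  have bij: "bij_betw U V W" and lin: "clinear_on V U"
    and iso: "\<And>x y. x \<in> V \<Longrightarrow> y \<in> V \<Longrightarrow> cinner (U x) (U y) = cinner x y"
    using U by (auto simp: unitary_op_def)
  note V' = csubspace_closed_ops[OF V] and W' = csubspace_closed_ops[OF W]
  note U_lin = clinear_on_ops[OF lin V]
  show 1: "y \<in> W \<Longrightarrow> U (U' y) = y" for y
    unfolding U'_def using bij by (rule bij_betw_inv_into_right)
  show 2: "x \<in> V \<Longrightarrow> U' (U x) = x" for x
    unfolding U'_def using bij by (rule bij_betw_inv_into_left)
  have inV: "y \<in> W \<Longrightarrow> U' y \<in> V" for y
    unfolding U'_def using bij_betwE[OF bij_betw_inv_into[OF bij]] by blast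
  have bij': "bij_betw U' W V" unfolding U'_def by (rule bij_betw_inv_into[OF bij])
  show ad: "x \<in> V \<Longrightarrow> y \<in> W \<Longrightarrow> cinner (U x) y = cinner x (U' y)" for x y
    using iso[of x "U' y"] inV[of y] 1[of y] by simp
  then show "x \<in> V \<Longrightarrow> y \<in> W \<Longrightarrow> cinner (U' y) x = cinner y (U x)" for x y
    by (metis cinner_commute)
  show "unitary_op W V U'"
    unfolding unitary_op_def
  proof (intro conjI ballI bij' clinear_onI)
    show "U' (x + y) = U' x + U' y" if "x \<in> W" "y \<in> W" for x y
      using 2[OF V'(2)[OF inV inV, OF that]] U_lin(2)[OF inV inV, OF that] 1 that by simp
    show "U' (c *\<^sub>C x) = c *\<^sub>C U' x" if "x \<in> W" for c x
      using 2[OF V'(4)[OF inV, OF that], of c] U_lin(4)[OF inV, OF that] 1 that by simp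
    show "cinner (U' x) (U' y) = cinner x y" if "x \<in> W" "y \<in> W" for x y
      using iso[OF inV inV, OF that] 1 that by simp
  qed
qed

lemma orthogonal_decomposition:
  fixes V :: "'a::chilbert_space set"
  assumes V: "closed_csubspace V" and N: "closed_csubspace N" "N \<subseteq> V" and x: "x \<in> V"
  shows "x - proj N x \<in> V" "v \<in> N \<Longrightarrow> cinner (x - proj N x) v = 0"
    "v \<in> N \<Longrightarrow> cinner v (x - proj N x) = 0"
  using csubspace_closed_ops(3)[OF closed_csubspaceD(1)[OF V] x] N(2) closed_csubspace_proj[OF N(1)]
  by (auto simp: cinner.diff_left cinner.diff_right)

text \<open>\<open>F\<close> acts on \<open>M\<close> and \<open>G\<close> on its complement in
  \<open>V\<close>. The splitting of \<open>W\<close> is demanded only as orthogonality and density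
  of \<open>N + M'\<close>; the direct sum follows because the isometric image is closed.\<close>

lemma unitary_op_direct_sum:
  fixes V :: "'a::chilbert_space set" and W :: "'b::chilbert_space set"
  assumes V: "closed_csubspace V" and W: "closed_csubspace W"
    and M: "closed_csubspace M" "M \<subseteq> V" and N: "N \<subseteq> W" and M'W: "M' \<subseteq> W"
    and F: "unitary_op M N F" and G: "clinear_on {x\<in>V. \<forall>y\<in>M. cinner x y = 0} G"
    and GM': "G ` {x\<in>V. \<forall>y\<in>M. cinner x y = 0} = M'"
    and Giso: "\<And>x y. x \<in> {x\<in>V. \<forall>y\<in>M. cinner x y = 0} \<Longrightarrow> y \<in> {x\<in>V. \<forall>y\<in>M. cinner x y = 0} \<Longrightarrow>
      cinner (G x) (G y) = cinner x y"
    and orth: "\<And>x y. x \<in> N \<Longrightarrow> y \<in> M' \<Longrightarrow> cinner x y = 0"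
    and dense: "\<And>y. y \<in> W \<Longrightarrow> (\<And>x. x \<in> N \<Longrightarrow> cinner x y = 0) \<Longrightarrow>
      (\<And>x. x \<in> M' \<Longrightarrow> cinner x y = 0) \<Longrightarrow> y = 0"
  obtains U where "unitary_op V W U" and "\<And>x. x \<in> M \<Longrightarrow> U x = F x"
proof -
  define C where "C = {x\<in>V. \<forall>y\<in>M. cinner x y = 0}"
  have C: "closed_csubspace C" unfolding C_def by (rule closed_csubspace_subset_complement[OF V])
  define U where "U x = F (proj M x) + G (x - proj M x)" for x
  note pr = closed_csubspace_proj[OF M(1)]
  have inC: "x - proj M x \<in> C" if "x \<in> V" for x
    using orthogonal_decomposition(1,2)[OF V M that] by (simp add: C_def)
  have Flin: "clinear_on M F" and Fiso: "\<And>x y. x \<in> M \<Longrightarrow> y \<in> M \<Longrightarrow> cinner (F x) (F y) = cinner x y"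
    and FM: "F ` M = N"
    using F by (auto simp: unitary_op_def bij_betw_def)
  note F' = clinear_on_ops[OF Flin closed_csubspaceD(1)[OF M(1)]]
  note G' = clinear_on_ops[OF G[folded C_def] closed_csubspaceD(1)[OF C]]
  note p' = clinear_on_ops[OF pr(4)[of UNIV], simplified]
  have FN: "F (proj M x) \<in> N" for x using FM pr(1) by blast
  have GM: "x \<in> C \<Longrightarrow> G x \<in> M'" for x using GM' by (auto simp: C_def)
  have UM: "U x = F x" if "x \<in> M" for x
    using that by (simp add: U_def pr(6) G'(1))
  have UC: "U x = G x" if "x \<in> C" for x
  proof -
    have "proj M x = 0"
    proof (rule cinner_ext_on[OF closed_csubspaceD(1)[OF M(1)] pr(1)])
      show "cinner v (proj M x) = cinner v 0" if "v \<in> M" for v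
        using \<open>x \<in> C\<close> that by (simp add: pr(2) C_def cinner.zero_right cinner_zero_commute[of v])
    qed (rule csubspace_closed_ops(1)[OF closed_csubspaceD(1)[OF M(1)]])
    then show ?thesis by (simp add: U_def F'(1))
  qed
  have "unitary_op V W U"
  proof (rule unitary_opI_closed[OF V closed_csubspaceD(1)[OF W]])
    note V' = csubspace_closed_ops[OF closed_csubspaceD(1)[OF V]]
    show "clinear_on V U"
    proof (rule clinear_onI)
      fix x y assume xy: "x \<in> V" "y \<in> V"
      have "x + y - proj M (x + y) = (x - proj M x) + (y - proj M y)" by (simp add: p')
      then show "U (x + y) = U x + U y"
        unfolding U_def by (simp only: p' F'(2)[OF pr(1) pr(1)] G'(2)[OF inC[OF xy(1)] inC[OF xy(2)]]) simp
    next
      fix c x assume x: "x \<in> V"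
      have "c *\<^sub>C x - proj M (c *\<^sub>C x) = c *\<^sub>C (x - proj M x)" by (simp add: p' scaleC.diff_right)
      then show "U (c *\<^sub>C x) = c *\<^sub>C U x"
        unfolding U_def by (simp only: p' F'(4)[OF pr(1)] G'(4)[OF inC[OF x]] scaleC_add_right)
    qed
    show "U x \<in> W" if "x \<in> V" for x
      unfolding U_def using FN GM[OF inC[OF that]] N M'W
      by (intro csubspace_closed_ops(2)[OF closed_csubspaceD(1)[OF W]]) auto
    show "cinner (U x) (U y) = cinner x y" if "x \<in> V" "y \<in> V" for x y
    proof -
      have "cinner (U x) (U y) = cinner (proj M x) (proj M y) + cinner (x - proj M x) (y - proj M y)"
        unfolding U_def using orth[OF FN GM[OF inC[OF that(2)]]]
          orth[OF FN GM[OF inC[OF that(1)]], THEN cinner_zero_commute[THEN iffD1]]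
          Giso[folded C_def, OF inC[OF that(1)] inC[OF that(2)]]
        by (simp add: cinner_add_left cinner_add_right Fiso[OF pr(1) pr(1)])
      also have "\<dots> = cinner x y"
        using pr(2)[OF pr(1)[of x], of y] pr(3)[OF pr(1)[of y], of x]
        by (simp add: cinner.diff_left cinner.diff_right)
      finally show ?thesis .
    qed
    show "y = 0" if "y \<in> W" "\<And>x. x \<in> V \<Longrightarrow> cinner (U x) y = 0" for y
    proof (rule dense[OF that(1)])
      show "cinner x y = 0" if "x \<in> N" for x
      proof -
        obtain m where "m \<in> M" "x = F m" using FM \<open>x \<in> N\<close> by blast
        then show ?thesis using \<open>\<And>x. x \<in> V \<Longrightarrow> cinner (U x) y = 0\<close>[of m] UM M(2) by auto
      qed
      show "cinner x y = 0" if "x \<in> M'" for x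
      proof -
        obtain m where "m \<in> C" "x = G m" using GM' \<open>x \<in> M'\<close> by (auto simp: C_def)
        then show ?thesis using \<open>\<And>x. x \<in> V \<Longrightarrow> cinner (U x) y = 0\<close>[of m] UC by (auto simp: C_def)
      qed
    qed
  qed
  then show ?thesis using UM that by blast
qed

text \<open>A Schroeder-Bernstein theorem: \<open>u\<close> is used on the closed span of the orbit of
  \<open>V \<ominus> v W\<close> under \<open>v \<circ> u\<close>, and the inverse of \<open>v\<close> on its complement.\<close>

lemma unitary_schroeder_bernstein:
  fixes V :: "'a::chilbert_space set" and W :: "'b::chilbert_space set"
  assumes V: "closed_csubspace V" and W: "closed_csubspace W"
    and u: "clinear_on V u" "\<And>x. x \<in> V \<Longrightarrow> u x \<in> W"
      "\<And>x y. x \<in> V \<Longrightarrow> y \<in> V \<Longrightarrow> cinner (u x) (u y) = cinner x y"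
    and v: "clinear_on W v" "\<And>x. x \<in> W \<Longrightarrow> v x \<in> V"
      "\<And>x y. x \<in> W \<Longrightarrow> y \<in> W \<Longrightarrow> cinner (v x) (v y) = cinner x y"
  obtains U where "unitary_op V W U"
proof -
  \<comment> \<open>\<open>A\<close> is the part of \<open>V\<close> missed by \<open>v\<close>, the
    analogue of the points without predecessor in the set-theoretic argument.\<close>
  define A where "A = {x\<in>V. \<forall>y\<in>v ` W. cinner x y = 0}"
  define Orb where "Orb = (\<Union>n. ((v \<circ> u) ^^ n) ` A)"
  define M where "M = closure (cspan Orb)"
  have M: "closed_csubspace M" unfolding M_def by (rule closed_csubspace_closure_cspan)
  have csV: "csubspace V" and csW: "csubspace W" using V W by (auto dest: closed_csubspaceD)
  have OV: "((v \<circ> u) ^^ n) x \<in> V" if "x \<in> A" for n x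
    by (induction n) (use that u(2) v(2) in \<open>auto simp: A_def\<close>)
  have OV': "Orb \<subseteq> V" using OV by (auto simp: Orb_def)
  have MV: "M \<subseteq> V" unfolding M_def by (rule closure_cspan_minimal[OF OV' V])
  have OM: "Orb \<subseteq> M" unfolding M_def by (rule closure_cspan_superset)
  have AO: "A \<subseteq> Orb" unfolding Orb_def by (rule subsetI, rule UN_I[of 0]) auto
  note u' = clinear_on_ops[OF u(1) csV] and v' = clinear_on_ops[OF v(1) csW]
  note V' = csubspace_closed_ops[OF csV] and W' = csubspace_closed_ops[OF csW]
  have Orb_step: "v (u x) \<in> Orb" if x: "x \<in> Orb" for x
  proof -
    obtain n where "x \<in> ((v \<circ> u) ^^ n) ` A" using x unfolding Orb_def by blast
    then obtain a where "a \<in> A" "x = ((v \<circ> u) ^^ n) a" by blast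
    then have "v (u x) = ((v \<circ> u) ^^ Suc n) a" by simp
    then show ?thesis using \<open>a \<in> A\<close> unfolding Orb_def by blast
  qed
  have vuV: "v (u x) \<in> V" if "x \<in> V" for x using that u(2) v(2) by blast
  have vuiso: "cinner (v (u x)) (v (u y)) = cinner x y" if "x \<in> V" "y \<in> V" for x y
    using that u v by simp
  have vuM: "v (u x) \<in> M" if x: "x \<in> M" for x
  proof -
    have vulin: "clinear_on V (\<lambda>x. v (u x))"
      by (rule clinear_onI) (simp_all add: u' v' u(2))
    have "closed_csubspace {x \<in> V. v (u x) \<in> M}"
    proof (rule closed_csubspace_preimage[OF V vulin _ M])
      show "norm (v (u x)) \<le> 1 * norm x" if "x \<in> V" for x
        using norm_eq_if_cinner_eq[OF vuiso[OF that that]] by simp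
    qed
    then have "M \<subseteq> {x \<in> V. v (u x) \<in> M}"
      using Orb_step OM OV' unfolding M_def by (intro closure_cspan_minimal) auto
    then show ?thesis using x by blast
  qed
  define C where "C = {x\<in>V. \<forall>y\<in>M. cinner x y = 0}"
  have csC: "csubspace C"
    unfolding C_def by (rule closed_csubspaceD[OF closed_csubspace_subset_complement[OF V]])
  have vW: "closed_csubspace (v ` W)" by (rule isometry_image_closed[OF W v(1,3)])
  \<comment> \<open>The component of \<open>x\<close> orthogonal to the range of \<open>v\<close>
    lies in \<open>A\<close>, hence in \<open>M\<close>, to which \<open>x\<close> is orthogonal. So
    that component is 0 and \<open>x\<close> is a value of \<open>v\<close>.\<close>
  have Cv: "x \<in> v ` W" if x: "x \<in> C" for x
  proof -
    have "v ` W \<subseteq> V" using v(2) by auto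
    moreover have xV: "x \<in> V" using x by (simp add: C_def)
    ultimately have a: "x - proj (v ` W) x \<in> A"
      using orthogonal_decomposition[OF V vW] by (simp add: A_def)
    then have "cinner x (x - proj (v ` W) x) = 0"
      using x AO OM by (auto simp: C_def)
    moreover have "cinner (proj (v ` W) x) (x - proj (v ` W) x) = 0"
      using closed_csubspace_proj[OF vW] by (simp add: cinner.diff_right)
    ultimately have "cinner (x - proj (v ` W) x) (x - proj (v ` W) x) = 0"
      by (simp add: cinner.diff_left[of x])
    then show ?thesis using closed_csubspace_proj(1)[OF vW, of x] by (simp add: cinner_self)
  qed
  have vU: "unitary_op W (v ` W) v" by (rule isometry_unitary_image[OF csW v(1,3)])
  define G where "G = inv_into W v"
  note inv = unitary_op_inv[OF vU csW closed_csubspaceD(1)[OF vW], folded G_def]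
  have Gu: "clinear_on (v ` W) G" "\<And>x y. x \<in> v ` W \<Longrightarrow> y \<in> v ` W \<Longrightarrow> cinner (G x) (G y) = cinner x y"
    "\<And>x. x \<in> v ` W \<Longrightarrow> G x \<in> W"
    using inv(1) by (auto simp: unitary_op_def bij_betw_def)
  have G: "G x \<in> W \<and> v (G x) = x" if "x \<in> C" for x
    using Gu(3)[OF Cv[OF that]] inv(2)[OF Cv[OF that]] by blast
  have uM: "unitary_op M (u ` M) u"
  proof (rule isometry_unitary_image[OF closed_csubspaceD(1)[OF M]])
    show "clinear_on M u" using u(1) MV unfolding clinear_on_def by blast
    show "cinner (u x) (u y) = cinner x y" if "x \<in> M" "y \<in> M" for x y
      using u(3) MV that by blast
  qed
  show ?thesis
  proof (rule unitary_op_direct_sum[OF V W M MV _ _ uM, of "G ` C" G, folded C_def])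
    show "u ` M \<subseteq> W" using u(2) MV by auto
    show "G ` C \<subseteq> W" using G by auto
    show "clinear_on C G" by (rule clinear_onI) (simp_all add: clinear_on_ops[OF Gu(1) closed_csubspaceD(1)[OF vW]] Cv)
    show "cinner (G x) (G y) = cinner x y" if "x \<in> C" "y \<in> C" for x y
      using Gu(2)[OF Cv[OF that(1)] Cv[OF that(2)]] .
    show "cinner x y = 0" if "x \<in> u ` M" "y \<in> G ` C" for x y
    proof -
      obtain m c where mc: "m \<in> M" "x = u m" "c \<in> C" "y = G c" using \<open>x \<in> u ` M\<close> \<open>y \<in> G ` C\<close> by blast
      \<comment> \<open>Applying the isometry \<open>v\<close> to both vectors replaces
        \<open>G c\<close> by \<open>c\<close>, and \<open>M\<close> is invariant under
        \<open>v \<circ> u\<close>.\<close>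
      have "cinner x y = cinner (v (u m)) c"
        using v(3)[of "u m" "G c"] G[OF mc(3)] mc u(2) MV by auto
      also have "\<dots> = 0" using mc(3) vuM[OF mc(1)] by (subst cinner_zero_commute) (auto simp: C_def)
      finally show ?thesis .
    qed
    show "y = 0" if y: "y \<in> W" "\<And>x. x \<in> u ` M \<Longrightarrow> cinner x y = 0" "\<And>x. x \<in> G ` C \<Longrightarrow> cinner x y = 0" for y
    proof -
      have vyV: "v y \<in> V" using y(1) v(2) by blast
      have 1: "cinner (v y) c = 0" if "c \<in> C" for c
        using v(3)[OF y(1), of "G c"] G[OF that] y(3)[of "G c"] that
        by (simp add: cinner_zero_commute[of y])
      let ?d = "v y - proj M (v y)"
      have dC: "?d \<in> C" using orthogonal_decomposition[OF V M MV vyV] by (simp add: C_def)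
      have "cinner ?d ?d = 0"
        using 1[OF dC] dC closed_csubspace_proj(1)[OF M, of "v y"]
        by (simp add: cinner.diff_left[of "v y"] C_def cinner_zero_commute[of "proj M _"])
      then have vyM: "v y \<in> M" using closed_csubspace_proj(1)[OF M, of "v y"] by (simp add: cinner_self)
      \<comment> \<open>Orbit points of index 0 are orthogonal to the range of \<open>v\<close>. A
        later one is \<open>v (u _)\<close> of its predecessor, and \<open>y\<close> is orthogonal
        to the image of \<open>M\<close> under \<open>u\<close>. So \<open>v y\<close> lies in
        \<open>M\<close> and is orthogonal to it.\<close>
      have "cinner x (v y) = 0" if x: "x \<in> Orb" for x
      proof -
        obtain n where "x \<in> ((v \<circ> u) ^^ n) ` A" using x unfolding Orb_def by blast
        then obtain a where na: "a \<in> A" "x = ((v \<circ> u) ^^ n) a" by blast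
        show ?thesis
        proof (cases n)
          case 0
          then show ?thesis using na y(1) by (auto simp: A_def)
        next
          case (Suc k)
          let ?x = "((v \<circ> u) ^^ k) a"
          have xO: "?x \<in> Orb" using na(1) unfolding Orb_def by blast
          have xM: "?x \<in> M" using xO OM by blast
          have "x = v (u ?x)" using na(2) Suc by simp
          then have "cinner x (v y) = cinner (u ?x) y"
            using v(3)[OF _ y(1), of "u ?x"] u(2)[OF OV[OF na(1)], of k] by simp
          then show ?thesis using y(2) xM by simp
        qed
      qed
      then have "cinner (v y) (v y) = 0"
        using orthogonal_closure_cspan[of Orb "v y" "v y"] vyM unfolding M_def by blast
      then have "cinner y y = 0" using v(3)[OF y(1) y(1)] by simp
      then show ?thesis by (simp add: cinner_self)
    qed
    show "thesis" if "unitary_op V W U" "\<And>x. x \<in> M \<Longrightarrow> U x = u x" for U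
      using that(1) \<open>\<And>U. unitary_op V W U \<Longrightarrow> thesis\<close> by blast
  qed (rule refl)
qed

section \<open>Orthonormal bases and finite powers of a space\<close>

definition orthonormal :: "'a::complex_inner set \<Rightarrow> bool"
  where "orthonormal B \<longleftrightarrow> (\<forall>x\<in>B. \<forall>y\<in>B. cinner x y = (if x = y then 1 else 0))"

lemma orthonormal_basis_exists:
  obtains B :: "'a::chilbert_space set"
  where "orthonormal B" and "\<And>x. (\<And>b. b \<in> B \<Longrightarrow> cinner b x = 0) \<Longrightarrow> x = 0"
proof -
  have "\<exists>B\<in>{B :: 'a set. orthonormal B}. \<forall>C\<in>{B. orthonormal B}. B \<subseteq> C \<longrightarrow> C = B"
  proof (rule subset_Zorn')
    fix \<C> :: "'a set set" assume c: "subset.chain {B. orthonormal B} \<C>"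
    have "orthonormal (\<Union>\<C>)"
      unfolding orthonormal_def
    proof (intro ballI)
      fix x y assume "x \<in> \<Union>\<C>" "y \<in> \<Union>\<C>"
      then obtain C D where CD: "C \<in> \<C>" "D \<in> \<C>" "x \<in> C" "y \<in> D" by blast
      then have "C \<subseteq> D \<or> D \<subseteq> C" "orthonormal C" "orthonormal D"
        using c unfolding subset.chain_def by blast+
      then show "cinner x y = (if x = y then 1 else 0)"
        using CD unfolding orthonormal_def by blast
    qed
    then show "\<Union>\<C> \<in> {B. orthonormal B}" by simp
  qed
  then obtain B :: "'a set" where B: "orthonormal B" and max: "\<And>C. orthonormal C \<Longrightarrow> B \<subseteq> C \<Longrightarrow> C = B"
    by blast
  have "x = 0" if x: "\<And>b. b \<in> B \<Longrightarrow> cinner b x = 0" for x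
  proof (rule ccontr)
    assume "x \<noteq> 0"
    define e where "e = complex_of_real (inverse (norm x)) *\<^sub>C x"
    have be: "cinner b e = 0" "cinner e b = 0" if "b \<in> B" for b
      using x[OF that] cinner_zero_commute[of b x]
      by (simp_all add: e_def cinner_scaleC_right cinner_scaleC_left)
    have ee: "cinner e e = 1"
    proof -
      have "norm e = 1" using \<open>x \<noteq> 0\<close> unfolding e_def norm_scaleC norm_of_real by simp
      then show ?thesis by (simp add: cinner_self)
    qed
    then have "e \<notin> B" using be(1)[of e] by auto
    moreover have "orthonormal (insert e B)"
      using B be ee \<open>e \<notin> B\<close> by (auto simp: orthonormal_def)
    then have "insert e B = B" by (rule max) auto
    ultimately show False by blast
  qed
  then show ?thesis using that B by blast
qed

lemma finite_basis_spans:
  fixes B :: "'a::chilbert_space set"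
  assumes "finite B" "orthonormal B" "\<And>x. (\<And>b. b \<in> B \<Longrightarrow> cinner b x = 0) \<Longrightarrow> x = 0"
  shows "UNIV \<subseteq> cspan B"
proof
  fix x :: 'a
  define s where "s = (\<Sum>b\<in>B. cinner x b *\<^sub>C b)"
  have s: "s \<in> cspan B"
    unfolding s_def by (intro complex_vector.span_sum complex_vector.span_scale complex_vector.span_base)
  have "x - s = 0"
  proof (rule assms(3))
    fix b assume b: "b \<in> B"
    have "cinner b s = (\<Sum>c\<in>B. cnj (cinner x c) * cinner b c)"
      by (simp add: s_def cinner.sum_right cinner_scaleC_right)
    also have "\<dots> = (\<Sum>c\<in>B. if c = b then cnj (cinner x b) else 0)"
      using assms(2) b by (intro sum.cong) (auto simp: orthonormal_def)
    also have "\<dots> = cinner b x" using b assms(1) by (simp add: cinner_commute[of b x])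
    finally show "cinner b (x - s) = 0" by (simp add: cinner.diff_right)
  qed
  then show "x \<in> cspan B" using s by simp
qed

text \<open>An infinite set \<open>B\<close> satisfies \<open>|B \<times> m| = |B|\<close> for finite \<open>m\<close>.\<close>

lemma power_embedding:
  assumes "(UNIV :: 'k::chilbert_space set) = {0} \<or> \<not> (\<exists>F :: 'k::chilbert_space set. finite F \<and> UNIV \<subseteq> cspan F)"
  obtains j :: "'k::chilbert_space ^ 'm::finite \<Rightarrow> 'k"
  where "clinear_on UNIV j" "\<And>x y. cinner (j x) (j y) = cinner x y"
proof (cases "(UNIV :: 'k set) = {0}")
  case True
  have "x = 0" for x :: 'k using True by auto
  then have "(x :: 'k ^ 'm) = 0" for x by (simp add: vec_eq_iff)
  then have "cinner (0 :: 'k) 0 = cinner x y" for x y :: "'k ^ 'm"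
    by (metis cinner.zero_left)
  then show ?thesis using that[of "\<lambda>_. 0"] by (simp add: clinear_on_def scaleC.zero_right)
next
  case False
  obtain B :: "'k set" where B: "orthonormal B" and total: "\<And>x. (\<And>b. b \<in> B \<Longrightarrow> cinner b x = 0) \<Longrightarrow> x = 0"
    by (rule orthonormal_basis_exists) blast
  have inf: "infinite B"
    using finite_basis_spans[OF _ B total] assms False by blast
  have "(card_of (UNIV :: 'm set), card_of B) \<in> ordLeq"
    using inf by (intro ordLess_imp_ordLeq finite_ordLess_infinite) (auto simp: Field_card_of card_of_well_order_on)
  then have "(card_of (B \<times> (UNIV :: 'm set)), card_of B) \<in> ordIso"
    using card_of_Times_infinite[OF inf] by blast
  then obtain \<sigma> where \<sigma>: "bij_betw \<sigma> (B \<times> (UNIV :: 'm set)) B"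
    using card_of_ordIso by blast
  have \<sigma>B: "\<sigma> p \<in> B" if "p \<in> B \<times> UNIV" for p using \<sigma> that by (auto simp: bij_betw_def)
  \<comment> \<open>\<open>h\<close> places a basis vector in a single coordinate. These vectors
    form an orthonormal basis of the power, which \<open>\<sigma>\<close> matches with
    \<open>B\<close>.\<close>
  define h :: "'k \<times> 'm \<Rightarrow> 'k ^ 'm" where "h p = (\<chi> i. if i = snd p then fst p else 0)" for p
  have ch: "cinner (h p) x = cinner (fst p) (x $ snd p)" for p x
  proof -
    have "cinner (h p) x = (\<Sum>i\<in>UNIV. if i = snd p then cinner (fst p) (x $ snd p) else 0)"
      unfolding h_def cinner_vec_def by (intro sum.cong) (auto simp: cinner.zero_left)
    then show ?thesis by simp
  qed
  have gram: "cinner (h p) (h q) = cinner (\<sigma> p) (\<sigma> q)" if "p \<in> B \<times> UNIV" "q \<in> B \<times> UNIV" for p q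
  proof -
    have "\<sigma> p = \<sigma> q \<longleftrightarrow> p = q"
      using \<sigma> that by (auto simp: bij_betw_def dest: inj_onD)
    then have "cinner (\<sigma> p) (\<sigma> q) = (if p = q then 1 else 0)"
      using B \<sigma>B[OF that(1)] \<sigma>B[OF that(2)] by (simp add: orthonormal_def)
    moreover have "cinner (h p) (h q) = (if p = q then 1 else 0)"
      unfolding ch using that B
      by (cases p, cases q) (simp add: h_def orthonormal_def cinner.zero_right)
    ultimately show ?thesis by simp
  qed
  obtain F where F: "unitary_op (closure (cspan (h ` (B \<times> UNIV)))) (closure (cspan (\<sigma> ` (B \<times> UNIV)))) F"
    by (rule gram_unitary[of "B \<times> UNIV" h \<sigma>, OF gram])
  have "closure (cspan (h ` (B \<times> UNIV))) = UNIV"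
  proof (rule closed_csubspace_eqI[OF closed_csubspace_closure_cspan])
    fix y :: "'k ^ 'm" assume y: "\<And>x. x \<in> closure (cspan (h ` (B \<times> UNIV))) \<Longrightarrow> cinner x y = 0"
    have "y $ i = 0" for i
    proof (rule total)
      fix b assume "b \<in> B"
      then have "h (b, i) \<in> closure (cspan (h ` (B \<times> UNIV)))"
        using closure_cspan_superset[of "h ` (B \<times> UNIV)"] by blast
      then show "cinner b (y $ i) = 0" using y ch[of "(b, i)" y] by simp
    qed
    then show "y = 0" by (simp add: vec_eq_iff)
  qed auto
  then show ?thesis using F that[of F] by (auto simp: unitary_op_def)
qed

section \<open>The Drury-Arveson space\<close>

text \<open>Keeps the denominator of the kernel nonzero on the ball.\<close>

lemma cmod_cinner_less: "z \<in> unit_ball \<Longrightarrow> w \<in> unit_ball \<Longrightarrow> cinner z w \<noteq> 1"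
proof
  assume z: "z \<in> unit_ball" "w \<in> unit_ball" and "cinner z w = 1"
  then have "1 = inner z w" by (metis Re_cinner one_complex.simps(1))
  also have "\<dots> \<le> norm z * norm w" by (rule norm_cauchy_schwarz)
  also have "\<dots> \<le> norm z" using z by (simp add: mult_left_le)
  finally show False using z by simp
qed

lemma cinner_zero_0 [simp]: "cinner 0 x = 0" "cinner x 0 = 0"
  by (rule cinner.zero_left, rule cinner.zero_right)

lemma cinner_axis: "cinner x (axis i f) = cinner (x $ i) f"
proof -
  have "cinner x (axis i f) = (\<Sum>k\<in>UNIV. if k = i then cinner (x $ i) f else 0)"
    unfolding cinner_vec_def axis_def by (intro sum.cong) auto
  then show ?thesis by simp
qed

lemma norm_axis_cinner: "norm (axis i f :: 'a::complex_inner ^ 'n::finite) = norm f"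
  by (rule norm_eq_if_cinner_eq) (simp add: cinner_axis)

locale drury_arveson_space =
  fixes ev :: "'h::chilbert_space \<Rightarrow> complex ^ 'n::finite \<Rightarrow> 'e::chilbert_space"
  assumes da: "drury_arveson ev"
begin

definition kern :: "complex ^ 'n \<Rightarrow> 'e \<Rightarrow> 'h"
  where "kern w e = (SOME k. (\<forall>z\<in>unit_ball. ev k z = inverse (1 - cinner z w) *\<^sub>C e) \<and>
      (\<forall>f. cinner f k = cinner (ev f w) e))"

lemma kern: 
  assumes "w \<in> unit_ball"
  shows ev_kern: "z \<in> unit_ball \<Longrightarrow> ev (kern w e) z = inverse (1 - cinner z w) *\<^sub>C e"
    and cinner_kern: "cinner f (kern w e) = cinner (ev f w) e"
proof -
  have "\<exists>k. (\<forall>z\<in>unit_ball. ev k z = inverse (1 - cinner z w) *\<^sub>C e) \<and>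
      (\<forall>f. cinner f k = cinner (ev f w) e)"
    using da assms unfolding drury_arveson_def by blast
  from someI_ex[OF this]
  show "z \<in> unit_ball \<Longrightarrow> ev (kern w e) z = inverse (1 - cinner z w) *\<^sub>C e"
    "cinner f (kern w e) = cinner (ev f w) e"
    unfolding kern_def by auto
qed

lemma ev_linear:
  assumes "z \<in> unit_ball"
  shows "ev (f + g) z = ev f z + ev g z" "ev (c *\<^sub>C f) z = c *\<^sub>C ev f z" "ev 0 z = 0"
    "ev (f - g) z = ev f z - ev g z"
proof -
  have "clinear_on UNIV (\<lambda>f. ev f z)" using da assms unfolding drury_arveson_def by blast
  from clinear_on_ops[OF this]
  show "ev (f + g) z = ev f z + ev g z" "ev (c *\<^sub>C f) z = c *\<^sub>C ev f z" "ev 0 z = 0"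
    "ev (f - g) z = ev f z - ev g z" by auto
qed

lemma ev_inject: "(\<And>z. z \<in> unit_ball \<Longrightarrow> ev f z = ev g z) \<Longrightarrow> f = g"
  using da unfolding drury_arveson_def by blast

lemma cinner_kern_kern:
  "w \<in> unit_ball \<Longrightarrow> z \<in> unit_ball \<Longrightarrow>
    cinner (kern w e) (kern z e') = inverse (1 - cinner z w) * cinner e e'"
  by (simp add: cinner_kern ev_kern cinner_scaleC_left)

lemma kern_total:
  assumes "\<And>w e. w \<in> unit_ball \<Longrightarrow> cinner (kern w e) f = 0"
  shows "f = 0"
proof (rule ev_inject)
  fix z :: "complex ^ 'n" assume z: "z \<in> unit_ball"
  have "cinner (ev f z) (ev f z) = 0"
    using assms[OF z, of "ev f z"] cinner_kern[OF z, of f "ev f z"] by (simp add: cinner_zero_commute)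
  then show "ev f z = ev 0 z" by (simp add: cinner_self ev_linear[OF z])
qed

definition kernels :: "'h set" where "kernels = (\<lambda>(w, e). kern w e) ` (unit_ball \<times> UNIV)"

lemma kern_in_kernels: "w \<in> unit_ball \<Longrightarrow> kern w e \<in> kernels"
  unfolding kernels_def by (rule image_eqI[of _ _ "(w, e)"]) simp_all

lemma closure_cspan_kernels: "closure (cspan kernels) = UNIV"
proof (rule closed_csubspace_eqI[OF closed_csubspace_closure_cspan])
  fix y assume y: "\<And>x. x \<in> closure (cspan kernels) \<Longrightarrow> cinner x y = 0"
  show "y = 0"
  proof (rule kern_total)
    fix w :: "complex ^ 'n" and e :: 'e assume "w \<in> unit_ball"
    then have "kern w e \<in> closure (cspan kernels)"
      using closure_cspan_superset[of kernels] kern_in_kernels by blast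
    then show "cinner (kern w e) y = 0" by (rule y)
  qed
qed auto

text \<open>Kernels span a dense subspace, so a closed linear condition need only be tested on
  them.\<close>

lemma kernels_induct:
  assumes "closed_csubspace V" "\<And>w e. w \<in> unit_ball \<Longrightarrow> kern w e \<in> V"
  shows "f \<in> V"
  using closure_cspan_minimal[OF _ assms(1), of kernels] closure_cspan_kernels assms(2)
  by (force simp: kernels_def)

text \<open>A family with the Gram matrix of the kernels extends to an isometry of the whole space.
  This yields both the isometry of \<open>gleason\<close> and the lurking isometry behind the
  multiplier.\<close>

lemma kernel_isometry:
  fixes g :: "complex ^ 'n \<Rightarrow> 'e \<Rightarrow> 'k::chilbert_space"
  assumes "\<And>w z e e'. w \<in> unit_ball \<Longrightarrow> z \<in> unit_ball \<Longrightarrow>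
    cinner (g w e) (g z e') = inverse (1 - cinner z w) * cinner e e'"
  obtains F where "clinear_on UNIV F" "\<And>x y. cinner (F x) (F y) = cinner x y"
    "\<And>w e. w \<in> unit_ball \<Longrightarrow> F (kern w e) = g w e"
proof -
  let ?I = "unit_ball \<times> UNIV :: ((complex ^ 'n) \<times> 'e) set"
  have gram: "cinner ((\<lambda>(w, e). kern w e) i) ((\<lambda>(w, e). kern w e) j) =
      cinner ((\<lambda>(w, e). g w e) i) ((\<lambda>(w, e). g w e) j)" if "i \<in> ?I" "j \<in> ?I" for i j
    using that assms by (auto simp: cinner_kern_kern simp del: mem_ball_0)
  obtain F where F: "unitary_op (closure (cspan ((\<lambda>(w, e). kern w e) ` ?I)))
      (closure (cspan ((\<lambda>(w, e). g w e) ` ?I))) F"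
    "\<And>i. i \<in> ?I \<Longrightarrow> F ((\<lambda>(w, e). kern w e) i) = (\<lambda>(w, e). g w e) i"
    by (rule gram_unitary[of ?I "\<lambda>(w, e). kern w e" "\<lambda>(w, e). g w e", OF gram]) blast+
  show ?thesis
  proof (rule that)
    show "clinear_on UNIV F" "\<And>x y. cinner (F x) (F y) = cinner x y"
      using F(1) unfolding kernels_def[symmetric] closure_cspan_kernels unitary_op_def by auto
    show "F (kern w e) = g w e" if "w \<in> unit_ball" for w e
      using F(2)[of "(w, e)"] that by auto
  qed
qed

lemma mult_op_eqI:
  fixes ev' :: "'h' \<Rightarrow> complex ^ 'n \<Rightarrow> 'e'"
  assumes "\<And>z. z \<in> unit_ball \<Longrightarrow> ev g z = \<Phi> z (ev' f z)"
  shows "mult_op ev' ev \<Phi> f = g"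
  unfolding mult_op_def
proof (rule the_equality)
  show "g' = g" if "\<forall>z\<in>unit_ball. ev g' z = \<Phi> z (ev' f z)" for g'
    using that assms by (intro ev_inject) simp
qed (use assms in blast)

text \<open>The backward shifts. Until \<open>gleason\<close> shows that the coordinate
  multiplications exist and are bounded, nothing is known about this \<open>adj\<close>.\<close>

definition bwd :: "'n \<Rightarrow> 'h \<Rightarrow> 'h" where "bwd i = adj UNIV (coord_mult ev i)"

text \<open>The isometry \<open>f \<mapsto> (f(0), (M\<^sub>i\<^sup>* f)\<^sub>i)\<close>, which comes from
  \<open>K(z,w) = 1 + \<Sum>\<^sub>i z\<^sub>i cnj w\<^sub>i K(z,w)\<close>; the multiplications \<open>M\<^sub>i\<close> are constructed from its adjoint.\<close>

lemma gleason:
  shows ev_coord_mult: "z \<in> unit_ball \<Longrightarrow> ev (coord_mult ev i f) z = (z $ i) *\<^sub>C ev f z"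
    and cinner_bwd: "cinner f (bwd i g) = cinner (coord_mult ev i f) g"
    and clinear_bwd: "clinear_on UNIV (bwd i)"
    and bwd_kern: "w \<in> unit_ball \<Longrightarrow> bwd i (kern w e) = cnj (w $ i) *\<^sub>C kern w e"
    and cinner_gleason: "cinner f g = cinner (ev f 0) (ev g 0) + (\<Sum>i\<in>UNIV. cinner (bwd i f) (bwd i g))"
proof -
  define g where "g w e = (e, \<chi> i. cnj (w $ i) *\<^sub>C kern w e)" for w :: "complex ^ 'n" and e
  have gram: "cinner (g w e) (g z e') = inverse (1 - cinner z w) * cinner e e'"
    if wz: "w \<in> unit_ball" "z \<in> unit_ball" for w z e e'
  proof -
    have "cinner (g w e) (g z e') = cinner e e' +
        (\<Sum>i\<in>UNIV. z $ i * cnj (w $ i)) * cinner (kern w e) (kern z e')"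
      by (simp add: g_def cinner_prod_def cinner_vec_def cinner_scaleC_left cinner_scaleC_right
          sum_distrib_left mult_ac)
    also have "(\<Sum>i\<in>UNIV. z $ i * cnj (w $ i)) = cinner z w"
      by (simp add: cinner_vec_def cinner_complex_def)
    also have "cinner (kern w e) (kern z e') = inverse (1 - cinner z w) * cinner e e'"
      by (rule cinner_kern_kern[OF wz])
    also have "cinner e e' + cinner z w * (inverse (1 - cinner z w) * cinner e e') =
        inverse (1 - cinner z w) * cinner e e'"
      using cmod_cinner_less[OF wz(2,1)] by (simp add: field_simps)
    finally show ?thesis .
  qed
  obtain J where J: "clinear_on UNIV J" "\<And>x y. cinner (J x) (J y) = cinner x y"
    "\<And>w e. w \<in> unit_ball \<Longrightarrow> J (kern w e) = g w e"
    by (rule kernel_isometry[OF gram]) blast+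
  have Jn: "norm (J x) \<le> 1 * norm x" for x using norm_eq_if_cinner_eq[OF J(2)[of x x]] by simp
  note aJ = closed_csubspace_UNIV J(1) Jn
  \<comment> \<open>\<open>M i\<close> is the adjoint of the i-th backward component of
    \<open>J\<close>. Starting from an adjoint gives boundedness for free, and pairing with kernels
    identifies it as multiplication by \<open>z $ i\<close>.\<close>
  define M where "M i f = adj UNIV J (0, axis i f)" for i f
  have M: "cinner f (M i h) = cinner (snd (J f) $ i) h" for f i h
    unfolding M_def cinner_adj[OF aJ UNIV_I] by (simp add: cinner_prod_def cinner_axis)
  have evM: "ev (M i f) z = (z $ i) *\<^sub>C ev f z" if z: "z \<in> unit_ball" for z i f
  proof (rule cinner_ext)
    fix e
    have "cinner e (ev (M i f) z) = cinner (kern z e) (M i f)"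
      using cinner_kern[OF z, of "M i f" e] by (metis cinner_commute)
    also have "\<dots> = cnj (z $ i) * cinner (kern z e) f"
      by (simp add: M J(3)[OF z] g_def cinner_scaleC_left)
    also have "\<dots> = cinner e ((z $ i) *\<^sub>C ev f z)"
      using cinner_kern[OF z, of f e] by (metis cinner_commute cinner_scaleC_right)
    finally show "cinner e (ev (M i f) z) = cinner e ((z $ i) *\<^sub>C ev f z)" .
  qed
  have cM: "coord_mult ev i f = M i f" for i f
    unfolding coord_mult_def by (rule mult_op_eqI) (simp add: evM)
  show evc: "z \<in> unit_ball \<Longrightarrow> ev (coord_mult ev i f) z = (z $ i) *\<^sub>C ev f z" for z i f
    by (simp add: cM evM)
  have lin: "clinear_on UNIV (coord_mult ev i)" for i
    by (rule clinear_onI; rule ev_inject) (simp_all add: evc ev_linear scaleC_add_right mult.commute)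
  have nc: "norm (coord_mult ev i f) \<le> 1 * norm f" for i f
    unfolding cM M_def using norm_adj_le[OF aJ, of "(0, axis i f)"]
    by (simp add: norm_Pair norm_axis_cinner)
  note ab = closed_csubspace_UNIV lin nc
  show cb: "cinner f (bwd i g) = cinner (coord_mult ev i f) g" for f g i
    unfolding bwd_def by (rule cinner_adj[OF ab UNIV_I])
  show "clinear_on UNIV (bwd i)" for i
    unfolding bwd_def by (rule clinear_adj[OF ab])
  have bJ: "bwd i f = snd (J f) $ i" for i f
    by (rule cinner_ext) (metis M cM cb cinner_commute)
  show "w \<in> unit_ball \<Longrightarrow> bwd i (kern w e) = cnj (w $ i) *\<^sub>C kern w e" for w i e
    by (simp add: bJ J(3) g_def)
  have z0: "(0 :: complex ^ 'n) \<in> unit_ball" by simp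
  have fJ: "fst (J f) = ev f 0" for f
  proof (rule cinner_ext)
    fix e
    \<comment> \<open>The kernel at 0 is the constant function \<open>e\<close>, and pairing with it
      evaluates at 0. This identifies the first component of \<open>J\<close>.\<close>
    have "adj UNIV J (e, 0) = kern 0 e"
    proof (rule ev_inject)
      fix z :: "complex ^ 'n" assume z: "z \<in> unit_ball"
      show "ev (adj UNIV J (e, 0)) z = ev (kern 0 e) z"
      proof (rule cinner_ext)
        fix e'
        have "cinner e' (ev (adj UNIV J (e, 0)) z) = cinner (kern z e') (adj UNIV J (e, 0))"
          using cinner_kern[OF z] by (metis cinner_commute)
        also have "\<dots> = cinner e' e"
          unfolding cinner_adj[OF aJ UNIV_I] by (simp add: J(3)[OF z] g_def cinner_prod_def)
        also have "\<dots> = cinner e' (ev (kern 0 e) z)"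
          by (simp add: ev_kern[OF z0 z])
        finally show "cinner e' (ev (adj UNIV J (e, 0)) z) = cinner e' (ev (kern 0 e) z)" .
      qed
    qed
    then have "cinner f (kern 0 e) = cinner (J f) (e, 0)"
      using cinner_adj[OF aJ UNIV_I, of f "(e, 0)"] by simp
    then have "cinner (ev f 0) e = cinner (fst (J f)) e"
      by (simp add: cinner_kern[OF z0] cinner_prod_def)
    then show "cinner e (fst (J f)) = cinner e (ev f 0)" by (metis cinner_commute)
  qed
  have "cinner f f' = cinner (J f) (J f')" for f f' by (simp add: J(2))
  also have "cinner (J f) (J f') =
      cinner (ev f 0) (ev f' 0) + (\<Sum>i\<in>UNIV. cinner (bwd i f) (bwd i f'))" for f f'
    by (simp add: cinner_prod_def cinner_vec_def fJ bJ)
  finally show "cinner f f' =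
      cinner (ev f 0) (ev f' 0) + (\<Sum>i\<in>UNIV. cinner (bwd i f) (bwd i f'))" for f f' .
qed

lemmas bwd_linear = clinear_on_ops[OF clinear_bwd, simplified]

lemma norm_gleason: "(norm f)\<^sup>2 = (norm (ev f 0))\<^sup>2 + (\<Sum>i\<in>UNIV. (norm (bwd i f))\<^sup>2)"
proof -
  have "complex_of_real ((norm f)\<^sup>2) =
      complex_of_real ((norm (ev f 0))\<^sup>2 + (\<Sum>i\<in>UNIV. (norm (bwd i f))\<^sup>2))"
    using cinner_gleason[of f f] by (simp add: cinner_self)
  then show ?thesis by (simp only: of_real_eq_iff)
qed

lemma norm_ev0_le: "norm (ev f 0) \<le> norm f" and norm_bwd_le: "norm (bwd i f) \<le> norm f"
proof -
  have "(norm (bwd i f))\<^sup>2 \<le> (\<Sum>i\<in>UNIV. (norm (bwd i f))\<^sup>2)"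
    by (rule member_le_sum) auto
  then have "(norm (ev f 0))\<^sup>2 \<le> (norm f)\<^sup>2" "(norm (bwd i f))\<^sup>2 \<le> (norm f)\<^sup>2"
    using zero_le_power2[of "norm (ev f 0)"] zero_le_power2[of "norm (bwd i f)"]
    unfolding norm_gleason[of f] by linarith+
  then show "norm (ev f 0) \<le> norm f" "norm (bwd i f) \<le> norm f"
    by (auto intro: power2_le_imp_le)
qed

text \<open>\<open>mass m f\<close> is the sum of \<open>\<parallel>M\<^sub>\<alpha>\<^sup>* f\<parallel>\<^sup>2\<close> over the words \<open>\<alpha>\<close> of length \<open>m\<close>; its convergence to \<open>0\<close> is the
  purity of the tuple \<open>(M\<^sub>i\<^sup>*)\<close>.\<close>

fun mass :: "nat \<Rightarrow> 'h \<Rightarrow> real" where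
  "mass 0 f = (norm f)\<^sup>2"
| "mass (Suc m) f = (\<Sum>i\<in>UNIV. mass m (bwd i f))"

lemma mass_nonneg: "0 \<le> mass m f"
  by (induction m arbitrary: f) (auto intro: sum_nonneg)

lemma mass_le: "mass m f \<le> (norm f)\<^sup>2"
proof (induction m arbitrary: f)
  case (Suc m)
  have "mass (Suc m) f \<le> (\<Sum>i\<in>UNIV. (norm (bwd i f))\<^sup>2)"
    using Suc by (auto intro: sum_mono)
  also have "\<dots> \<le> (norm f)\<^sup>2" by (simp add: norm_gleason[of f])
  finally show ?case .
qed simp

text \<open>The parallelogram law at each word. A triangle inequality with factor 2 is enough to
  make convergence of \<open>mass\<close> to 0 a linear condition.\<close>

lemma mass_add: "mass m (f + g) \<le> 2 * mass m f + 2 * mass m g"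
proof (induction m arbitrary: f g)
  case 0
  have "(norm (f + g))\<^sup>2 + (norm (f - g))\<^sup>2 = 2 * (norm f)\<^sup>2 + 2 * (norm g)\<^sup>2"
    by (simp add: power2_norm_eq_inner inner_add_left inner_add_right inner_diff_left inner_diff_right)
  then show ?case using zero_le_power2[of "norm (f - g)"] unfolding mass.simps by linarith
next
  case (Suc m)
  have "mass (Suc m) (f + g) \<le> (\<Sum>i\<in>UNIV. 2 * mass m (bwd i f) + 2 * mass m (bwd i g))"
    unfolding mass.simps bwd_linear by (intro sum_mono Suc)
  then show ?case by (simp add: sum.distrib sum_distrib_left)
qed

lemma mass_scaleC: "mass m (c *\<^sub>C f) = (cmod c)\<^sup>2 * mass m f"
  by (induction m arbitrary: f) (simp_all add: norm_scaleC power_mult_distrib bwd_linear sum_distrib_left)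

lemma mass_kern: "w \<in> unit_ball \<Longrightarrow> mass m (kern w e) = (norm w)\<^sup>2 ^ m * (norm (kern w e))\<^sup>2"
proof (induction m)
  case (Suc m)
  have "(norm w)\<^sup>2 = (\<Sum>i\<in>UNIV. (cmod (w $ i))\<^sup>2)"
    by (simp add: norm_vec_def L2_set_def sum_nonneg)
  then show ?case using Suc by (simp add: bwd_kern mass_scaleC sum_distrib_right[symmetric] mult_ac)
qed simp

text \<open>Kernels are joint eigenvectors of the backward shifts, so their mass decays like
  |w|^(2m). The vectors with limit 0 form a subspace, which is closed because \<open>mass m\<close>
  is bounded by the squared norm uniformly in \<open>m\<close>.\<close>

lemma mass_tendsto_zero: "(\<lambda>m. mass m f) \<longlonglongrightarrow> 0"
proof -
  define V where "V = {f. (\<lambda>m. mass m f) \<longlonglongrightarrow> 0}"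
  have add: "f + g \<in> V" if "f \<in> V" "g \<in> V" for f g
  proof -
    have "(\<lambda>m. 2 * mass m f + 2 * mass m g) \<longlonglongrightarrow> 2 * 0 + 2 * 0"
      using that by (intro tendsto_intros) (simp_all add: V_def)
    then have "(\<lambda>m. mass m (f + g)) \<longlonglongrightarrow> 0"
      using mass_add[of _ f g]
      by (intro tendsto_sandwich[OF _ _ tendsto_const, of 0 "\<lambda>m. mass m (f + g)"])
        (simp_all add: always_eventually mass_nonneg)
    then show ?thesis by (simp add: V_def)
  qed
  have "closed_csubspace V"
    unfolding closed_csubspace_def
  proof (intro conjI csubspaceI)
    show "0 \<in> V" using mass_scaleC[of _ 0 0] by (simp add: V_def)
    show "f + g \<in> V" if "f \<in> V" "g \<in> V" for f g by (rule add[OF that])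
    show "c *\<^sub>C f \<in> V" if "f \<in> V" for c f
      using tendsto_mult[OF tendsto_const[of "(cmod c)\<^sup>2"], of "\<lambda>m. mass m f" 0 sequentially] that
      by (simp add: V_def mass_scaleC)
    show "closed V"
      unfolding closure_subset_eq[symmetric]
    proof
      fix f assume "f \<in> closure V"
      then have f: "\<forall>e>0. \<exists>g\<in>V. dist g f < e" by (simp add: closure_approachable)
      show "f \<in> V"
        unfolding V_def mem_Collect_eq LIMSEQ_iff
      proof (intro allI impI)
        fix r :: real assume r: "r > 0"
        then obtain g where g: "g \<in> V" "dist g f < sqrt (r / 4)"
          using f[rule_format, of "sqrt (r / 4)"] by auto
        have "(norm (f - g))\<^sup>2 < (sqrt (r / 4))\<^sup>2"
          using g(2) by (intro power_strict_mono) (auto simp: dist_norm norm_minus_commute)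
        then have fg: "(norm (f - g))\<^sup>2 < r / 4" using r by simp
        obtain N where N: "\<forall>n\<ge>N. mass n g < r / 4"
          using g(1) r unfolding V_def mem_Collect_eq LIMSEQ_iff
          by (metis (no_types, opaque_lifting) abs_ge_self diff_zero divide_pos_pos le_less_trans
              real_norm_def zero_less_numeral)
        have "mass n f < r" if "n \<ge> N" for n
        proof -
          have "mass n f \<le> 2 * mass n (f - g) + 2 * mass n g" using mass_add[of n "f - g" g] by simp
          then show ?thesis using N that mass_le[of n "f - g"] fg by fastforce
        qed
        then show "\<exists>no. \<forall>n\<ge>no. norm (mass n f - 0) < r"
          using mass_nonneg by auto
      qed
    qed
  qed
  moreover have "kern w e \<in> V" if w: "w \<in> unit_ball" for w e
  proof -
    have "(norm w)\<^sup>2 < 1" using w by (simp add: abs_square_less_1)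
    then have "(\<lambda>m. (norm w)\<^sup>2 ^ m * (norm (kern w e))\<^sup>2) \<longlonglongrightarrow> 0 * (norm (kern w e))\<^sup>2"
      by (intro tendsto_intros LIMSEQ_realpow_zero) auto
    then show ?thesis by (simp add: V_def mass_kern[OF w])
  qed
  ultimately show ?thesis using kernels_induct[of V f] by (simp add: V_def)
qed

text \<open>Iterating \<open>step\<close> bounds |F f|^2 by the sum of |F M_\<alpha>^* f|^2 over the
  words \<alpha> of length m, hence by \<open>C\<^sup>2 * mass m f\<close>, which tends to
  0.\<close>

lemma pure_zero:
  fixes F :: "'h \<Rightarrow> 'k::real_normed_vector"
  assumes Q: "\<And>f i. f \<in> Q \<Longrightarrow> bwd i f \<in> Q"
    and C: "\<And>f. f \<in> Q \<Longrightarrow> norm (F f) \<le> C * norm f"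
    and step: "\<And>f. f \<in> Q \<Longrightarrow> (norm (F f))\<^sup>2 \<le> (\<Sum>i\<in>UNIV. (norm (F (bwd i f)))\<^sup>2)"
    and f: "f \<in> Q"
  shows "F f = 0"
proof -
  have "(norm (F f))\<^sup>2 \<le> C\<^sup>2 * mass m f" if "f \<in> Q" for m f
    using that
  proof (induction m arbitrary: f)
    case 0
    then show ?case using power_mono[OF C[OF 0] norm_ge_zero, of 2] by (simp add: power_mult_distrib)
  next
    case (Suc m)
    have "(norm (F f))\<^sup>2 \<le> (\<Sum>i\<in>UNIV. (norm (F (bwd i f)))\<^sup>2)" by (rule step[OF Suc.prems])
    also have "\<dots> \<le> (\<Sum>i\<in>UNIV. C\<^sup>2 * mass m (bwd i f))" by (intro sum_mono Suc.IH Q Suc.prems)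
    finally show ?case by (simp add: sum_distrib_left)
  qed
  moreover have "(\<lambda>m. C\<^sup>2 * mass m f) \<longlonglongrightarrow> C\<^sup>2 * 0"
    by (intro tendsto_intros mass_tendsto_zero)
  ultimately have "(norm (F f))\<^sup>2 \<le> C\<^sup>2 * 0"
    using f by (intro LIMSEQ_le[OF tendsto_const[of "(norm (F f))\<^sup>2"], of _ "C\<^sup>2 * 0"]) auto
  then show ?thesis by simp
qed

text \<open>The powers of a coordinate applied to a constant function are linearly independent.\<close>

lemma infinite_dimensional:
  assumes e: "(e :: 'e) \<noteq> 0" and F: "finite (F :: 'h set)" "UNIV \<subseteq> cspan F"
  shows False
proof -
  obtain i :: 'n where True by blast
  define p where "p k = (coord_mult ev i ^^ k) (kern 0 e)" for k
  have ev_p: "ev (p k) z = (z $ i) ^ k *\<^sub>C e" if z: "z \<in> unit_ball" for k z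
  proof (induction k)
    case 0
    then show ?case by (simp add: p_def ev_kern[OF _ z])
  next
    case (Suc k)
    have "p (Suc k) = coord_mult ev i (p k)" by (simp add: p_def)
    then show ?case by (simp add: ev_coord_mult[OF z] Suc)
  qed
  \<comment> \<open>Restricted to the disc in direction \<open>i\<close>, a relation among the
    \<open>p k\<close> becomes a scalar polynomial with infinitely many zeros, since
    \<open>e\<close> is nonzero.\<close>
  have vanish: "c k = 0" if s: "(\<Sum>k<N. c k *\<^sub>C p k) = 0" and k: "k < N" for c N k
  proof -
    have "(\<Sum>k\<le>N - 1. c k * t ^ k) = 0" if t: "cmod t < 1" for t
    proof -
      have z: "axis i t \<in> unit_ball" using t by (simp add: norm_axis_cinner)
      have evs: "ev (\<Sum>k\<in>A. c k *\<^sub>C p k) (axis i t) = (\<Sum>k\<in>A. c k * t ^ k) *\<^sub>C e" if "finite A" for A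
        using that
      proof (induction A)
        case empty
        then show ?case by (simp add: ev_linear[OF z])
      next
        case (insert x A)
        then show ?case by (simp add: ev_linear[OF z] ev_p[OF z] scaleC_add_left)
      qed
      have "(\<Sum>k<N. c k * t ^ k) *\<^sub>C e = 0"
        using evs[of "{..<N}"] s by (simp add: ev_linear[OF z])
      then have "(\<Sum>k<N. c k * t ^ k) = 0" using e by simp
      moreover have "{..<N} = {..N - 1}" using k by auto
      ultimately show ?thesis by simp
    qed
    then have "ball 0 1 \<subseteq> {t. (\<Sum>k\<le>N - 1. c k * t ^ k) = 0}" by auto
    moreover have "infinite (ball (0 :: complex) 1)"
      using uncountable_ball[of 1 "0 :: complex"] by (auto dest: countable_finite simp del: mem_ball_0)
    ultimately have "infinite {t. (\<Sum>k\<le>N - 1. c k * t ^ k) = 0}"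
      using finite_subset by blast
    moreover have "k \<le> N - 1" using k by simp
    ultimately show "c k = 0"
      using Transcendental.polyfun_finite_roots[of c "N - 1"] by blast
  qed
  have inj: "inj p"
  proof (rule linorder_injI)
    fix j k :: nat assume jk: "j < k"
    show "p j \<noteq> p k"
    proof
      assume eq: "p j = p k"
      \<comment> \<open>A coincidence \<open>p j = p k\<close> is itself a linear relation, with
        coefficient 1 at \<open>k\<close> and -1 at \<open>j\<close>.\<close>
      define c where "c l = (if l = k then 1 else 0) - (if l = j then 1 else (0 :: complex))" for l
      have "(\<Sum>l<Suc k. c l *\<^sub>C p l) = (\<Sum>l<Suc k. (if l = k then p k else 0) - (if l = j then p j else 0))"
        by (intro sum.cong) (auto simp: c_def scaleC.diff_left)
      also have "\<dots> = 0" using jk by (simp add: sum_subtractf eq)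
      finally have "c k = 0" by (rule vanish) simp
      then show False using jk by (simp add: c_def)
    qed
  qed
  have ind: "complex_vector.independent (range p)"
    unfolding complex_vector.independent_explicit_module
  proof (intro allI impI)
    fix t u v
    assume t: "finite t" "t \<subseteq> range p" "(\<Sum>v\<in>t. u v *\<^sub>C v) = 0" "v \<in> t"
    define K where "K = p -` t"
    have K: "finite K" "t = p ` K"
      using t(1,2) inj by (auto simp: K_def intro: finite_vimageI)
    obtain N where N: "K \<subseteq> {..<N}" using finite_nat_bounded[OF K(1)] by blast
    define c where "c k = (if k \<in> K then u (p k) else 0)" for k
    have "(\<Sum>k<N. c k *\<^sub>C p k) = (\<Sum>k\<in>K. u (p k) *\<^sub>C p k)"
      using N by (intro sum.mono_neutral_cong_right) (auto simp: c_def)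
    also have "\<dots> = (\<Sum>v\<in>t. u v *\<^sub>C v)"
      unfolding K(2) using inj by (subst sum.reindex) (auto simp: inj_on_def)
    finally have sum0: "(\<Sum>k<N. c k *\<^sub>C p k) = 0" using t(3) by simp
    obtain k where k: "k \<in> K" "v = p k" using t(4) K(2) by blast
    then have "c k = 0" using vanish[OF sum0] N by blast
    then show "u v = 0" using k by (simp add: c_def)
  qed
  have "finite (range p)"
    using complex_vector.independent_span_bound[OF F(1) ind] F(2) by blast
  then show False using inj finite_imageD by blast
qed

end

section \<open>Unitary colligations\<close>

lemma closed_csubspace_Times:
  assumes "closed_csubspace V" "closed_csubspace W"
  shows "closed_csubspace (V \<times> W)"
  unfolding closed_csubspace_def
proof
  note V = csubspace_closed_ops[OF closed_csubspaceD(1)[OF assms(1)]]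
  note W = csubspace_closed_ops[OF closed_csubspaceD(1)[OF assms(2)]]
  show "csubspace (V \<times> W)"
    by (rule csubspaceI) (auto simp: zero_prod_def scaleC_prod_def V(1,2,4) W(1,2,4))
  show "closed (V \<times> W)"
    using assms by (intro closed_Times) (auto dest: closed_csubspaceD)
qed

lemma closed_csubspace_power_space:
  assumes "closed_csubspace R"
  shows "closed_csubspace (power_space R :: ('r::chilbert_space ^ 'n::finite) set)"
  unfolding closed_csubspace_def
proof
  note R = csubspace_closed_ops[OF closed_csubspaceD(1)[OF assms]]
  show "csubspace (power_space R :: ('r ^ 'n) set)"
    by (rule csubspaceI) (auto simp: power_space_def scaleC_vec_def R(1,2,4))
  have "power_space R = (\<Inter>i. {v :: 'r ^ 'n. v $ i \<in> R})" by (auto simp: power_space_def)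
  moreover have "closed {v :: 'r ^ 'n. v $ i \<in> R}" for i
    using closed_csubspaceD(2)[OF assms]
    by (intro closed_vimage[unfolded vimage_def] continuous_intros)
  ultimately show "closed (power_space R :: ('r ^ 'n) set)" by auto
qed

section \<open>The row operator Z and its adjoint column\<close>

definition row_op :: "complex ^ 'n::finite \<Rightarrow> 'r::complex_inner ^ 'n \<Rightarrow> 'r"
  where "row_op z v = (\<Sum>i\<in>UNIV. (z $ i) *\<^sub>C (v $ i))"

definition col_op :: "complex ^ 'n::finite \<Rightarrow> 'r::complex_inner \<Rightarrow> 'r ^ 'n"
  where "col_op z r = (\<chi> i. cnj (z $ i) *\<^sub>C r)"

lemma row_linear:
  "row_op z (u + v) = row_op z u + row_op z v" "row_op z (u - v) = row_op z u - row_op z v"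
  "row_op z (c *\<^sub>C v) = c *\<^sub>C row_op z v"
  "row_op (z + w) v = row_op z v + row_op w v" "row_op (z - w) v = row_op z v - row_op w v"
  "row_op (c *\<^sub>C z) v = c *\<^sub>C row_op z v" "row_op z 0 = 0"
  by (simp_all add: row_op_def scaleC_add_right scaleC_add_left scaleC.diff_left scaleC.diff_right
      sum.distrib sum_subtractf scaleC_vec_def scaleC_complex_def scaleC.sum_right mult.commute)

lemma norm_row: "norm (row_op z v) \<le> norm z * norm v"
proof -
  have "norm (row_op z v) \<le> (\<Sum>i\<in>UNIV. \<bar>norm (z $ i)\<bar> * \<bar>norm (v $ i)\<bar>)"
    unfolding row_op_def by (rule order_trans[OF norm_sum]) (simp add: norm_scaleC)
  also have "\<dots> \<le> L2_set (\<lambda>i. norm (z $ i)) UNIV * L2_set (\<lambda>i. norm (v $ i)) UNIV"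
    by (rule L2_set_mult_ineq)
  finally show ?thesis by (simp add: norm_vec_def)
qed

lemma cinner_row: "cinner (row_op z v) r = cinner v (col_op z r)"
  by (simp add: row_op_def col_op_def cinner_vec_def cinner.sum_left cinner_scaleC_left cinner_scaleC_right)

text \<open>This is Z W^* = <z,w> I for the row operators Z, W at \<open>z\<close>,
  \<open>w\<close>: the origin of the scalar in the kernel.\<close>

lemma cinner_col: "cinner (col_op w r) (col_op z r') = cinner z w * cinner r r'"
  by (simp add: col_op_def cinner_vec_def[of "\<chi> i. _ i"] cinner_vec_def[of z] cinner_complex_def
      cinner_scaleC_left cinner_scaleC_right sum_distrib_left mult_ac)

lemma col_linear: "col_op z (r + s) = col_op z r + col_op z s" "col_op z (c *\<^sub>C r) = c *\<^sub>C col_op z r"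
  by (simp_all add: col_op_def vec_eq_iff scaleC_vec_def scaleC_add_right mult.commute)

lemma norm_col: "norm (col_op z r) = norm z * norm r"
proof -
  have "complex_of_real ((norm (col_op z r))\<^sup>2) = complex_of_real ((norm z * norm r)\<^sup>2)"
    using cinner_col[of z r z r] by (simp add: cinner_self power_mult_distrib)
  then have "(norm (col_op z r))\<^sup>2 = (norm z * norm r)\<^sup>2" by (simp only: of_real_eq_iff)
  then show ?thesis by (simp add: power2_eq_iff_nonneg)
qed

lemma row_in: "csubspace R \<Longrightarrow> v \<in> power_space R \<Longrightarrow> row_op z v \<in> R"
  unfolding row_op_def power_space_def
  by (intro complex_vector.subspace_sum complex_vector.subspace_scale) auto

lemma col_in: "csubspace R \<Longrightarrow> r \<in> R \<Longrightarrow> col_op z r \<in> power_space R"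
  by (simp add: col_op_def power_space_def complex_vector.subspace_scale)

text \<open>Inverts I - F on a closed subspace. The contraction principle replaces the Neumann
  series and delivers existence and uniqueness at once.\<close>

lemma affine_fixed_point:
  fixes V :: "'a::chilbert_space set"
  assumes V: "closed_csubspace V" and F: "clinear_on V F" and FV: "\<And>x. x \<in> V \<Longrightarrow> F x \<in> V"
    and c: "0 \<le> c" "c < 1" and bd: "\<And>x. x \<in> V \<Longrightarrow> norm (F x) \<le> c * norm x" and p: "p \<in> V"
  shows "\<exists>!x. x \<in> V \<and> x = p + F x"
proof -
  note V' = csubspace_closed_ops[OF closed_csubspaceD(1)[OF V]]
  note F' = clinear_on_ops[OF F closed_csubspaceD(1)[OF V]]
  have "\<exists>!x\<in>V. p + F x = x"
  proof (rule Banach_fix[OF _ _ c])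
    show "complete V" using closed_csubspaceD(2)[OF V] by (simp add: complete_eq_closed)
    show "V \<noteq> {}" using V'(1) by auto
    show "(\<lambda>x. p + F x) ` V \<subseteq> V" using V'(2) FV p by auto
    show "dist (p + F x) (p + F y) \<le> c * dist x y" if "x \<in> V" "y \<in> V" for x y
      using bd[OF V'(3)[OF that]] F'(3)[OF that] by (simp add: dist_norm)
  qed
  then show ?thesis by (auto simp: eq_commute[of "p + F _"])
qed

lemma norm_le_geometric:
  fixes x p c :: real
  assumes "x \<le> p + c * x" "c < 1"
  shows "x \<le> p / (1 - c)"
proof -
  have "x * (1 - c) \<le> p" using assms(1) by (simp add: right_diff_distrib mult.commute)
  then show ?thesis using assms(2) by (simp add: pos_le_divide_eq)
qed

lemma has_derivativeI_quadratic:
  fixes f :: "'a::real_normed_vector \<Rightarrow> 'b::real_normed_vector"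
  assumes "bounded_linear f'" "\<delta> > 0"
    and q: "\<And>z. norm (z - w) < \<delta> \<Longrightarrow> norm (f z - f w - f' (z - w)) \<le> C * (norm (z - w))\<^sup>2"
  shows "(f has_derivative f') (at w)"
  unfolding has_derivative_iff_norm
proof (rule conjI[OF assms(1)], rule tendsto_sandwich[OF _ _ tendsto_const])
  show "\<forall>\<^sub>F z in at w. 0 \<le> norm (f z - f w - f' (z - w)) / norm (z - w)"
    by (intro always_eventually) simp
  show "\<forall>\<^sub>F z in at w. norm (f z - f w - f' (z - w)) / norm (z - w) \<le> C * norm (z - w)"
    unfolding eventually_at
  proof (intro exI[of _ \<delta>] conjI assms(2) ballI impI)
    fix z assume z: "z \<noteq> w \<and> dist z w < \<delta>"
    then have "norm (f z - f w - f' (z - w)) \<le> C * (norm (z - w))\<^sup>2"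
      using q by (simp add: dist_norm)
    then show "norm (f z - f w - f' (z - w)) / norm (z - w) \<le> C * norm (z - w)"
      using z by (simp add: pos_divide_le_eq power2_eq_square mult.assoc)
  qed
  have "((\<lambda>z. C * norm (z - w)) \<longlongrightarrow> C * norm (w - w)) (at w)"
    by (intro tendsto_intros)
  then show "((\<lambda>z. C * norm (z - w)) \<longlongrightarrow> 0) (at w)" by simp
qed

lemma norm_snd_component: "norm (snd p) \<le> norm p"
  by (cases p) (simp add: norm_snd_le)

text \<open>The equation \<open>v = snd (K (a, f v))\<close> occurs twice: with
  \<open>U\<^sup>*\<close> and the row operator for the transfer function, and with \<open>U\<close>
  and the adjoint column for the residual part. In both cases \<open>K\<close> is isometric and
  \<open>f\<close> has norm at most |z| < 1, so solvability, linearity and the bound by |a| / (1 -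
  |z|) are proved once.\<close>

locale feedback_loop =
  fixes A :: "'a::chilbert_space set" and B :: "'b::chilbert_space set" and C :: "'c::chilbert_space set"
    and K :: "'a \<times> 'b \<Rightarrow> 'd::chilbert_space \<times> 'c" and f :: "'c \<Rightarrow> 'b" and c :: real
  assumes A: "csubspace A" and B: "csubspace B" and C: "closed_csubspace C"
    and K: "clinear_on (A \<times> B) K" and KC: "\<And>p. p \<in> A \<times> B \<Longrightarrow> snd (K p) \<in> C"
    and norm_K: "\<And>p. p \<in> A \<times> B \<Longrightarrow> norm (K p) = norm p"
    and f: "clinear_on UNIV f" and fB: "\<And>v. v \<in> C \<Longrightarrow> f v \<in> B"
    and norm_f: "\<And>v. norm (f v) \<le> c * norm v" and c: "0 \<le> c" "c < 1"
begin

definition feedback :: "'a \<Rightarrow> 'c" where "feedback a = (THE v. v \<in> C \<and> v = snd (K (a, f v)))"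

lemmas csC = closed_csubspaceD(1)[OF C]
lemmas f_linear = clinear_on_ops[OF f, simplified]

lemma csAB: "csubspace (A \<times> B)"
  using csubspace_closed_ops(1,2,4)[OF A] csubspace_closed_ops(1,2,4)[OF B]
  by (intro csubspaceI) (auto simp: zero_prod_def scaleC_prod_def)

lemmas K_linear = clinear_on_ops[OF K csAB]

lemma feedback_ex:
  assumes a: "a \<in> A"
  shows "\<exists>!v. v \<in> C \<and> v = snd (K (a, f v))"
proof -
  note z = csubspace_closed_ops(1)[OF A] csubspace_closed_ops(1)[OF B]
  have p: "(0, f v) \<in> A \<times> B" if "v \<in> C" for v using z fB[OF that] by simp
  have "\<exists>!v. v \<in> C \<and> v = snd (K (a, 0)) + snd (K (0, f v))"
  proof (rule affine_fixed_point[OF C _ _ c])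
    show "clinear_on C (\<lambda>v. snd (K (0, f v)))"
    proof (rule clinear_onI)
      show "snd (K (0, f (u + v))) = snd (K (0, f u)) + snd (K (0, f v))" if "u \<in> C" "v \<in> C" for u v
        using K_linear(2)[OF p[OF that(1)] p[OF that(2)]] by (simp add: f_linear)
      show "snd (K (0, f (t *\<^sub>C v))) = t *\<^sub>C snd (K (0, f v))" if "v \<in> C" for t v
        using K_linear(4)[OF p[OF that], of t] by (simp add: f_linear scaleC_prod_def)
    qed
    show "snd (K (0, f v)) \<in> C" if "v \<in> C" for v by (rule KC[OF p[OF that]])
    show "norm (snd (K (0, f v))) \<le> c * norm v" if "v \<in> C" for v
      using norm_snd_component[of "K (0, f v)"] norm_K[OF p[OF that]] norm_f[of v]
      by (simp add: norm_Pair)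
    show "snd (K (a, 0)) \<in> C" using a z by (intro KC) simp
  qed
  moreover have "snd (K (a, f v)) = snd (K (a, 0)) + snd (K (0, f v))" if "v \<in> C" for v
    using K_linear(2)[of "(a, 0)" "(0, f v)"] p[OF that] a z by simp
  ultimately show ?thesis by (metis (no_types, lifting))
qed

lemma feedback:
  assumes a: "a \<in> A"
  shows feedback_in: "feedback a \<in> C" and feedback_eq: "snd (K (a, f (feedback a))) = feedback a"
    and feedback_unique: "v \<in> C \<Longrightarrow> v = snd (K (a, f v)) \<Longrightarrow> feedback a = v"
proof -
  have *: "feedback a \<in> C \<and> feedback a = snd (K (a, f (feedback a)))"
    unfolding feedback_def by (rule theI'[OF feedback_ex[OF a]])
  then show "feedback a \<in> C" "snd (K (a, f (feedback a))) = feedback a" by auto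
  show "v \<in> C \<Longrightarrow> v = snd (K (a, f v)) \<Longrightarrow> feedback a = v"
    using feedback_ex[OF a] * by blast
qed

lemma norm_feedback:
  assumes a: "a \<in> A"
  shows "norm (feedback a) \<le> norm a / (1 - c)"
proof (rule norm_le_geometric[OF _ c(2)])
  have "norm (feedback a) \<le> norm (K (a, f (feedback a)))"
    using norm_snd_component[of "K (a, f (feedback a))"] by (simp add: feedback_eq[OF a])
  also have "\<dots> \<le> norm a + norm (f (feedback a))"
    using norm_K a fB[OF feedback_in[OF a]] by (simp add: norm_Pair_le)
  finally show "norm (feedback a) \<le> norm a + c * norm (feedback a)"
    using norm_f[of "feedback a"] by linarith
qed

lemma clinear_on_feedback: "clinear_on A feedback"
proof (rule clinear_onI)
  note A' = csubspace_closed_ops[OF A] and C' = csubspace_closed_ops[OF csC]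
  have p: "(a, f (feedback a)) \<in> A \<times> B" if "a \<in> A" for a using that fB[OF feedback_in[OF that]] by simp
  show "feedback (x + y) = feedback x + feedback y" if xy: "x \<in> A" "y \<in> A" for x y
  proof (rule feedback_unique[OF A'(2)[OF xy] C'(2)[OF feedback_in feedback_in, OF xy]])
    show "feedback x + feedback y = snd (K (x + y, f (feedback x + feedback y)))"
      using K_linear(2)[OF p[OF xy(1)] p[OF xy(2)]] feedback_eq[OF xy(1)] feedback_eq[OF xy(2)]
      by (simp add: f_linear)
  qed
  show "feedback (t *\<^sub>C x) = t *\<^sub>C feedback x" if x: "x \<in> A" for t x
  proof (rule feedback_unique[OF A'(4)[OF x] C'(4)[OF feedback_in[OF x]]])
    show "t *\<^sub>C feedback x = snd (K (t *\<^sub>C x, f (t *\<^sub>C feedback x)))"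
      using K_linear(4)[OF p[OF x], of t] feedback_eq[OF x] by (simp add: f_linear scaleC_prod_def)
  qed
qed

end

locale colligation =
  fixes DS :: "'s::chilbert_space set" and DT :: "'t::chilbert_space set" and R :: "'r::chilbert_space set"
    and U :: "'s \<times> ('r ^ 'n::finite) \<Rightarrow> 't \<times> 'r"
  assumes DS: "closed_csubspace DS" and DT: "closed_csubspace DT" and R: "closed_csubspace R"
    and U: "unitary_op (DS \<times> power_space R) (DT \<times> R) U"
begin

abbreviation "P \<equiv> power_space R :: ('r ^ 'n) set"

lemma P: "closed_csubspace P" by (rule closed_csubspace_power_space[OF R])

lemmas csDS = closed_csubspaceD(1)[OF DS]
lemmas csDT = closed_csubspaceD(1)[OF DT]
lemmas csR = closed_csubspaceD(1)[OF R]
lemmas csP = closed_csubspaceD(1)[OF P]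
lemmas zDS = csubspace_closed_ops(1)[OF csDS]
lemmas zDT = csubspace_closed_ops(1)[OF csDT]
lemmas zR = csubspace_closed_ops(1)[OF csR]
lemmas zP = csubspace_closed_ops(1)[OF csP]

text \<open>The inverse of a unitary is its adjoint, so \<open>W\<close> is
  \<open>U\<^sup>*\<close>.\<close>

definition W :: "'t \<times> 'r \<Rightarrow> 's \<times> ('r ^ 'n)" where "W = inv_into (DS \<times> P) U"

lemmas csV = closed_csubspaceD(1)[OF closed_csubspace_Times[OF DS P]]
lemmas csW = closed_csubspaceD(1)[OF closed_csubspace_Times[OF DT R]]
lemmas W_props = unitary_op_inv[OF U csV csW, folded W_def]

lemma U_lin: "clinear_on (DS \<times> P) U" and W_lin: "clinear_on (DT \<times> R) W"
  using U W_props(1) by (auto simp: unitary_op_def)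

lemma W_add:
  assumes "a \<in> DT" "b \<in> DT" "u \<in> R" "v \<in> R"
  shows "W (a + b, u + v) = W (a, u) + W (b, v)"
  using clinear_on_ops(2)[OF W_lin csW, of "(a, u)" "(b, v)"] assms by simp

lemma W_diff:
  assumes "a \<in> DT" "b \<in> DT" "u \<in> R" "v \<in> R"
  shows "W (a - b, u - v) = W (a, u) - W (b, v)"
  using clinear_on_ops(3)[OF W_lin csW, of "(a, u)" "(b, v)"] assms by simp

lemma U_in: "a \<in> DS \<Longrightarrow> u \<in> P \<Longrightarrow> fst (U (a, u)) \<in> DT \<and> snd (U (a, u)) \<in> R"
proof -
  assume "a \<in> DS" "u \<in> P"
  then have "U (a, u) \<in> DT \<times> R" using U unfolding unitary_op_def bij_betw_def by blast
  then show ?thesis by (auto simp: mem_Times_iff)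
qed

lemma W_in: "a \<in> DT \<Longrightarrow> u \<in> R \<Longrightarrow> fst (W (a, u)) \<in> DS \<and> snd (W (a, u)) \<in> P"
proof -
  assume "a \<in> DT" "u \<in> R"
  then have "W (a, u) \<in> DS \<times> P" using W_props(1) unfolding unitary_op_def bij_betw_def by blast
  then show ?thesis by (auto simp: mem_Times_iff)
qed

lemma cinner_U: "a \<in> DS \<Longrightarrow> u \<in> P \<Longrightarrow> b \<in> DS \<Longrightarrow> v \<in> P \<Longrightarrow>
    cinner (U (a, u)) (U (b, v)) = cinner a b + cinner u v"
  using U unfolding unitary_op_def by (auto simp: cinner_prod_def)

lemma norm_W: "a \<in> DT \<Longrightarrow> u \<in> R \<Longrightarrow> norm (W (a, u)) = norm (a, u)"
  using W_props(1) unfolding unitary_op_def by (intro norm_eq_if_cinner_eq) auto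

lemma norm_U: "a \<in> DS \<Longrightarrow> u \<in> P \<Longrightarrow> norm (U (a, u)) = norm (a, u)"
  using U unfolding unitary_op_def by (intro norm_eq_if_cinner_eq) auto

lemma state_loop: "z \<in> unit_ball \<Longrightarrow> feedback_loop DT R P W (row_op z) (norm z)"
  using W_in by unfold_locales
    (auto simp: csDT csR P W_lin norm_W row_in[OF csR] norm_row clinear_onI row_linear)

lemma residue_loop: "z \<in> unit_ball \<Longrightarrow> feedback_loop DS P R U (col_op z) (norm z)"
  using U_in by unfold_locales
    (auto simp: csDS csP R U_lin norm_U col_in[OF csR] norm_col clinear_onI col_linear)

text \<open>\<open>U\<^sup>* (y, Z v) = (out z y, v)\<close> for \<open>v = state z y\<close>, and \<open>U (a, Z\<^sup>* r) = (dual z a, r)\<close> for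
  \<open>r = res z a\<close>. So \<open>out z\<close> is the value of the transfer function of \<open>U\<^sup>*\<close> and \<open>dual z\<close> is its adjoint.\<close>

definition state :: "complex ^ 'n \<Rightarrow> 't \<Rightarrow> 'r ^ 'n"
  where "state z = feedback_loop.feedback P W (row_op z)"

definition out :: "complex ^ 'n \<Rightarrow> 't \<Rightarrow> 's"
  where "out z y = fst (W (y, row_op z (state z y)))"

lemma state:
  assumes z: "z \<in> unit_ball" and y: "y \<in> DT"
  shows state_in: "state z y \<in> P" and state_eq: "snd (W (y, row_op z (state z y))) = state z y"
    and state_unique: "v \<in> P \<Longrightarrow> v = snd (W (y, row_op z v)) \<Longrightarrow> state z y = v"
    and out_in: "out z y \<in> DS"
    and W_state: "W (y, row_op z (state z y)) = (out z y, state z y)"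
proof -
  note fb = feedback_loop.feedback[OF state_loop[OF z] y, folded state_def]
  show 1: "state z y \<in> P" "snd (W (y, row_op z (state z y))) = state z y" by (rule fb(1), rule fb(2))
  show "v \<in> P \<Longrightarrow> v = snd (W (y, row_op z v)) \<Longrightarrow> state z y = v" by (rule fb(3))
  show "out z y \<in> DS" unfolding out_def using W_in[OF y row_in[OF csR 1(1)]] by blast
  show "W (y, row_op z (state z y)) = (out z y, state z y)"
    using 1(2) by (simp add: out_def prod_eq_iff)
qed

lemma norm_state: "z \<in> unit_ball \<Longrightarrow> y \<in> DT \<Longrightarrow> norm (state z y) \<le> norm y / (1 - norm z)"
  unfolding state_def by (rule feedback_loop.norm_feedback[OF state_loop])

lemma clinear_on_state: "z \<in> unit_ball \<Longrightarrow> clinear_on DT (state z)"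
  unfolding state_def by (rule feedback_loop.clinear_on_feedback[OF state_loop])

definition res :: "complex ^ 'n \<Rightarrow> 's \<Rightarrow> 'r"
  where "res z = feedback_loop.feedback R U (col_op z)"

definition dual :: "complex ^ 'n \<Rightarrow> 's \<Rightarrow> 't"
  where "dual z a = fst (U (a, col_op z (res z a)))"

lemma res:
  assumes z: "z \<in> unit_ball" and a: "a \<in> DS"
  shows res_in: "res z a \<in> R" and dual_in: "dual z a \<in> DT"
    and U_res: "U (a, col_op z (res z a)) = (dual z a, res z a)"
proof -
  note fb = feedback_loop.feedback[OF residue_loop[OF z] a, folded res_def]
  show 1: "res z a \<in> R" by (rule fb(1))
  show "dual z a \<in> DT" unfolding dual_def using U_in[OF a col_in[OF csR 1]] by blast
  show "U (a, col_op z (res z a)) = (dual z a, res z a)"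
    using fb(2) by (simp add: dual_def prod_eq_iff)
qed

lemma norm_res: "z \<in> unit_ball \<Longrightarrow> a \<in> DS \<Longrightarrow> norm (res z a) \<le> norm a / (1 - norm z)"
  unfolding res_def by (rule feedback_loop.norm_feedback[OF residue_loop])

lemma clinear_on_res: "z \<in> unit_ball \<Longrightarrow> clinear_on DS (res z)"
  unfolding res_def by (rule feedback_loop.clinear_on_feedback[OF residue_loop])

text \<open>Unitarity of \<open>U\<close>, tested on a state at \<open>z\<close> and a residue at
  another point \<open>w\<close>. The diagonal case makes \<open>dual z\<close> the adjoint of
  \<open>out z\<close>; off the diagonal the extra term is the increment of \<open>out\<close>, from
  which derivative and remainder are read.\<close>

lemma cinner_out:
  assumes z: "z \<in> unit_ball" and w: "w \<in> unit_ball" and y: "y \<in> DT" and a: "a \<in> DS"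
  shows "cinner (out z y) a = cinner y (dual w a) + cinner (row_op (z - w) (state z y)) (res w a)"
proof -
  have "(a, col_op w (res w a)) \<in> DS \<times> P" "(y, row_op z (state z y)) \<in> DT \<times> R"
    using a y col_in[OF csR res_in[OF w a]] row_in[OF csR state_in[OF z y]] by auto
  from W_props(5)[OF this]
  have "cinner (out z y) a + cinner (row_op w (state z y)) (res w a) =
      cinner y (dual w a) + cinner (row_op z (state z y)) (res w a)"
    by (simp add: W_state[OF z y] U_res[OF w a] cinner_prod_def cinner_row)
  then show ?thesis by (simp add: row_linear cinner.diff_left algebra_simps)
qed

lemma cinner_out_dual:
  "z \<in> unit_ball \<Longrightarrow> y \<in> DT \<Longrightarrow> a \<in> DS \<Longrightarrow> cinner (out z y) a = cinner y (dual z a)"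
  using cinner_out[of z z y a] by (simp add: row_op_def)

text \<open>\<open>U\<close> preserves the inner product of the vectors in \<open>U_res\<close>, and
  \<open>cinner_col\<close> turns that of their column parts into \<open>cinner z w\<close> times
  the inner product of the residues.\<close>

lemma dual_gram:
  assumes w: "w \<in> unit_ball" and z: "z \<in> unit_ball" and a: "a \<in> DS" and b: "b \<in> DS"
  shows "cinner a b = cinner (dual w a) (dual z b) + (1 - cinner z w) * cinner (res w a) (res z b)"
  using cinner_U[OF a col_in[OF csR res_in[OF w a]] b col_in[OF csR res_in[OF z b]], of w z]
  by (simp add: U_res[OF w a] U_res[OF z b] cinner_prod_def cinner_col algebra_simps)

lemma norm_dual:
  assumes z: "z \<in> unit_ball" and a: "a \<in> DS"
  shows "norm (dual z a) \<le> norm a"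
proof -
  have "complex_of_real ((norm a)\<^sup>2) =
      complex_of_real ((norm (dual z a))\<^sup>2 + (1 - (norm z)\<^sup>2) * (norm (res z a))\<^sup>2)"
    using dual_gram[OF z z a a] by (simp add: cinner_self)
  then have "(norm a)\<^sup>2 = (norm (dual z a))\<^sup>2 + (1 - (norm z)\<^sup>2) * (norm (res z a))\<^sup>2"
    by (simp only: of_real_eq_iff)
  moreover have "0 \<le> (1 - (norm z)\<^sup>2) * (norm (res z a))\<^sup>2"
    using z by (intro mult_nonneg_nonneg) (auto simp: abs_square_le_1 less_imp_le)
  ultimately have "(norm (dual z a))\<^sup>2 \<le> (norm a)\<^sup>2" by linarith
  then show ?thesis by (rule power2_le_imp_le) simp
qed

lemma norm_out:
  assumes z: "z \<in> unit_ball" and y: "y \<in> DT"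
  shows "norm (out z y) \<le> norm y"
proof (cases "out z y = 0")
  case False
  have o: "out z y \<in> DS" by (rule out_in[OF z y])
  have "(norm (out z y))\<^sup>2 = inner y (dual z (out z y))"
    using cinner_out_dual[OF z y o] by (metis Re_cinner power2_norm_eq_inner)
  also have "\<dots> \<le> norm y * norm (dual z (out z y))" by (rule norm_cauchy_schwarz)
  also have "\<dots> \<le> norm y * norm (out z y)" by (intro mult_left_mono norm_dual[OF z o]) simp
  finally show ?thesis using False by (simp add: power2_eq_square)
qed simp

lemma clinear_on_out:
  assumes z: "z \<in> unit_ball"
  shows "clinear_on DT (out z)"
proof (rule clinear_onI)
  note DT' = csubspace_closed_ops[OF csDT] and DS' = csubspace_closed_ops[OF csDS]
  have *: "cinner v (out z y) = cinner (dual z v) y" if "y \<in> DT" "v \<in> DS" for v y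
    using cinner_out_dual[OF z that] by (metis cinner_commute)
  show "out z (x + y) = out z x + out z y" if "x \<in> DT" "y \<in> DT" for x y
    using that by (intro cinner_ext_on[OF csDS] DS'(2) out_in[OF z] DT'(2))
      (simp_all add: * DT'(2) cinner_add_right)
  show "out z (c *\<^sub>C y) = c *\<^sub>C out z y" if "y \<in> DT" for c y
    using that by (intro cinner_ext_on[OF csDS] DS'(4) out_in[OF z] DT'(4))
      (simp_all add: * DT'(4) cinner_scaleC_right)
qed

section \<open>Complex differentiability of the transfer function\<close>

lemma norm_state_diff:
  assumes z: "z \<in> unit_ball" and w: "w \<in> unit_ball" and y: "y \<in> DT"
  shows "norm (state z y - state w y) \<le> norm (z - w) * norm (state z y) / (1 - norm w)"
proof (rule norm_le_geometric)
  let ?r = "row_op (z - w) (state z y) + row_op w (state z y - state w y)"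
  \<comment> \<open>Resolvent identity: the increment splits into a change of the point and a change
    of the state, and the latter is absorbed thanks to \<open>norm w < 1\<close>.\<close>
  have r: "row_op z (state z y) - row_op w (state w y) = ?r" by (simp add: row_linear)
  have ri: "row_op z (state z y) \<in> R" "row_op w (state w y) \<in> R"
    using row_in[OF csR] state_in[OF z y] state_in[OF w y] by blast+
  have rR: "?r \<in> R" unfolding r[symmetric] by (rule csubspace_closed_ops(3)[OF csR ri])
  have "state z y - state w y = snd (W (y - y, row_op z (state z y) - row_op w (state w y)))"
    using W_diff[OF y y ri] by (simp add: state_eq[OF z y] state_eq[OF w y])
  also have "\<dots> = snd (W (0, ?r))" by (simp only: r diff_self)
  finally have "norm (state z y - state w y) \<le> norm (W (0, ?r))"
    using norm_snd_component[of "W (0, ?r)"] by metis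
  also have "\<dots> = norm ?r" by (simp add: norm_W[OF zDT rR] norm_Pair)
  also have "\<dots> \<le> norm (row_op (z - w) (state z y)) + norm (row_op w (state z y - state w y))"
    by (rule norm_triangle_ineq)
  finally show "norm (state z y - state w y) \<le>
      norm (z - w) * norm (state z y) + norm w * norm (state z y - state w y)"
    using norm_row[of "z - w" "state z y"] norm_row[of w "state z y - state w y"] by linarith
qed (use w in auto)

text \<open>The candidate derivative at \<open>w\<close> in direction \<open>h\<close>: the extra
  term of \<open>cinner_out\<close> with the state frozen at \<open>w\<close>, written as a vector
  by means of the adjoint of \<open>res w\<close>.\<close>

definition deriv_out :: "complex ^ 'n \<Rightarrow> complex ^ 'n \<Rightarrow> 't \<Rightarrow> 's"
  where "deriv_out w h y = adj DS (res w) (row_op h (state w y))"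

context
  fixes w :: "complex ^ 'n"
  assumes w: "w \<in> unit_ball"
begin

lemma res_bound: "a \<in> DS \<Longrightarrow> norm (res w a) \<le> 1 / (1 - norm w) * norm a"
  using norm_res[OF w] by simp

lemmas adj_res = adj_in[OF DS clinear_on_res[OF w] res_bound]
  cinner_adj_left[OF DS clinear_on_res[OF w] res_bound]
  clinear_adj[OF DS clinear_on_res[OF w] res_bound, of UNIV]

lemma deriv_out_in: "deriv_out w h y \<in> DS"
  unfolding deriv_out_def by (rule adj_res(1))

lemma deriv_out_linear:
  "x \<in> DT \<Longrightarrow> y \<in> DT \<Longrightarrow> deriv_out w h (x + y) = deriv_out w h x + deriv_out w h y"
  "y \<in> DT \<Longrightarrow> deriv_out w h (c *\<^sub>C y) = c *\<^sub>C deriv_out w h y"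
  "deriv_out w (h + h') y = deriv_out w h y + deriv_out w h' y"
  "deriv_out w (c *\<^sub>C h) y = c *\<^sub>C deriv_out w h y"
  using clinear_on_ops[OF adj_res(3)]
  clinear_on_ops[OF clinear_on_state[OF w] csDT]
  by (simp_all add: deriv_out_def row_linear)

lemma norm_deriv_out:
  assumes y: "y \<in> DT"
  shows "norm (deriv_out w h y) \<le> norm h * norm y / (1 - norm w)\<^sup>2"
proof -
  have w1: "norm w < 1" using w by simp
  have "norm (deriv_out w h y) \<le> 1 / (1 - norm w) * norm (row_op h (state w y))"
    unfolding deriv_out_def
    using w1 by (intro norm_adj_le[OF DS clinear_on_res[OF w] res_bound]) auto
  also have "\<dots> \<le> 1 / (1 - norm w) * (norm h * (norm y / (1 - norm w)))"
    using w1 norm_row[of h "state w y"] mult_left_mono[OF norm_state[OF w y], of "norm h"]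
    by (intro mult_left_mono) auto
  finally show ?thesis by (simp add: power2_eq_square)
qed

text \<open>Against a vector of \<open>DS\<close> the remainder is the extra term of
  \<open>cinner_out\<close> taken at the increment of the state. That increment is itself of order
  |z - w|, so the remainder is quadratic. The test vector is the remainder \<open>d\<close>.\<close>

lemma norm_out_remainder:
  assumes z: "z \<in> unit_ball" and y: "y \<in> DT"
  shows "norm (out z y - out w y - deriv_out w (z - w) y) \<le>
    (norm (z - w))\<^sup>2 * norm y / ((1 - norm w)\<^sup>2 * (1 - norm z))"
proof -
  define d where "d = out z y - out w y - deriv_out w (z - w) y"
  have w1: "norm w < 1" "norm z < 1" using w z by auto
  have d: "d \<in> DS"
    unfolding d_def by (intro csubspace_closed_ops(3)[OF csDS] out_in[OF z y] out_in[OF w y] deriv_out_in)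
  have "cinner d d = cinner (out z y) d - cinner (out w y) d - cinner (deriv_out w (z - w) y) d"
    by (subst d_def) (simp add: cinner.diff_left)
  also have "\<dots> = cinner (row_op (z - w) (state z y - state w y)) (res w d)"
    unfolding deriv_out_def adj_res(2)[OF _ d] cinner_out[OF z w y d] cinner_out_dual[OF w y d]
    by (simp add: adj_res(2) d row_linear(2) cinner.diff_left)
  finally have "(norm d)\<^sup>2 = inner (row_op (z - w) (state z y - state w y)) (res w d)"
    by (metis Re_cinner power2_norm_eq_inner)
  also have "\<dots> \<le> norm (row_op (z - w) (state z y - state w y)) * norm (res w d)"
    by (rule norm_cauchy_schwarz)
  also have "\<dots> \<le> (norm (z - w) * (norm (z - w) * (norm y / (1 - norm z)) / (1 - norm w))) *
      (norm d / (1 - norm w))"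
  proof (intro mult_mono norm_res[OF w d])
    have "norm (state z y - state w y) \<le> norm (z - w) * norm (state z y) / (1 - norm w)"
      by (rule norm_state_diff[OF z w y])
    also have "\<dots> \<le> norm (z - w) * (norm y / (1 - norm z)) / (1 - norm w)"
      using w1 by (intro divide_right_mono mult_left_mono norm_state[OF z y]) auto
    finally show "norm (row_op (z - w) (state z y - state w y)) \<le>
        norm (z - w) * (norm (z - w) * (norm y / (1 - norm z)) / (1 - norm w))"
      by (rule order_trans[OF norm_row mult_left_mono]) simp
  qed (use w1 in auto)
  also have "\<dots> = (norm (z - w))\<^sup>2 * norm y / ((1 - norm w)\<^sup>2 * (1 - norm z)) * norm d"
    using w1 by (simp add: field_simps power2_eq_square)
  finally have *: "norm d * norm d \<le> (norm (z - w))\<^sup>2 * norm y / ((1 - norm w)\<^sup>2 * (1 - norm z)) * norm d"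
    by (simp add: power2_eq_square)
  show ?thesis
  proof (cases "d = 0")
    case True
    then show ?thesis using w1 by (simp add: d_def[symmetric])
  next
    case False
    then have "norm d \<le> (norm (z - w))\<^sup>2 * norm y / ((1 - norm w)\<^sup>2 * (1 - norm z))"
      using mult_right_le_imp_le[OF *] by simp
    then show ?thesis by (simp only: d_def)
  qed
qed

end

text \<open>The defining formula solves q = Z B^* y + Z D^* q, while \<open>state\<close> solves v =
  B^* y + D^* Z v. The two are linked by q = Z v.\<close>

lemma transfer_adj_eq_out:
  assumes z: "z \<in> unit_ball" and y: "y \<in> DT"
  shows "transfer_adj DS R U z y = out z y"
proof -
  have A: "adj DS (\<lambda>x. fst (U (x, 0))) t = fst (W (t, 0))" if "t \<in> DT" for t
    using W_in[OF that zR] W_props(4)[of "(_, 0)" "(t, 0)"] that zP zR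
    by (intro adj_eqI[OF csDS]) (auto simp: cinner_prod_def)
  have B: "adj P (\<lambda>v. fst (U (0, v))) t = snd (W (t, 0))" if "t \<in> DT" for t
    using W_in[OF that zR] W_props(4)[of "(0, _)" "(t, 0)"] that zDS zR
    by (intro adj_eqI[OF csP]) (auto simp: cinner_prod_def)
  have C: "adj DS (\<lambda>x. snd (U (x, 0))) r = fst (W (0, r))" if "r \<in> R" for r
    using W_in[OF zDT that] W_props(4)[of "(_, 0)" "(0, r)"] that zP zDT
    by (intro adj_eqI[OF csDS]) (auto simp: cinner_prod_def)
  have D: "adj P (\<lambda>v. snd (U (0, v))) r = snd (W (0, r))" if "r \<in> R" for r
    using W_in[OF zDT that] W_props(4)[of "(0, _)" "(0, r)"] that zDS zDT
    by (intro adj_eqI[OF csP]) (auto simp: cinner_prod_def)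
  define f where "f = (\<lambda>r. r - row_op z (adj P (\<lambda>v. snd (U (0, v))) r))"
  define b where "b = row_op z (adj P (\<lambda>v. fst (U (0, v))) y)"
  define q where "q = inv_into R f b"
  have sR: "row_op z (state z y) \<in> R" by (rule row_in[OF csR state_in[OF z y]])
  have split: "W (y, r) = W (y, 0) + W (0, r)" if "r \<in> R" for r
    using W_add[OF y zDT zR that] by simp
  \<comment> \<open>\<open>inv_into\<close> is meaningful once \<open>b\<close> is a value of
    \<open>f\<close>. Any preimage \<open>q\<close> will do, since it yields a solution of the state
    equation and \<open>state_unique\<close> applies.\<close>
  have "f (row_op z (state z y)) = b"
    using state_eq[OF z y] split[OF sR] unfolding f_def b_def D[OF sR] B[OF y]
    by (metis add_diff_cancel_right' row_linear(2) snd_add)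
  then have "b \<in> f ` R" using sR by blast
  then have q: "q \<in> R" "f q = b"
    unfolding q_def by (rule inv_into_into, rule f_inv_into_f)
  have "row_op z (snd (W (y, q))) = q"
  proof -
    have "row_op z (snd (W (y, q))) = b + row_op z (snd (W (0, q)))"
      by (simp add: split[OF q(1)] row_linear b_def B[OF y])
    also have "\<dots> = q" using q(2) by (simp add: f_def D[OF q(1)] algebra_simps)
    finally show ?thesis .
  qed
  moreover from this have "state z y = snd (W (y, q))"
    using W_in[OF y q(1)] by (intro state_unique[OF z y]) auto
  ultimately have "out z y = fst (W (y, 0)) + fst (W (0, q))"
    using split[OF q(1)] by (simp add: out_def)
  also have "\<dots> = transfer_adj DS R U z y"
    unfolding transfer_adj_def Let_def A[OF y] q_def[unfolded f_def b_def, unfolded row_op_def, symmetric]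
    by (simp add: C[OF q(1)])
  finally show ?thesis by simp
qed

end

section \<open>The multiplier of a colligation\<close>

lemma cinner_preserving_if_norm_preserving:
  assumes V: "csubspace V" and F: "clinear_on V F" and n: "\<And>x. x \<in> V \<Longrightarrow> norm (F x) = norm x"
    and xy: "x \<in> V" "y \<in> V"
  shows "cinner (F x) (F y) = cinner x y"
proof -
  note V' = csubspace_closed_ops[OF V] and F' = clinear_on_ops[OF F V]
  have inner: "inner (F u) (F v) = inner u v" if "u \<in> V" "v \<in> V" for u v
  proof -
    have "(norm (F u + F v))\<^sup>2 = (norm (u + v))\<^sup>2"
      using n[OF V'(2)[OF that]] F'(2)[OF that] by simp
    moreover have "(norm (F u))\<^sup>2 = (norm u)\<^sup>2" "(norm (F v))\<^sup>2 = (norm v)\<^sup>2"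
      using n that by auto
    ultimately show ?thesis
      by (simp add: power2_norm_eq_inner inner_add_left inner_add_right inner_commute)
  qed
  show ?thesis
    using inner[OF xy] inner[OF xy(1) V'(4)[OF xy(2), of \<i>]] F'(4)[OF xy(2), of \<i>]
    by (simp add: complex_eq_iff Re_cinner Im_cinner)
qed

lemma bounded_linear_if_clinear:
  assumes "clinear_on UNIV F" "\<And>x. norm (F x) \<le> K * norm x"
  shows "bounded_linear F"
  using clinear_on_ops(2,5)[OF assms(1)] assms(2)
  by (intro bounded_linear_intro[of F K]) (simp_all add: mult.commute)

locale transfer_multiplier =
  colligation DS DT R U + E1: drury_arveson_space ev1 + E2: drury_arveson_space ev2
  for DS :: "'s::chilbert_space set" and DT :: "'t::chilbert_space set" and R :: "'r::chilbert_space set"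
    and U :: "'s \<times> ('r ^ 'n::finite) \<Rightarrow> 't \<times> 'r"
    and ev1 :: "'h1::chilbert_space \<Rightarrow> complex ^ 'n \<Rightarrow> 'e1::chilbert_space"
    and ev2 :: "'h2::chilbert_space \<Rightarrow> complex ^ 'n \<Rightarrow> 'e2::chilbert_space" +
  fixes V1 :: "'t \<Rightarrow> 'e1" and V2 :: "'s \<Rightarrow> 'e2"
  assumes V1: "clinear_on DT V1" "\<And>x. x \<in> DT \<Longrightarrow> norm (V1 x) = norm x"
    and V2: "clinear_on DS V2" "\<And>x. x \<in> DS \<Longrightarrow> norm (V2 x) = norm x"
begin

definition P1 :: "'e1 \<Rightarrow> 't" where "P1 = adj DT V1"
definition P2 :: "'e2 \<Rightarrow> 's" where "P2 = adj DS V2"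

lemma V1_bd: "x \<in> DT \<Longrightarrow> norm (V1 x) \<le> 1 * norm x"
  by (simp add: V1)

lemma V2_bd: "x \<in> DS \<Longrightarrow> norm (V2 x) \<le> 1 * norm x"
  by (simp add: V2)

lemma P1: "P1 e \<in> DT" "x \<in> DT \<Longrightarrow> cinner (P1 e) x = cinner e (V1 x)" "clinear_on UNIV P1"
    "norm (P1 e) \<le> norm e"
  unfolding P1_def
  using adj_in[OF DT V1(1) V1_bd] cinner_adj_left[OF DT V1(1) V1_bd]
    clinear_adj[OF DT V1(1) V1_bd] norm_adj_le[OF DT V1(1) V1_bd] by auto

lemma P2: "P2 e \<in> DS" "x \<in> DS \<Longrightarrow> cinner (P2 e) x = cinner e (V2 x)" "clinear_on UNIV P2"
    "norm (P2 e) \<le> norm e" "x \<in> DS \<Longrightarrow> cinner x (P2 e) = cinner (V2 x) e"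
  unfolding P2_def
  using adj_in[OF DS V2(1) V2_bd] cinner_adj_left[OF DS V2(1) V2_bd] cinner_adj[OF DS V2(1) V2_bd]
    clinear_adj[OF DS V2(1) V2_bd] norm_adj_le[OF DS V2(1) V2_bd] by auto

lemma cinner_V1: "x \<in> DT \<Longrightarrow> y \<in> DT \<Longrightarrow> cinner (V1 x) (V1 y) = cinner x y"
  by (rule cinner_preserving_if_norm_preserving[OF csDT V1])

lemma cinner_V2: "x \<in> DS \<Longrightarrow> y \<in> DS \<Longrightarrow> cinner (V2 x) (V2 y) = cinner x y"
  by (rule cinner_preserving_if_norm_preserving[OF csDS V2])

lemmas P1_linear = clinear_on_ops[OF P1(3), simplified]
lemmas P2_linear = clinear_on_ops[OF P2(3), simplified]
lemmas V1_linear = clinear_on_ops[OF V1(1) csDT]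
lemmas V2_linear = clinear_on_ops[OF V2(1) csDS]

lemma P2_V2: "x \<in> DS \<Longrightarrow> P2 (V2 x) = x"
  unfolding P2_def by (rule adj_eqI[OF csDS]) (simp_all add: cinner_V2)

text \<open>Outside the ball the inner map need not be bounded and \<open>Blinfun\<close> carries no
  information; \<open>\<Phi>\<close> is evaluated on the ball only.\<close>

definition \<Phi> :: "complex ^ 'n \<Rightarrow> 'e1 \<Rightarrow>\<^sub>L 'e2"
  where "\<Phi> z = Blinfun (\<lambda>e. V2 (out z (P1 e)))"

lemma clinear_Phi: "z \<in> unit_ball \<Longrightarrow> clinear_on UNIV (\<lambda>e. V2 (out z (P1 e)))"
  using clinear_on_ops[OF clinear_on_out csDT]
  by (intro clinear_onI) (simp_all add: P1_linear V2_linear out_in P1(1))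

lemma \<Phi>: "z \<in> unit_ball \<Longrightarrow> \<Phi> z e = V2 (out z (P1 e))"
proof -
  assume z: "z \<in> unit_ball"
  have "bounded_linear (\<lambda>e. V2 (out z (P1 e)))"
    by (rule bounded_linear_if_clinear[OF clinear_Phi[OF z], of 1])
      (simp add: V2(2) out_in[OF z] P1(1) order_trans[OF norm_out[OF z P1(1)] P1(4)])
  then show ?thesis by (simp add: \<Phi>_def bounded_linear_Blinfun_apply)
qed

lemma cinner_Phi:
  assumes z: "z \<in> unit_ball"
  shows "cinner (\<Phi> z e) e' = cinner e (V1 (dual z (P2 e')))"
  using out_in[OF z P1(1)] dual_in[OF z P2(1)]
  by (simp add: \<Phi>[OF z] P2(5)[symmetric] cinner_out_dual[OF z P1(1) P2(1)] P1(2))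

lemma holomorphic_Phi: "holomorphic_ball \<Phi>"
  unfolding holomorphic_ball_def
proof (intro ballI)
  fix w :: "complex ^ 'n" assume w: "w \<in> unit_ball"
  \<comment> \<open>Half the distance from \<open>w\<close> to the sphere: then
    \<open>1 - norm z \<ge> \<delta>\<close> throughout the neighbourhood, and the remainder bound
    is uniform there.\<close>
  define \<delta> where "\<delta> = (1 - norm w) / 2"
  have w1: "norm w < 1" and \<delta>: "\<delta> > 0" using w by (auto simp: \<delta>_def)
  note lin = deriv_out_linear[OF w]
  define D where "D h = Blinfun (\<lambda>e. V2 (deriv_out w h (P1 e)))" for h
  have Dc: "clinear_on UNIV (\<lambda>e. V2 (deriv_out w h (P1 e)))" for h
    by (rule clinear_onI) (simp_all add: P1_linear lin V2_linear deriv_out_in[OF w] P1(1))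
  have Dn: "norm (V2 (deriv_out w h (P1 e))) \<le> (norm h / (1 - norm w)\<^sup>2) * norm e" for h e
  proof -
    have "norm (V2 (deriv_out w h (P1 e))) \<le> norm h * norm (P1 e) / (1 - norm w)\<^sup>2"
      by (simp add: V2(2) deriv_out_in[OF w] norm_deriv_out[OF w P1(1)])
    also have "\<dots> \<le> norm h * norm e / (1 - norm w)\<^sup>2"
      by (intro divide_right_mono mult_left_mono P1(4)) auto
    finally show ?thesis by simp
  qed
  have D: "D h e = V2 (deriv_out w h (P1 e))" for h e
    unfolding D_def by (simp add: bounded_linear_Blinfun_apply bounded_linear_if_clinear[OF Dc Dn])
  have Dadd: "D (h + h') = D h + D h'" for h h'
    by (rule blinfun_eqI) (simp add: D lin V2_linear deriv_out_in[OF w] blinfun.add_left)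
  have Dscale: "D (c *\<^sub>C h) = c *\<^sub>C D h" for c h
    by (rule blinfun_eqI) (simp add: D lin V2_linear deriv_out_in[OF w] scaleC_blinfun.rep_eq)
  have Dbl: "bounded_linear D"
  proof (rule bounded_linear_if_clinear[of D "1 / (1 - norm w)\<^sup>2"])
    show "clinear_on UNIV D" by (rule clinear_onI) (simp_all add: Dadd Dscale)
    show "norm (D h) \<le> 1 / (1 - norm w)\<^sup>2 * norm h" for h
      using Dn[of h] by (intro norm_blinfun_bound) (simp_all add: D)
  qed
  have "(\<Phi> has_derivative D) (at w)"
  proof (rule has_derivativeI_quadratic[OF Dbl \<delta>, where C = "1 / ((1 - norm w)\<^sup>2 * \<delta>)"])
    fix z assume zw: "norm (z - w) < \<delta>"
    have nz: "\<delta> \<le> 1 - norm z"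
      using zw norm_triangle_ineq2[of z w] unfolding \<delta>_def by simp
    then have z: "z \<in> unit_ball" using \<delta> by simp
    show "norm (\<Phi> z - \<Phi> w - D (z - w)) \<le> 1 / ((1 - norm w)\<^sup>2 * \<delta>) * (norm (z - w))\<^sup>2"
    proof (rule norm_blinfun_bound)
      fix e
      note i = out_in[OF z P1(1)] out_in[OF w P1(1)] deriv_out_in[OF w]
      have "norm ((\<Phi> z - \<Phi> w - D (z - w)) e) =
          norm (out z (P1 e) - out w (P1 e) - deriv_out w (z - w) (P1 e))"
        using V2_linear(3)[OF i(1,2), of e e] V2_linear(3)[OF csubspace_closed_ops(3)[OF csDS i(1,2)] i(3), of e e]
          V2(2)[OF csubspace_closed_ops(3)[OF csDS csubspace_closed_ops(3)[OF csDS i(1,2)] i(3)], of e e]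
        by (simp add: blinfun.diff_left \<Phi>[OF z] \<Phi>[OF w] D)
      also have "\<dots> \<le> (norm (z - w))\<^sup>2 * norm (P1 e) / ((1 - norm w)\<^sup>2 * (1 - norm z))"
        by (rule norm_out_remainder[OF w z P1(1)])
      also have "\<dots> \<le> (norm (z - w))\<^sup>2 * norm e / ((1 - norm w)\<^sup>2 * \<delta>)"
        using w1 \<delta> nz by (intro frac_le mult_left_mono P1(4)) auto
      finally show "norm ((\<Phi> z - \<Phi> w - D (z - w)) e) \<le> 1 / ((1 - norm w)\<^sup>2 * \<delta>) * (norm (z - w))\<^sup>2 * norm e"
        by simp
    qed (use \<delta> in auto)
  qed
  then show "\<exists>f'. (\<Phi> has_derivative f') (at w) \<and> (\<forall>c v. f' (c *\<^sub>C v) = c *\<^sub>C f' v)"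
    using Dscale by blast
qed

text \<open>The lurking isometry: splitting \<open>e\<close> along the range of \<open>V2\<close> turns the kernel into the sum of
  the kernel twisted by \<open>\<Phi>\<close>, the kernel of the orthogonal part and the residual part.\<close>

lemma multiplier_model:
  obtains G :: "'h2 \<Rightarrow> 'h1" and \<Gamma> :: "'h2 \<Rightarrow> 'r"
  where "clinear_on UNIV G" "\<And>k. norm (G k) \<le> norm k"
    and "clinear_on UNIV \<Gamma>" "\<And>k. norm (\<Gamma> k) \<le> norm k" "\<And>k. \<Gamma> k \<in> R"
    and "\<And>f. \<exists>g. (\<forall>z\<in>unit_ball. ev2 g z = \<Phi> z (ev1 f z)) \<and> norm g \<le> norm f"
    and "\<And>k. adj UNIV (mult_op ev1 ev2 (\<lambda>z. blinfun_apply (\<Phi> z))) k = G k"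
    and "\<And>i k. E1.bwd i (G k) = G (E2.bwd i k)"
    and "\<And>k. ev1 (G k) 0 = V1 (fst (U (P2 (ev2 k 0), \<chi> i. \<Gamma> (E2.bwd i k))))"
    and "\<And>k. \<Gamma> k = snd (U (P2 (ev2 k 0), \<chi> i. \<Gamma> (E2.bwd i k)))"
proof -
  define D where "D w e = V1 (dual w (P2 e))" for w e
  define g where "g w e = (E1.kern w (D w e), (E2.kern w (e - V2 (P2 e)), res w (P2 e)))" for w e
  have gram: "cinner (g w e) (g z e') = inverse (1 - cinner z w) * cinner e e'"
    if w: "w \<in> unit_ball" and z: "z \<in> unit_ball" for w z e e'
  proof -
    \<comment> \<open>\<open>V2 \<circ> P2\<close> is the orthogonal projection onto the embedded
      defect space, so this is the Gram form of the components orthogonal to it.\<close>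
    have a: "cinner (e - V2 (P2 e)) (e' - V2 (P2 e')) = cinner e e' - cinner (P2 e) (P2 e')"
      by (simp add: cinner.diff_left cinner.diff_right P2_V2[OF P2(1)] P2_linear
          P2(2)[OF P2(1), symmetric] P2(5)[OF P2(1), symmetric])
    have b: "cinner (P2 e) (P2 e') = cinner (D w e) (D z e') +
        (1 - cinner z w) * cinner (res w (P2 e)) (res z (P2 e'))"
      unfolding D_def cinner_V1[OF dual_in[OF w P2(1)] dual_in[OF z P2(1)]]
      by (rule dual_gram[OF w z P2(1) P2(1)])
    have nz: "1 - cinner z w \<noteq> 0" using cmod_cinner_less[OF z w] by simp
    have "cinner (g w e) (g z e') = inverse (1 - cinner z w) * cinner (D w e) (D z e') +
        (inverse (1 - cinner z w) * (cinner e e' - cinner (P2 e) (P2 e')) +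
          cinner (res w (P2 e)) (res z (P2 e')))"
      by (simp only: g_def cinner_prod_def fst_conv snd_conv E1.cinner_kern_kern[OF w z]
          E2.cinner_kern_kern[OF w z] a)
    also have "\<dots> = inverse (1 - cinner z w) * cinner e e'"
    proof -
      have "inverse c * d + (inverse c * (x - (d + c * r)) + r) = inverse c * x"
        if "c \<noteq> 0" for c d x r :: complex
        using that by (simp add: field_simps)
      then show ?thesis unfolding b using nz by blast
    qed
    finally show ?thesis .
  qed
  obtain F where F: "clinear_on UNIV F" "\<And>x y. cinner (F x) (F y) = cinner x y"
    "\<And>w e. w \<in> unit_ball \<Longrightarrow> F (E2.kern w e) = g w e"
    by (rule E2.kernel_isometry[OF gram]) blast+
  note F' = clinear_on_ops[OF F(1), simplified]
  have Fn: "norm (F x) \<le> 1 * norm x" for x using norm_eq_if_cinner_eq[OF F(2)[of x x]] by simp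
  define G where "G k = fst (F k)" for k
  define \<Gamma> where "\<Gamma> k = snd (snd (F k))" for k
  have Glin: "clinear_on UNIV G" and \<Gamma>lin: "clinear_on UNIV \<Gamma>"
    by (rule clinear_onI; simp add: G_def \<Gamma>_def F' scaleC_prod_def)+
  have Gn: "norm (G k) \<le> norm k" for k
    using Fn[of k] norm_fst_le[of "fst (F k)" "snd (F k)"] by (simp add: G_def)
  have \<Gamma>n: "norm (\<Gamma> k) \<le> norm k" for k
    using Fn[of k] norm_snd_component[of "snd (F k)"] norm_snd_component[of "F k"]
    by (simp add: \<Gamma>_def)
  have Gk: "G (E2.kern w e) = E1.kern w (D w e)" and \<Gamma>k: "\<Gamma> (E2.kern w e) = res w (P2 e)"
    if "w \<in> unit_ball" for w e
    by (simp_all only: G_def \<Gamma>_def F(3)[OF that] g_def fst_conv snd_conv)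
  have \<Gamma>R: "\<Gamma> k \<in> R" for k
  proof -
    have "closed_csubspace {k\<in>UNIV. \<Gamma> k \<in> R}"
      by (rule closed_csubspace_preimage[OF closed_csubspace_UNIV \<Gamma>lin _ R, of 1]) (simp add: \<Gamma>n)
    then show ?thesis
      using E2.kernels_induct[of "{k\<in>UNIV. \<Gamma> k \<in> R}" k] \<Gamma>k res_in P2(1) by simp
  qed
  \<comment> \<open>The adjoint of the first component of \<open>F\<close>. Pairing with kernels
    shows that it multiplies by \<open>\<Phi>\<close>, so existence and contractivity of the
    multiplier come together.\<close>
  define M where "M f = adj UNIV F (f, (0, 0))" for f
  note aF = closed_csubspace_UNIV F(1) Fn
  have MG: "cinner (M f) k = cinner f (G k)" for f k
    unfolding M_def cinner_adj_left[OF aF UNIV_I] by (simp add: G_def cinner_prod_def)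
  have evM: "ev2 (M f) z = \<Phi> z (ev1 f z)" if z: "z \<in> unit_ball" for f z
  proof (rule cinner_ext)
    fix e
    have "cinner (ev2 (M f) z) e = cinner f (G (E2.kern z e))"
      by (simp add: E2.cinner_kern[OF z, symmetric] MG)
    also have "\<dots> = cinner (\<Phi> z (ev1 f z)) e"
      by (simp add: Gk[OF z] E1.cinner_kern[OF z] D_def cinner_Phi[OF z])
    finally show "cinner e (ev2 (M f) z) = cinner e (\<Phi> z (ev1 f z))" by (metis cinner_commute)
  qed
  have Mn: "norm (M f) \<le> norm f" for f
    using norm_adj_le[OF aF, of "(f, (0, 0))"] by (simp add: M_def norm_Pair)
  have mo: "mult_op ev1 ev2 (\<lambda>z. blinfun_apply (\<Phi> z)) = M"
    by (rule ext, rule E2.mult_op_eqI) (simp add: evM)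
  have adjM: "adj UNIV (mult_op ev1 ev2 (\<lambda>z. blinfun_apply (\<Phi> z))) k = G k" for k
    unfolding mo by (rule adj_eqI) (simp_all add: MG)
  have comm: "E1.bwd i (G k) = G (E2.bwd i k)" for i k
  proof (rule cinner_ext)
    fix f
    have "M (coord_mult ev1 i f) = coord_mult ev2 i (M f)"
      by (rule E2.ev_inject)
        (simp add: evM E1.ev_coord_mult E2.ev_coord_mult clinear_on_ops(4)[OF clinear_Phi] \<Phi>
          del: mem_ball_0)
    then show "cinner f (E1.bwd i (G k)) = cinner f (G (E2.bwd i k))"
      by (simp add: E1.cinner_bwd MG[symmetric] E2.cinner_bwd)
  qed
  define arg where "arg k = (P2 (ev2 k 0), \<chi> i. \<Gamma> (E2.bwd i k))" for k
  have z0: "(0 :: complex ^ 'n) \<in> unit_ball" by simp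
  note \<Gamma>' = clinear_on_ops[OF \<Gamma>lin, simplified] and G' = clinear_on_ops[OF Glin, simplified]
  have arg_in: "P2 (ev2 k 0) \<in> DS" "(\<chi> i. \<Gamma> (E2.bwd i k)) \<in> P" for k
    by (simp_all add: P2 power_space_def \<Gamma>R)
  have arg_add: "arg (k + l) = arg k + arg l" and arg_scale: "arg (c *\<^sub>C k) = c *\<^sub>C arg k" for k l c
    by (simp_all add: arg_def E2.ev_linear[OF z0] P2_linear E2.bwd_linear \<Gamma>' vec_eq_iff
        scaleC_prod_def scaleC_vec_def)
  have argV: "arg k \<in> DS \<times> P" for k using arg_in[of k] by (simp add: arg_def)
  have Uadd: "U (arg (k + l)) = U (arg k) + U (arg l)" and Uscale: "U (arg (c *\<^sub>C k)) = c *\<^sub>C U (arg k)" for k l c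
    unfolding arg_add arg_scale
    by (rule clinear_on_ops(2)[OF U_lin csV argV argV], rule clinear_on_ops(4)[OF U_lin csV argV])
  have Uin: "fst (U (arg k)) \<in> DT" for k using U_in[OF arg_in] by (simp add: arg_def)
  \<comment> \<open>A crude bound: 1 for the value at 0 and 1 for each backward shift. It only has
    to make the error \<open>E\<close> continuous.\<close>
  define N where "N = 1 + real CARD('n)"
  have Un: "norm (U (arg k)) \<le> N * norm k" for k
  proof -
    have "norm (\<chi> i. \<Gamma> (E2.bwd i k)) \<le> (\<Sum>i\<in>UNIV. norm (\<Gamma> (E2.bwd i k)))"
      unfolding norm_vec_def by (rule order_trans[OF L2_set_le_sum]) simp_all
    also have "\<dots> \<le> (\<Sum>i\<in>(UNIV :: 'n set). norm k)"
      by (intro sum_mono order_trans[OF \<Gamma>n E2.norm_bwd_le])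
    finally have "norm (\<chi> i. \<Gamma> (E2.bwd i k)) \<le> real CARD('n) * norm k" by simp
    moreover have "norm (P2 (ev2 k 0)) \<le> norm k" using P2(4) E2.norm_ev0_le order_trans by blast
    moreover have "norm (U (arg k)) \<le> norm (P2 (ev2 k 0)) + norm (\<chi> i. \<Gamma> (E2.bwd i k))"
      unfolding arg_def norm_U[OF arg_in] by (rule norm_Pair_le)
    ultimately show ?thesis by (simp add: N_def algebra_simps)
  qed
  define E where "E k = (V1 (fst (U (arg k))) - ev1 (G k) 0, snd (U (arg k)) - \<Gamma> k)" for k
  have "clinear_on UNIV E"
    by (rule clinear_onI) (simp_all add: E_def Uadd Uscale V1_linear Uin G' \<Gamma>' E1.ev_linear[OF z0]
        scaleC_prod_def scaleC.diff_right)
  moreover have "norm (E k) \<le> (2 * N + 2) * norm k" for k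
  proof -
    have "norm (E k) \<le> norm (V1 (fst (U (arg k))) - ev1 (G k) 0) + norm (snd (U (arg k)) - \<Gamma> k)"
      unfolding E_def by (rule norm_Pair_le)
    also have "\<dots> \<le> (norm (V1 (fst (U (arg k)))) + norm (ev1 (G k) 0)) + (norm (snd (U (arg k))) + norm (\<Gamma> k))"
      by (intro add_mono norm_triangle_ineq4)
    also have "\<dots> \<le> (N * norm k + norm k) + (N * norm k + norm k)"
    proof (intro add_mono)
      show "norm (V1 (fst (U (arg k)))) \<le> N * norm k"
        unfolding V1(2)[OF Uin] using Un[of k] norm_fst_le[of "fst (U (arg k))" "snd (U (arg k))"] by simp
      show "norm (ev1 (G k) 0) \<le> norm k" by (rule order_trans[OF E1.norm_ev0_le Gn])
      show "norm (snd (U (arg k))) \<le> N * norm k"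
        using Un[of k] norm_snd_component[of "U (arg k)"] by simp
    qed (rule \<Gamma>n)
    finally show ?thesis by (simp add: algebra_simps)
  qed
  ultimately have cl: "closed_csubspace {k\<in>UNIV. E k \<in> {0}}"
    by (rule closed_csubspace_preimage[OF closed_csubspace_UNIV]) (simp_all add: closed_csubspace_def csubspaceI)
  \<comment> \<open>On a kernel the backward shifts act by the scalars \<open>cnj (w $ i)\<close>,
    so the argument of \<open>U\<close> is the one in \<open>U_res\<close>.\<close>
  have "E (E2.kern w e) = 0" if w: "w \<in> unit_ball" for w e
  proof -
    have "arg (E2.kern w e) = (P2 e, col_op w (res w (P2 e)))"
      by (simp add: arg_def E2.ev_kern[OF w z0] E2.bwd_kern[OF w] \<Gamma>' \<Gamma>k[OF w] col_op_def)
    then have "U (arg (E2.kern w e)) = (dual w (P2 e), res w (P2 e))"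
      by (simp add: U_res[OF w P2(1)])
    then show ?thesis
      by (simp add: E_def Gk[OF w] \<Gamma>k[OF w] E1.ev_kern[OF w z0] D_def zero_prod_def)
  qed
  then have "E k = 0" for k
    using E2.kernels_induct[OF cl, of k] by simp
  then have rel: "ev1 (G k) 0 = V1 (fst (U (arg k)))" "\<Gamma> k = snd (U (arg k))" for k
    by (simp_all add: E_def zero_prod_def)
  show ?thesis
    by (rule that[OF Glin Gn \<Gamma>lin \<Gamma>n \<Gamma>R _ adjM comm rel[unfolded arg_def]]) (use evM Mn in blast)
qed

lemma contractive_multiplier_Phi: "contractive_multiplier ev1 ev2 \<Phi>"
proof -
  have "clinear_on UNIV (blinfun_apply (\<Phi> z))" if "z \<in> unit_ball" for z
    using clinear_Phi[OF that] \<Phi>[OF that] by (simp add: clinear_on_def)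
  moreover have "\<exists>g. (\<forall>z\<in>unit_ball. ev2 g z = \<Phi> z (ev1 f z)) \<and> norm g \<le> norm f" for f
    by (rule multiplier_model) blast
  ultimately show ?thesis
    unfolding contractive_multiplier_def using holomorphic_Phi by blast
qed

end

section \<open>Commutant lifting\<close>

locale coinvariant_subspace = drury_arveson_space ev
  for ev :: "'h::chilbert_space \<Rightarrow> complex ^ 'n::finite \<Rightarrow> 'e::chilbert_space" +
  fixes Q :: "'h set"
  assumes Q: "coinvariant ev Q"
begin

lemma clQ: "closed_csubspace Q" and bwd_in: "f \<in> Q \<Longrightarrow> bwd i f \<in> Q"
  using Q by (auto simp: coinvariant_def bwd_def)

lemmas csQ = closed_csubspaceD(1)[OF clQ]

abbreviation "T \<equiv> compression ev Q"
abbreviation "D \<equiv> defect Q T"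
abbreviation "DD \<equiv> defect_space Q T"

lemma compression_in: "T i f \<in> Q"
  unfolding compression_def by (rule closed_csubspace_proj(1)[OF clQ])

lemma cinner_compression: "k \<in> Q \<Longrightarrow> cinner (T i f) k = cinner f (bwd i k)"
  unfolding compression_def by (simp add: closed_csubspace_proj(3)[OF clQ] cinner_bwd)

text \<open>Co-invariance keeps the backward shift inside \<open>Q\<close>, so the adjoint of a
  compression is a plain restriction.\<close>

lemma adj_compression: "k \<in> Q \<Longrightarrow> adj Q (T i) k = bwd i k"
  by (rule adj_eqI[OF csQ]) (simp_all add: bwd_in cinner_compression)

text \<open>The square of the defect operator subtracts the Gram forms of the backward shifts from
  the inner product; by \<open>cinner_gleason\<close> only evaluation at 0 remains.\<close>

lemma defect_props:
  shows clinear_defect: "clinear_on Q D"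
    and cinner_defect: "x \<in> Q \<Longrightarrow> y \<in> Q \<Longrightarrow> cinner (D x) (D y) = cinner (ev x 0) (ev y 0)"
proof -
  define G where "G x = (\<chi> i. bwd i x)" for x
  have G: "clinear_on Q G"
    by (rule clinear_onI) (simp_all add: G_def bwd_linear vec_eq_iff scaleC_vec_def)
  have cG: "cinner (G x) (G y) = (\<Sum>i\<in>UNIV. cinner (bwd i x) (bwd i y))" for x y
    by (simp add: G_def cinner_vec_def)
  have nG: "norm (G x) \<le> norm x" for x
  proof (rule power2_le_imp_le)
    have "(norm (G x))\<^sup>2 = (\<Sum>i\<in>UNIV. (norm (bwd i x))\<^sup>2)"
      by (simp add: G_def norm_vec_def L2_set_def sum_nonneg)
    then show "(norm (G x))\<^sup>2 \<le> (norm x)\<^sup>2" using norm_gleason[of x] by simp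
  qed simp
  define P where "P x = x - (\<Sum>i\<in>UNIV. T i (adj Q (T i) x))" for x
  have PQ: "P x \<in> Q" if "x \<in> Q" for x
    unfolding P_def using that csQ
    by (intro csubspace_closed_ops(3) complex_vector.subspace_sum compression_in)
  have cP: "cinner (P x) y = cinner x y - cinner (G x) (G y)" if "x \<in> Q" "y \<in> Q" for x y
    using that by (simp add: P_def cinner.diff_left cinner.sum_left cinner_compression adj_compression cG)
  have D: "D = sqrt_op Q P" by (simp add: defect_def P_def[abs_def])
  note * = sqrt_op_gram[OF clQ G nG PQ cP]
  show "clinear_on Q D" unfolding D by (rule *(2)) auto
  show "cinner (D x) (D y) = cinner (ev x 0) (ev y 0)" if "x \<in> Q" "y \<in> Q"
  proof -
    have "cinner (D x) (D y) = cinner x y - cinner (G x) (G y)"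
      unfolding D by (rule *(3)) (use that in auto)
    then show ?thesis using cinner_gleason[of x y] by (simp add: cG)
  qed
qed

lemma closed_csubspace_defect_space: "closed_csubspace DD"
  unfolding defect_space_def
  by (intro closed_csubspace_closure clinear_on_image_csubspace csQ clinear_defect)

lemma defect_in_defect_space: "x \<in> Q \<Longrightarrow> D x \<in> DD"
  unfolding defect_space_def by (rule subsetD[OF closure_subset]) (rule imageI)

lemma defect_embedding_exists:
  obtains V where "defect_embedding ev Q V"
proof -
  obtain V where V: "unitary_op (closure (cspan (D ` Q))) (closure (cspan ((\<lambda>f. ev f 0) ` Q))) V"
    "\<And>f. f \<in> Q \<Longrightarrow> V (D f) = ev f 0"
    by (rule gram_unitary[of Q D "\<lambda>f. ev f 0", OF cinner_defect]) blast+
  have "cspan (D ` Q) = D ` Q"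
    using clinear_on_image_csubspace[OF csQ clinear_defect] complex_vector.span_eq_iff by blast
  then have "unitary_op DD (closure (cspan ((\<lambda>f. ev f 0) ` Q))) V"
    using V(1) by (simp only: defect_space_def)
  then have "defect_embedding ev Q V"
    unfolding defect_embedding_def unitary_op_def
    using V(2) norm_eq_if_cinner_eq by blast
  then show ?thesis by (rule that)
qed

end

locale commutant_lifting =
  E1: coinvariant_subspace ev1 Q1 + E2: coinvariant_subspace ev2 Q2
  for ev1 :: "'h1::chilbert_space \<Rightarrow> complex ^ 'n::finite \<Rightarrow> 'e1::chilbert_space"
    and ev2 :: "'h2::chilbert_space \<Rightarrow> complex ^ 'n \<Rightarrow> 'e2::chilbert_space"
    and Q1 Q2 +
  fixes X :: "'h1 \<Rightarrow> 'h2"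
  assumes X: "contraction_op Q1 Q2 X"
    and intertwine: "f \<in> Q1 \<Longrightarrow> X (compression ev1 Q1 i f) = compression ev2 Q2 i (X f)"
begin

abbreviation "Xa \<equiv> adj Q1 X"
abbreviation "DX \<equiv> star_defect Q1 Q2 X"
abbreviation "R0 \<equiv> closure ((\<lambda>k. k - X (Xa k)) ` Q2)"

lemma X_in: "f \<in> Q1 \<Longrightarrow> X f \<in> Q2" and X_lin: "clinear_on Q1 X"
    and X_le: "f \<in> Q1 \<Longrightarrow> norm (X f) \<le> 1 * norm f"
  using X by (auto simp: contraction_op_def bounded_op_def)

lemma Xa_in: "Xa k \<in> Q1"
  by (rule adj_in[OF E1.clQ X_lin X_le])

lemma cinner_Xa: "f \<in> Q1 \<Longrightarrow> cinner f (Xa k) = cinner (X f) k"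
  by (rule cinner_adj[OF E1.clQ X_lin X_le])

lemma Xa_lin: "clinear_on W Xa"
  by (rule clinear_adj[OF E1.clQ X_lin X_le])

lemma norm_Xa: "norm (Xa k) \<le> norm k"
  using norm_adj_le[OF E1.clQ X_lin X_le] by simp

lemma Xa_bwd: "k \<in> Q2 \<Longrightarrow> Xa (E2.bwd i k) = E1.bwd i (Xa k)"
proof (rule cinner_ext_on[OF E1.csQ])
  assume k: "k \<in> Q2"
  show "Xa (E2.bwd i k) \<in> Q1" by (rule Xa_in)
  show "E1.bwd i (Xa k) \<in> Q1" by (intro E1.bwd_in Xa_in)
  fix v assume v: "v \<in> Q1"
  have "cinner v (Xa (E2.bwd i k)) = cinner (compression ev2 Q2 i (X v)) k"
    by (simp add: cinner_Xa[OF v] E2.cinner_compression[OF k])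
  also have "\<dots> = cinner (compression ev1 Q1 i v) (Xa k)"
    by (simp add: cinner_Xa[OF E1.compression_in] intertwine[OF v])
  also have "\<dots> = cinner v (E1.bwd i (Xa k))" by (rule E1.cinner_compression[OF Xa_in])
  finally show "cinner v (Xa (E2.bwd i k)) = cinner v (E1.bwd i (Xa k))" .
qed

lemma star_defect_props:
  shows DX_in: "k \<in> Q2 \<Longrightarrow> DX k \<in> R0"
    and cinner_DX: "k \<in> Q2 \<Longrightarrow> l \<in> Q2 \<Longrightarrow> cinner (DX k) (DX l) = cinner k l - cinner (Xa k) (Xa l)"
    and closed_R0: "closed_csubspace R0"
proof -
  let ?P = "\<lambda>k. k - X (Xa k)"
  have PQ: "?P k \<in> Q2" if "k \<in> Q2" for k
    by (rule csubspace_closed_ops(3)[OF E2.csQ that X_in[OF Xa_in]])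
  have cP: "cinner (?P k) l = cinner k l - cinner (Xa k) (Xa l)" if "k \<in> Q2" "l \<in> Q2" for k l
    by (simp add: cinner.diff_left cinner_Xa[OF Xa_in])
  note * = sqrt_op_gram[OF E2.clQ Xa_lin norm_Xa PQ cP, folded star_defect_def]
  show "k \<in> Q2 \<Longrightarrow> DX k \<in> R0" by (rule *(4)) auto
  show "k \<in> Q2 \<Longrightarrow> l \<in> Q2 \<Longrightarrow> cinner (DX k) (DX l) = cinner k l - cinner (Xa k) (Xa l)"
    by (rule *(3)) auto
  have "clinear_on Q2 ?P" by (rule *(5)) auto
  then show "closed_csubspace R0"
    by (intro closed_csubspace_closure clinear_on_image_csubspace E2.csQ)
qed

lemma norm_DX: "k \<in> Q2 \<Longrightarrow> norm (DX k) \<le> norm k"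
proof (rule power2_le_imp_le)
  assume k: "k \<in> Q2"
  have "complex_of_real ((norm (DX k))\<^sup>2) = complex_of_real ((norm k)\<^sup>2 - (norm (Xa k))\<^sup>2)"
    using cinner_DX[OF k k] by (simp add: cinner_self)
  then have "(norm (DX k))\<^sup>2 = (norm k)\<^sup>2 - (norm (Xa k))\<^sup>2" by (simp only: of_real_eq_iff)
  then show "(norm (DX k))\<^sup>2 \<le> (norm k)\<^sup>2" by simp
qed simp

text \<open>Both sides equal <k,l> - \<Sum> <M_i^* X^* k, M_i^* X^* l>: the left by
  \<open>cinner_gleason\<close> for \<open>k\<close>, \<open>l\<close> and by \<open>Xa_bwd\<close>,
  the right by \<open>cinner_gleason\<close> for the images under \<open>Xa\<close>. So the relation
  prescribed for \<open>U\<close> defines an isometry.\<close>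

lemma lurking_gram:
  assumes k: "k \<in> Q2" and l: "l \<in> Q2"
  shows "cinner (E2.D k, \<chi> i. (DX (E2.bwd i k), 0 :: 'l::chilbert_space)) (E2.D l, \<chi> i. (DX (E2.bwd i l), 0)) =
    cinner (E1.D (Xa k), (DX k, 0 :: 'l)) (E1.D (Xa l), (DX l, 0))"
  using E2.cinner_gleason[of k l] E1.cinner_gleason[of "Xa k" "Xa l"] k l
  by (simp add: cinner_prod_def cinner_vec_def[of "\<chi> i. _ i"] E2.cinner_defect E1.cinner_defect Xa_in
      cinner_DX E2.bwd_in Xa_bwd sum_subtractf)

lemma closed_state_space: "closed_csubspace L \<Longrightarrow> closed_csubspace (state_space Q1 Q2 X L)"
  unfolding state_space_def by (intro closed_csubspace_Times closed_R0)

lemma lifting_transfer: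
  fixes L :: "'l::chilbert_space set"
  assumes L: "closed_csubspace L"
    and lift: "lifting_unitary Q1 Q2 X (compression ev1 Q1) (compression ev2 Q2) L U"
  shows "\<exists>\<Phi>. contractive_multiplier ev1 ev2 \<Phi> \<and>
    (\<forall>k\<in>Q2. Xa k = adj UNIV (mult_op ev1 ev2 (\<lambda>z. blinfun_apply (\<Phi> z))) k) \<and>
    is_transfer_multiplier ev1 ev2 Q1 Q2 X L U \<Phi>"
proof -
  obtain V1 where emb1: "defect_embedding ev1 Q1 V1" by (rule E1.defect_embedding_exists)
  obtain V2 where emb2: "defect_embedding ev2 Q2 V2" by (rule E2.defect_embedding_exists)
  interpret transfer_multiplier E2.DD E1.DD "state_space Q1 Q2 X L" U ev1 ev2 V1 V2
    using emb1 emb2 lift closed_state_space[OF L]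
    by unfold_locales
      (auto simp: E1.closed_csubspace_defect_space E2.closed_csubspace_defect_space
        lifting_unitary_def defect_embedding_def)
  obtain G \<Gamma> where G: "clinear_on UNIV G" "\<And>k. norm (G k) \<le> norm k"
    and \<Gamma>: "clinear_on UNIV \<Gamma>" "\<And>k. norm (\<Gamma> k) \<le> norm k" "\<And>k. \<Gamma> k \<in> state_space Q1 Q2 X L"
    and adjG: "\<And>k. adj UNIV (mult_op ev1 ev2 (\<lambda>z. blinfun_apply (\<Phi> z))) k = G k"
    and Gb: "\<And>i k. E1.bwd i (G k) = G (E2.bwd i k)"
    and rel1: "\<And>k. ev1 (G k) 0 = V1 (fst (U (P2 (ev2 k 0), \<chi> i. \<Gamma> (E2.bwd i k))))"
    and rel2: "\<And>k. \<Gamma> k = snd (U (P2 (ev2 k 0), \<chi> i. \<Gamma> (E2.bwd i k)))"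
    by (rule multiplier_model) blast
  have z0: "(0 :: complex ^ 'n) \<in> unit_ball" by simp
  define \<Delta> where "\<Delta> k = \<Gamma> k - (DX k, 0)" for k
  define H where "H k = G k - Xa k" for k
  \<comment> \<open>Both pairs are values of \<open>U\<close> at arguments with the same first
    component \<open>E2.D k\<close>. Their difference is \<open>U\<close> at an argument with first
    component 0, and \<open>U\<close> preserves norms.\<close>
  have main: "(norm (\<Delta> k))\<^sup>2 + (norm (ev1 (H k) 0))\<^sup>2 = (\<Sum>i\<in>UNIV. (norm (\<Delta> (E2.bwd i k)))\<^sup>2)"
    if k: "k \<in> Q2" for k
  proof -
    have Dk: "E2.D k \<in> E2.DD" by (rule E2.defect_in_defect_space[OF k])
    have "V2 (E2.D k) = ev2 k 0" using emb2 k by (simp add: defect_embedding_def)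
    then have P2k: "P2 (ev2 k 0) = E2.D k" using P2_V2[OF Dk] by simp
    let ?v = "\<chi> i. \<Gamma> (E2.bwd i k)" and ?v' = "\<chi> i. (DX (E2.bwd i k), 0 :: 'l)"
    have v: "?v \<in> P" by (simp add: power_space_def \<Gamma>)
    have v': "?v' \<in> P"
      using csubspace_closed_ops(1)[OF closed_csubspaceD(1)[OF L]]
      by (simp add: power_space_def state_space_def DX_in E2.bwd_in k)
    let ?u = "U (E2.D k, ?v)" and ?u' = "U (E2.D k, ?v')"
    have u': "?u' = (E1.D (Xa k), (DX k, 0))"
      using lift k by (auto simp: lifting_unitary_def E2.adj_compression)
    have u: "ev1 (G k) 0 = V1 (fst ?u)" "\<Gamma> k = snd ?u"
      using rel1[of k] rel2[of k] by (simp_all only: P2k)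
    have fu: "fst ?u \<in> E1.DD" "fst ?u' \<in> E1.DD" using U_in[OF Dk v] U_in[OF Dk v'] by auto
    have "V1 (fst ?u') = ev1 (Xa k) 0"
      using emb1 Xa_in by (simp add: u' defect_embedding_def)
    then have evH: "ev1 (H k) 0 = V1 (fst ?u - fst ?u')"
      by (simp add: H_def E1.ev_linear[OF z0] u(1) V1_linear(3)[OF fu])
    have nH: "norm (ev1 (H k) 0) = norm (fst ?u - fst ?u')"
      unfolding evH using emb1 csubspace_closed_ops(3)[OF csDT fu]
      by (simp add: defect_embedding_def)
    have n\<Delta>: "\<Delta> k = snd ?u - snd ?u'" by (simp add: \<Delta>_def u(2) u')
    have vv: "?v - ?v' \<in> P" by (rule csubspace_closed_ops(3)[OF csP v v'])
    have "?u - ?u' = U (0, ?v - ?v')"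
      using clinear_on_ops(3)[OF U_lin csV, of "(E2.D k, ?v)" "(E2.D k, ?v')"] Dk v v' by simp
    then have "norm (?u - ?u') = norm (?v - ?v')"
      using norm_U[OF zDS vv] by (simp add: norm_Pair)
    then have "(norm (?u - ?u'))\<^sup>2 = (norm (?v - ?v'))\<^sup>2" by simp
    moreover have "(norm (?u - ?u'))\<^sup>2 = (norm (fst ?u - fst ?u'))\<^sup>2 + (norm (snd ?u - snd ?u'))\<^sup>2"
      by (simp add: norm_prod_def)
    moreover have "(norm (?v - ?v'))\<^sup>2 = (\<Sum>i\<in>UNIV. (norm (\<Delta> (E2.bwd i k)))\<^sup>2)"
      by (simp add: norm_vec_def L2_set_def sum_nonneg \<Delta>_def)
    ultimately show ?thesis by (simp only: nH n\<Delta>)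
  qed
  have HB: "E1.bwd i (H k) = H (E2.bwd i k)" if "k \<in> Q2" for i k
    by (simp add: H_def E1.bwd_linear Gb Xa_bwd[OF that])
  have "(\<Delta> k, H k) = 0" if k: "k \<in> Q2" for k
  proof (rule E2.pure_zero[of Q2 "\<lambda>k. (\<Delta> k, H k)" 4, OF _ _ _ k])
    show "E2.bwd i f \<in> Q2" if "f \<in> Q2" for f i using that by (rule E2.bwd_in)
    \<comment> \<open>\<open>\<Gamma>\<close>, \<open>DX\<close>, \<open>G\<close> and
      \<open>Xa\<close> are contractions, hence the constant 4.\<close>
    show "norm (\<Delta> f, H f) \<le> 4 * norm f" if f: "f \<in> Q2" for f
    proof -
      have "norm (\<Delta> f, H f) \<le> norm (\<Delta> f) + norm (H f)" by (rule norm_Pair_le)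
      moreover have "norm (\<Delta> f) \<le> norm (\<Gamma> f) + norm (DX f)"
        unfolding \<Delta>_def using norm_triangle_ineq4[of "\<Gamma> f" "(DX f, 0)"] by (simp add: norm_Pair)
      moreover have "norm (H f) \<le> norm (G f) + norm (Xa f)"
        unfolding H_def by (rule norm_triangle_ineq4)
      ultimately show ?thesis using \<Gamma>(2)[of f] G(2)[of f] norm_DX[OF f] norm_Xa[of f] by linarith
    qed
    \<comment> \<open>\<open>E1.norm_gleason\<close> for \<open>H f\<close> trades the value at 0 in
      \<open>main\<close> for the norm of \<open>H f\<close> minus the backward terms. The result is
      an equality.\<close>
    show "(norm (\<Delta> f, H f))\<^sup>2 \<le> (\<Sum>i\<in>UNIV. (norm (\<Delta> (E2.bwd i f), H (E2.bwd i f)))\<^sup>2)"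
      if f: "f \<in> Q2" for f
    proof -
      have "(norm (a, b))\<^sup>2 = (norm a)\<^sup>2 + (norm b)\<^sup>2"
        for a :: "'h2 \<times> 'l" and b :: 'h1
        by (simp add: norm_prod_def)
      then show ?thesis
        using main[OF f] E1.norm_gleason[of "H f"] by (simp add: HB[OF f] sum.distrib)
    qed
  qed
  then have "Xa k = G k" if "k \<in> Q2" for k using that by (simp add: H_def zero_prod_def)
  moreover have "is_transfer_multiplier ev1 ev2 Q1 Q2 X L U \<Phi>"
    unfolding is_transfer_multiplier_def
    using emb1 emb2 by (intro exI[of _ V1] exI[of _ V2])
      (simp add: \<Phi> transfer_adj_eq_out[OF _ P1(1)] P1_def[symmetric] del: mem_ball_0)
  ultimately show ?thesis using contractive_multiplier_Phi adjG by auto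
qed

section \<open>Existence of the lifting unitary\<close>

lemma cspan_image_onto:
  assumes "clinear_on UNIV F" "surj F" "UNIV \<subseteq> cspan S"
  shows "UNIV \<subseteq> cspan (F ` S)"
proof -
  have "cspan S \<subseteq> {p. F p \<in> cspan (F ` S)}"
    by (rule complex_vector.span_minimal)
      (auto intro!: csubspace_vimage_clinear complex_vector.span_base assms(1))
  then have "F p \<in> cspan (F ` S)" for p using assms(3) by blast
  then show ?thesis using assms(2) by (metis subsetI surjD)
qed

text \<open>A finite spanning set projects to finite spanning sets of both factors, which forces
  both coefficient spaces, and with them both function spaces, to be zero. The dichotomy is what
  \<open>power_embedding\<close> asks for.\<close>

lemma state_dimension:
  "(UNIV :: ('h1 \<times> 'h2) set) = {0} \<or> \<not> (\<exists>F :: ('h1 \<times> 'h2) set. finite F \<and> UNIV \<subseteq> cspan F)"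
proof (rule disjCI)
  assume "\<not> \<not> (\<exists>F :: ('h1 \<times> 'h2) set. finite F \<and> UNIV \<subseteq> cspan F)"
  then obtain F :: "('h1 \<times> 'h2) set" where F: "finite F" "UNIV \<subseteq> cspan F" by blast
  have "UNIV \<subseteq> cspan (fst ` F)"
    by (rule cspan_image_onto[OF _ _ F(2)]) (simp_all add: clinear_on_def scaleC_prod_def)
  then have e1: "e = 0" for e :: 'e1 using E1.infinite_dimensional[of e "fst ` F"] F(1) by blast
  have "UNIV \<subseteq> cspan (snd ` F)"
    by (rule cspan_image_onto[OF _ _ F(2)]) (simp_all add: clinear_on_def scaleC_prod_def)
  then have e2: "e = 0" for e :: 'e2 using E2.infinite_dimensional[of e "snd ` F"] F(1) by blast
  have "f = 0" for f :: 'h1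
    by (rule E1.ev_inject) (metis e1)
  moreover have "f = 0" for f :: 'h2
    by (rule E2.ev_inject) (metis e2)
  ultimately have "p = 0" for p :: "'h1 \<times> 'h2" by (simp add: prod_eq_iff)
  then show "(UNIV :: ('h1 \<times> 'h2) set) = {0}" by auto
qed

lemma lifting_unitary_exists:
  obtains U where "lifting_unitary Q1 Q2 X (compression ev1 Q1) (compression ev2 Q2)
    (UNIV :: ('h1 \<times> 'h2) set) U"
proof -
  define R where "R = state_space Q1 Q2 X (UNIV :: ('h1 \<times> 'h2) set)"
  have R: "closed_csubspace R" unfolding R_def by (rule closed_state_space[OF closed_csubspace_UNIV])
  define V where "V = E2.DD \<times> (power_space R :: (('h2 \<times> ('h1 \<times> 'h2)) ^ 'n) set)"
  define W where "W = E1.DD \<times> R"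
  have V: "closed_csubspace V"
    unfolding V_def by (intro closed_csubspace_Times closed_csubspace_power_space R E2.closed_csubspace_defect_space)
  have W: "closed_csubspace W"
    unfolding W_def by (intro closed_csubspace_Times R E1.closed_csubspace_defect_space)
  define h where "h k = (E2.D k, \<chi> i. (DX (E2.bwd i k), 0 :: 'h1 \<times> 'h2) :: (_ ^ 'n))" for k
  define g where "g k = (E1.D (Xa k), (DX k, 0 :: 'h1 \<times> 'h2))" for k
  define M where "M = closure (cspan (h ` Q2))"
  define N where "N = closure (cspan (g ` Q2))"
  have M: "closed_csubspace M" and N: "closed_csubspace N"
    unfolding M_def N_def by (rule closed_csubspace_closure_cspan)+
  have hM: "k \<in> Q2 \<Longrightarrow> h k \<in> M" for k
    unfolding M_def using closure_cspan_superset[of "h ` Q2"] by blast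
  have gram: "cinner (h k) (h l) = cinner (g k) (g l)" if "k \<in> Q2" "l \<in> Q2" for k l
    unfolding h_def g_def by (rule lurking_gram[OF that])
  obtain F where F: "unitary_op M N F" "\<And>k. k \<in> Q2 \<Longrightarrow> F (h k) = g k"
    unfolding M_def N_def by (rule gram_unitary[of Q2 h g, OF gram]) blast+
  have "h k \<in> V" if "k \<in> Q2" for k
    using that by (simp add: h_def V_def R_def E2.defect_in_defect_space power_space_def
        state_space_def DX_in E2.bwd_in)
  then have MV: "M \<subseteq> V" unfolding M_def by (intro closure_cspan_minimal V) auto
  have "g k \<in> W" if "k \<in> Q2" for k
    using that by (simp add: g_def W_def R_def E1.defect_in_defect_space state_space_def DX_in Xa_in)
  then have NW: "N \<subseteq> W" unfolding N_def by (intro closure_cspan_minimal W) auto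
  define C where "C = {x\<in>V. \<forall>y\<in>M. cinner x y = 0}"
  define C' where "C' = {x\<in>W. \<forall>y\<in>N. cinner x y = 0}"
  have C: "closed_csubspace C" and C': "closed_csubspace C'"
    unfolding C_def C'_def by (rule closed_csubspace_subset_complement[OF V], rule closed_csubspace_subset_complement[OF W])
  obtain j2 :: "('h1 \<times> 'h2) ^ bool \<Rightarrow> 'h1 \<times> 'h2" where
    j2: "clinear_on UNIV j2" "\<And>x y. cinner (j2 x) (j2 y) = cinner x y"
    by (rule power_embedding[OF state_dimension]) blast
  obtain jn :: "('h1 \<times> 'h2) ^ 'n \<Rightarrow> 'h1 \<times> 'h2" where
    jn: "clinear_on UNIV jn" "\<And>x y. cinner (jn x) (jn y) = cinner x y"
    by (rule power_embedding[OF state_dimension]) blast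
  note j2' = clinear_on_ops[OF j2(1), simplified] and jn' = clinear_on_ops[OF jn(1), simplified]
  \<comment> \<open>\<open>pr\<close> and \<open>jn\<close> pack two, respectively n, copies of
    \<open>'h1 \<times> 'h2\<close> into one, so that finite sums can be encoded
    isometrically.\<close>
  define pr where "pr p q = j2 (\<chi> b. if b then p else q)" for p q
  have pr_add: "pr (p + p') (q + q') = pr p q + pr p' q'" for p q p' q'
    unfolding pr_def j2'(2)[symmetric] by (rule arg_cong[of _ _ j2]) (simp add: vec_eq_iff)
  have pr_scale: "pr (c *\<^sub>C p) (c *\<^sub>C q) = c *\<^sub>C pr p q" for c p q
    unfolding pr_def j2'(4)[symmetric] by (rule arg_cong[of _ _ j2]) (simp add: vec_eq_iff scaleC_vec_def)
  have pr_cinner: "cinner (pr p q) (pr p' q') = cinner p p' + cinner q q'" for p q p' q'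
    by (simp add: pr_def j2(2) cinner_vec_def UNIV_bool add.commute)
  \<comment> \<open>\<open>j\<close> and \<open>j'\<close> encode the ambient spaces of domain and
    range in one copy of \<open>'h1 \<times> 'h2\<close>. A component that lies in
    \<open>'h2\<close> alone is padded with 0.\<close>
  define j where "j x = pr (0, fst x) (jn (\<chi> i. pr (0, fst (snd x $ i)) (snd (snd x $ i))))"
    for x :: "'h2 \<times> (('h2 \<times> ('h1 \<times> 'h2)) ^ 'n)"
  define j' where "j' y = pr (fst y, fst (snd y)) (snd (snd y))" for y :: "'h1 \<times> ('h2 \<times> ('h1 \<times> 'h2))"
  have j_add: "j (x + y) = j x + j y" for x y
  proof -
    have "pr (0, fst (snd (x + y) $ i)) (snd (snd (x + y) $ i)) =
        pr (0, fst (snd x $ i)) (snd (snd x $ i)) + pr (0, fst (snd y $ i)) (snd (snd y $ i))" for i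
      by (simp add: pr_add[symmetric])
    then have "(\<chi> i. pr (0, fst (snd (x + y) $ i)) (snd (snd (x + y) $ i))) =
        (\<chi> i. pr (0, fst (snd x $ i)) (snd (snd x $ i))) + (\<chi> i. pr (0, fst (snd y $ i)) (snd (snd y $ i)))"
      by (simp add: vec_eq_iff del: snd_add)
    then show ?thesis unfolding j_def by (simp add: jn' pr_add[symmetric] del: snd_add)
  qed
  have j_scale: "j (c *\<^sub>C x) = c *\<^sub>C j x" for c x
  proof -
    have "pr (0, fst (snd (c *\<^sub>C x) $ i)) (snd (snd (c *\<^sub>C x) $ i)) =
        c *\<^sub>C pr (0, fst (snd x $ i)) (snd (snd x $ i))" for i
      unfolding pr_scale[symmetric] by (simp add: scaleC_prod_def scaleC_vec_def)
    then have "(\<chi> i. pr (0, fst (snd (c *\<^sub>C x) $ i)) (snd (snd (c *\<^sub>C x) $ i))) =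
        c *\<^sub>C (\<chi> i. pr (0, fst (snd x $ i)) (snd (snd x $ i)))"
      by (simp only: vec_eq_iff scaleC_vec_def vec_lambda_beta) simp
    moreover have "(0, fst (c *\<^sub>C x)) = c *\<^sub>C (0 :: 'h1, fst x)"
      by (simp add: scaleC_prod_def)
    ultimately show ?thesis unfolding j_def by (simp only: jn' pr_scale)
  qed
  have j_cinner: "cinner (j x) (j y) = cinner x y" for x y
    by (simp only: j_def pr_cinner jn(2) cinner_vec_def vec_lambda_beta) (simp add: cinner_prod_def cinner_vec_def)
  have j'_add: "j' (x + y) = j' x + j' y" for x y
    by (simp add: j'_def pr_add[symmetric])
  have j'_scale: "j' (c *\<^sub>C x) = c *\<^sub>C j' x" for c x
    unfolding j'_def pr_scale[symmetric] by (simp add: scaleC_prod_def)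
  have j'_cinner: "cinner (j' x) (j' y) = cinner x y" for x y
    by (simp only: j'_def pr_cinner) (simp add: cinner_prod_def)
  obtain i0 :: 'n where True by blast
  \<comment> \<open>The code goes into the auxiliary summand, where all \<open>g k\<close> and
    \<open>h k\<close> have entry 0, so the images lie in the orthogonal complements. For
    \<open>v\<close> a single one of the n copies of the state space is enough.\<close>
  define u where "u x = (0 :: 'h1, (0 :: 'h2, j x))" for x
  define v where "v y = (0 :: 'h2, axis i0 (0 :: 'h2, j' y) :: (_ ^ 'n))" for y
  have z: "0 \<in> E1.DD" "0 \<in> E2.DD" "0 \<in> R0"
    using csubspace_closed_ops(1) closed_csubspaceD(1) E1.closed_csubspace_defect_space
      E2.closed_csubspace_defect_space closed_R0 by blast+
  have uC: "u x \<in> C'" for x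
  proof -
    have "cinner y (u x) = 0" if "y \<in> N" for y
      using that unfolding N_def
      by (rule orthogonal_closure_cspan[rotated]) (auto simp: g_def u_def cinner_prod_def)
    then have "cinner (u x) y = 0" if "y \<in> N" for y using that cinner_zero_commute by blast
    moreover have "u x \<in> W" using z by (simp add: u_def W_def R_def state_space_def)
    ultimately show ?thesis by (simp add: C'_def)
  qed
  have vC: "v y \<in> C" for y
  proof -
    have "cinner x (v y) = 0" if "x \<in> M" for x
      using that unfolding M_def
      by (rule orthogonal_closure_cspan[rotated])
        (auto simp: h_def v_def cinner_prod_def cinner_axis)
    then have "cinner (v y) x = 0" if "x \<in> M" for x using that cinner_zero_commute by blast
    moreover have "v y \<in> V"
      using z by (simp add: v_def V_def R_def state_space_def power_space_def axis_def zero_prod_def)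
    ultimately show ?thesis by (simp add: C_def)
  qed
  obtain G where G: "unitary_op C C' G"
  proof (rule unitary_schroeder_bernstein[OF C C', of u v])
    show "clinear_on C u"
      by (rule clinear_onI; unfold u_def j_add j_scale) (simp_all add: scaleC_prod_def)
    show "clinear_on C' v"
      by (rule clinear_onI; unfold v_def j'_add j'_scale)
        (simp_all add: scaleC_prod_def scaleC_vec_def axis_def vec_eq_iff zero_prod_def)
    show "cinner (u x) (u y) = cinner x y" for x y
      by (simp add: u_def cinner_prod_def j_cinner[unfolded cinner_prod_def])
    show "cinner (v x) (v y) = cinner x y" for x y
      by (simp add: v_def cinner_prod_def[of "(0, _)"] cinner_axis j'_cinner)
  qed (use uC vC in auto)
  have Gp: "clinear_on C G" "G ` C = C'" "\<And>x y. x \<in> C \<Longrightarrow> y \<in> C \<Longrightarrow> cinner (G x) (G y) = cinner x y"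
    using G by (auto simp: unitary_op_def bij_betw_def)
  obtain U where U: "unitary_op V W U" "\<And>x. x \<in> M \<Longrightarrow> U x = F x"
  proof (rule unitary_op_direct_sum[OF V W M MV NW _ F(1), of C' G, folded C_def])
    show "C' \<subseteq> W" by (auto simp: C'_def)
    show "cinner x y = 0" if "x \<in> N" "y \<in> C'" for x y
      using that by (subst cinner_zero_commute) (simp add: C'_def)
    show "y = 0" if "y \<in> W" "\<And>x. x \<in> N \<Longrightarrow> cinner x y = 0" "\<And>x. x \<in> C' \<Longrightarrow> cinner x y = 0" for y
    proof -
      have "\<forall>x\<in>N. cinner y x = 0" using that(2) cinner_zero_commute by blast
      then have "y \<in> C'" using that(1) by (simp add: C'_def)
      then show ?thesis using that(3)[of y] by (simp add: cinner_self)
    qed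
  qed (use Gp in auto)
  have "lifting_unitary Q1 Q2 X (compression ev1 Q1) (compression ev2 Q2) (UNIV :: ('h1 \<times> 'h2) set) U"
    unfolding lifting_unitary_def
  proof (intro conjI ballI)
    show "unitary_op (E2.DD \<times> power_space (state_space Q1 Q2 X UNIV)) (E1.DD \<times> state_space Q1 Q2 X UNIV) U"
      using U(1) by (simp add: V_def W_def R_def)
    show "U (E2.D k, \<chi> i. (DX (adj Q2 (compression ev2 Q2 i) k), 0)) = (E1.D (Xa k), DX k, 0)"
      if "k \<in> Q2" for k
      using U(2)[OF hM[OF that]] F(2)[OF that] by (simp add: h_def g_def E2.adj_compression that)
  qed
  then show ?thesis by (rule that)
qed

end

text \<open>In the third part the auxiliary space and its type \<open>'l\<close> are arbitrary, so
  every admissible \<open>U\<close> gives a lifting. The second part supplies such a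
  \<open>U\<close>, with an auxiliary space that is zero or infinite dimensional, so the third is
  not vacuous.\<close>

theorem theorem3p7:
  fixes ev1 :: "'h1::chilbert_space \<Rightarrow> complex ^ 'n::finite \<Rightarrow> 'e1::chilbert_space"
    and ev2 :: "'h2::chilbert_space \<Rightarrow> complex ^ 'n \<Rightarrow> 'e2::chilbert_space"
    and Q1 :: "'h1 set" and Q2 :: "'h2 set" and X :: "'h1 \<Rightarrow> 'h2"
  assumes "drury_arveson ev1" and "drury_arveson ev2"
    and "coinvariant ev1 Q1" and "coinvariant ev2 Q2"
    and "contraction_op Q1 Q2 X"
    and "\<And>i f. f \<in> Q1 \<Longrightarrow> X (compression ev1 Q1 i f) = compression ev2 Q2 i (X f)"
  shows "(\<exists>\<Phi>. contractive_multiplier ev1 ev2 \<Phi> \<and>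
        (\<forall>k\<in>Q2. adj Q1 X k = adj UNIV (mult_op ev1 ev2 (\<lambda>z. blinfun_apply (\<Phi> z))) k)) \<and>
    (\<exists>(L :: ('h1 \<times> 'h2) set) U. closed_csubspace L \<and>
        (L = {0} \<or> \<not> (\<exists>F. finite F \<and> L \<subseteq> cspan F)) \<and>
        lifting_unitary Q1 Q2 X (compression ev1 Q1) (compression ev2 Q2) L U) \<and>
    (\<forall>(L :: 'l::chilbert_space set) U. closed_csubspace L \<longrightarrow>
        lifting_unitary Q1 Q2 X (compression ev1 Q1) (compression ev2 Q2) L U \<longrightarrow>
        (\<exists>\<Phi>. contractive_multiplier ev1 ev2 \<Phi> \<and>
          (\<forall>k\<in>Q2. adj Q1 X k = adj UNIV (mult_op ev1 ev2 (\<lambda>z. blinfun_apply (\<Phi> z))) k) \<and>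
          is_transfer_multiplier ev1 ev2 Q1 Q2 X L U \<Phi>))"
proof -
  interpret commutant_lifting ev1 ev2 Q1 Q2 X
    using assms by unfold_locales auto
  obtain U where U: "lifting_unitary Q1 Q2 X (compression ev1 Q1) (compression ev2 Q2)
      (UNIV :: ('h1 \<times> 'h2) set) U"
    by (rule lifting_unitary_exists)
  show ?thesis
  proof (intro conjI allI impI)
    show "\<exists>\<Phi>. contractive_multiplier ev1 ev2 \<Phi> \<and>
        (\<forall>k\<in>Q2. adj Q1 X k = adj UNIV (mult_op ev1 ev2 (\<lambda>z. blinfun_apply (\<Phi> z))) k)"
      using lifting_transfer[OF closed_csubspace_UNIV U] by blast
    show "\<exists>(L :: ('h1 \<times> 'h2) set) U. closed_csubspace L \<and>
        (L = {0} \<or> \<not> (\<exists>F. finite F \<and> L \<subseteq> cspan F)) \<and>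
        lifting_unitary Q1 Q2 X (compression ev1 Q1) (compression ev2 Q2) L U"
      using closed_csubspace_UNIV state_dimension U by blast
  qed (rule lifting_transfer)
qed

end
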